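(* Let $\alpha,\beta>0$, let $X=(X_t)_{t\ge0}$ be a $\Gamma(\alpha,\beta)$ process and $T=(T_t)_{t\ge0}$ an $\mathrm{LGNBC}(\mathbb R_+)$ subordinator independent of $X$ with quadruplet $(c,1/\alpha,0,\pi)$, and assume $\int_0^1\pi(dq)=\vartheta>0$ and $c\,\alpha\ge\vartheta$. Then $Y=(X_{T_t})_{t\ge0}$ is a Thorin subordinator with Thorin triplet $(c',0,\tau)$, where $$c'=\int_1^\infty\frac{\tau(dx)}{x},\qquad\tau=f_\sharp\pi+(c\,\alpha-\vartheta)\,\delta_\beta,$$ and $f:[0,1]\to[0,\beta]$ is given by $f(x)=\beta(1-x)$. Moreover, $\operatorname{supp}\tau\subseteq[0,\beta]$ and $Y\in\mathrm{BG}_0(c\,\alpha,\mathbb R_+)$.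
   Context: A $\Gamma(\alpha,\beta)$ process is a Lévy process with $E[e^{izX_1}]=(1-iz/\beta)^{-\alpha}$ (zero drift). Generalized negative binomial convolutions: $\mathrm{GNBC}(\mathbb R_+)$ is the class of weak limits of finite convolutions of negative binomial laws on $\mathbb N$ (probability generating function (p.g.f.) $(\frac{1-p}{1-pz})^{\beta'}$, $p\in(0,1)$, $\beta'>0$). Its members have p.g.f. $\varphi_0(z)=\exp\bigl(a(z-1)+\int_0^1\log\frac{1-q}{1-qz}\,\pi(dq)\bigr)$, with $a\ge0$ and $\pi$ a measure on $[0,1]$ with $\int_0^{1/2}q\,\pi(dq)<\infty$, $\int_{1/2}^1|\log(1-q)|\pi(dq)<\infty$ (in particular $\pi(\{1\})=0$). $\mathrm{LGNBC}(\mathbb R_+)$ with quadruplet $(c,\alpha_0,a,\pi)$, $c,\alpha_0>0$, is the law with p.g.f. $E[z^{T_1}]=z^c\varphi_0(z^{\alpha_0})$; it is infinitely divisible, and an LGNBC subordinator is a Lévy process $T$ with $\mathcal L(T_1)$ of this form. (So $T_t\stackrel d= ct+\alpha_0 N_t$ with $N$ a Lévy process whose unit-time law is the GNBC law.) A Thorin subordinator is an increasing Lévy process with $\mathcal L(Y_1)$ a weak limit of finite convolutions of gamma laws on $(0,\infty)$. It has Thorin triplet $(b,0,\tau)$, $\tau$ a measure on $(0,\infty)$ satisfying $\int_{(0,1]}(1+|\log x|)\tau(dx)+\int_{(1,\infty)}x^{-2}\tau(dx)<\infty$, if $\log E[e^{izY_1}]=izb-\int_0^\infty\bigl(\log(1-\frac{iz}{x})+\frac{iz}{x}\mathbf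 1_{\{x\ge1\}}\bigr)\tau(dx)$; its Lévy density is $k(x)/x$ with $k(x)=\int_0^\infty e^{-sx}\tau(ds)$. $f_\sharp\pi(B)=\pi(f^{-1}(B))$. $Y\in\mathrm{BG}_0(\zeta,\mathbb R_+)$ means that $Y$ is self-decomposable with Blumenthal--Getoor index $\inf\{p>0:\int_{\{|x|\le1\}}|x|^p\nu(dx)<\infty\}=0$ and $0<\zeta=k(0+)<\infty$; for Thorin subordinators $k(0+)=\tau((0,\infty))$. *)

theory Defs
  imports "HOL-Probability.Probability"
begin

text \<open>A measure on a Borel subset \<open>S\<close> of the real line is represented by a Borel measure on the
  whole line for which the complement of \<open>S\<close> is null.\<close>

definition measure_on :: "real set \<Rightarrow> real measure \<Rightarrow> bool" where
  "measure_on S \<mu> \<longleftrightarrow> sets \<mu> = sets borel \<and> emeasure \<mu> (- S) = 0"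

definition measure_plus :: "'a measure \<Rightarrow> 'a measure \<Rightarrow> 'a measure" where
  "measure_plus \<mu> \<nu> = measure_of (space \<mu>) (sets \<mu>) (\<lambda>A. emeasure \<mu> A + emeasure \<nu> A)"

lemma sets_measure_plus [simp]: "sets (measure_plus \<mu> \<nu>) = sets \<mu>"
  by (simp add: measure_plus_def)

lemma emeasure_measure_plus:
  assumes "sets \<nu> = sets \<mu>" and "A \<in> sets \<mu>"
  shows "emeasure (measure_plus \<mu> \<nu>) A = emeasure \<mu> A + emeasure \<nu> A"
proof (rule emeasure_measure_of[OF measure_plus_def])
  show "sets \<mu> \<subseteq> Pow (space \<mu>)" by (rule sets.space_closed)
  show "A \<in> sets (measure_plus \<mu> \<nu>)" using assms by simp
  show "positive (sets (measure_plus \<mu> \<nu>)) (\<lambda>A. emeasure \<mu> A + emeasure \<nu> A)"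
    by (simp add: positive_def)
  show "countably_additive (sets (measure_plus \<mu> \<nu>)) (\<lambda>A. emeasure \<mu> A + emeasure \<nu> A)"
  proof (rule countably_additiveI)
    fix B :: "nat \<Rightarrow> 'a set"
    assume B: "range B \<subseteq> sets (measure_plus \<mu> \<nu>)" "disjoint_family B"
    have "(\<Sum>i. emeasure \<mu> (B i) + emeasure \<nu> (B i)) =
        (\<Sum>i. emeasure \<mu> (B i)) + (\<Sum>i. emeasure \<nu> (B i))"
      by (rule suminf_add[symmetric]) auto
    also have "\<dots> = emeasure \<mu> (\<Union>i. B i) + emeasure \<nu> (\<Union>i. B i)"
      using B assms(1) by (simp add: suminf_emeasure)
    finally show "(\<Sum>i. emeasure \<mu> (B i) + emeasure \<nu> (B i)) =
        emeasure \<mu> (\<Union>i. B i) + emeasure \<nu> (\<Union>i. B i)" .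
  qed
qed

definition measure_support :: "real measure \<Rightarrow> real set" where
  "measure_support \<mu> = {x. \<forall>U. open U \<longrightarrow> x \<in> U \<longrightarrow> emeasure \<mu> U > 0}"

inductive_set finite_convolutions :: "real measure set \<Rightarrow> real measure set"
  for S :: "real measure set" where
  single: "\<mu> \<in> S \<Longrightarrow> \<mu> \<in> finite_convolutions S"
| conv: "\<mu> \<in> finite_convolutions S \<Longrightarrow> \<nu> \<in> S \<Longrightarrow> (\<mu> \<star> \<nu>) \<in> finite_convolutions S"

definition weak_limits :: "real measure set \<Rightarrow> real measure set" where
  "weak_limits S = {\<mu>. real_distribution \<mu> \<and> (\<exists>\<mu>s. (\<forall>n. \<mu>s n \<in> S) \<and> weak_conv_m \<mu>s \<mu>)}"

text \<open>Processes are indexed by \<open>t \<ge> 0\<close>; values at negative times are irrelevant.\<close>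

definition cadlag :: "(real \<Rightarrow> real) \<Rightarrow> bool" where
  "cadlag x \<longleftrightarrow> (\<forall>t\<ge>0. (x \<longlongrightarrow> x t) (at_right t)) \<and> (\<forall>t>0. \<exists>l. (x \<longlongrightarrow> l) (at_left t))"

text \<open>Stochastic continuity need not be listed: it follows from right-continuity of the paths and
  stationarity of the increments.\<close>

definition levy_process :: "'a measure \<Rightarrow> (real \<Rightarrow> 'a \<Rightarrow> real) \<Rightarrow> bool" where
  "levy_process M X \<longleftrightarrow>
     prob_space M \<and>
     (\<forall>t\<ge>0. X t \<in> borel_measurable M) \<and>
     (AE \<omega> in M. X 0 \<omega> = 0) \<and>
     (\<forall>n (t :: nat \<Rightarrow> real). 0 \<le> t 0 \<longrightarrow> (\<forall>i<n. t i \<le> t (Suc i)) \<longrightarrow>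
        prob_space.indep_vars M (\<lambda>_. borel) (\<lambda>i \<omega>. X (t (Suc i)) \<omega> - X (t i) \<omega>) {..<n}) \<and>
     (\<forall>s\<ge>0. \<forall>h\<ge>0. distr M borel (\<lambda>\<omega>. X (s + h) \<omega> - X s \<omega>) = distr M borel (X h)) \<and>
     (AE \<omega> in M. cadlag (\<lambda>t. X t \<omega>))"

definition increasing_process :: "'a measure \<Rightarrow> (real \<Rightarrow> 'a \<Rightarrow> real) \<Rightarrow> bool" where
  "increasing_process M X \<longleftrightarrow> (AE \<omega> in M. mono_on {0..} (\<lambda>t. X t \<omega>))"

definition independent_processes ::
    "'a measure \<Rightarrow> (real \<Rightarrow> 'a \<Rightarrow> real) \<Rightarrow> (real \<Rightarrow> 'a \<Rightarrow> real) \<Rightarrow> bool" where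
  "independent_processes M X T \<longleftrightarrow>
     prob_space.indep_var M
       (PiM {0..} (\<lambda>_. borel)) (\<lambda>\<omega>. \<lambda>t\<in>{0..}. X t \<omega>)
       (PiM {0..} (\<lambda>_. borel)) (\<lambda>\<omega>. \<lambda>t\<in>{0..}. T t \<omega>)"

text \<open>\<open>Y\<close> is a version of the time-changed process, equal to it for all times at once outside a
  null set. The path properties of \<open>X\<close> and \<open>T\<close> only hold almost surely, so on a space that is not
  complete the pointwise composition may fail to be measurable; on a complete space it always
  qualifies as \<open>Y\<close>.\<close>

definition time_change ::
    "'a measure \<Rightarrow> (real \<Rightarrow> 'a \<Rightarrow> real) \<Rightarrow> (real \<Rightarrow> 'a \<Rightarrow> real) \<Rightarrow> (real \<Rightarrow> 'a \<Rightarrow> real) \<Rightarrow> bool"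
where
  "time_change M X T Y \<longleftrightarrow>
     (\<forall>t\<ge>0. Y t \<in> borel_measurable M) \<and>
     (AE \<omega> in M. \<forall>t\<ge>0. Y t \<omega> = X (T t \<omega>) \<omega>)"

definition gamma_process :: "'a measure \<Rightarrow> real \<Rightarrow> real \<Rightarrow> (real \<Rightarrow> 'a \<Rightarrow> real) \<Rightarrow> bool" where
  "gamma_process M \<alpha> \<beta> X \<longleftrightarrow>
     levy_process M X \<and>
     (\<forall>z. char (distr M borel (X 1)) z =
        (1 - \<i> * complex_of_real z / complex_of_real \<beta>) powr complex_of_real (- \<alpha>))"

text \<open>For laws on the nonnegative half-line; used for \<open>0 < z \<le> 1\<close> only, since \<open>0 powr 0 = 0\<close>.\<close>

definition pgf :: "real measure \<Rightarrow> real \<Rightarrow> real" where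
  "pgf \<mu> z = (LINT x|\<mu>. z powr x)"

definition negative_binomial_law :: "real \<Rightarrow> real \<Rightarrow> real measure \<Rightarrow> bool" where
  "negative_binomial_law b p \<mu> \<longleftrightarrow>
     real_distribution \<mu> \<and> (AE x in \<mu>. x \<in> \<nat>) \<and>
     (\<forall>z\<in>{0<..1}. pgf \<mu> z = ((1 - p) / (1 - p * z)) powr b)"

definition GNBC :: "real measure set" where
  "GNBC = weak_limits (finite_convolutions
     {\<mu>. \<exists>b p. 0 < b \<and> 0 < p \<and> p < 1 \<and> negative_binomial_law b p \<mu>})"

text \<open>Since \<open>ln 0 = 0\<close> in HOL, the absence of an atom at \<open>1\<close>, which finiteness of the logarithmic
  integral expresses under the convention \<open>\<bar>log 0\<bar> = \<infinity>\<close>, is a separate conjunct.\<close>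

definition GNBC_measure :: "real measure \<Rightarrow> bool" where
  "GNBC_measure \<pi> \<longleftrightarrow>
     measure_on {0..1} \<pi> \<and> emeasure \<pi> {1} = 0 \<and>
     (\<integral>\<^sup>+q\<in>{0..1/2}. ennreal q \<partial>\<pi>) < \<infinity> \<and>
     (\<integral>\<^sup>+q\<in>{1/2..1}. ennreal \<bar>ln (1 - q)\<bar> \<partial>\<pi>) < \<infinity>"

definition GNBC_pair :: "real \<Rightarrow> real measure \<Rightarrow> real measure \<Rightarrow> bool" where
  "GNBC_pair a \<pi> \<mu> \<longleftrightarrow>
     \<mu> \<in> GNBC \<and> 0 \<le> a \<and> GNBC_measure \<pi> \<and> (AE x in \<mu>. x \<in> \<nat>) \<and>
     (\<forall>z\<in>{0<..1}. pgf \<mu> z =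
        exp (a * (z - 1) + (LINT q:{0..1}|\<pi>. ln ((1 - q) / (1 - q * z)))))"

definition LGNBC_law :: "real \<Rightarrow> real \<Rightarrow> real \<Rightarrow> real measure \<Rightarrow> real measure \<Rightarrow> bool" where
  "LGNBC_law c \<alpha>\<^sub>0 a \<pi> \<mu> \<longleftrightarrow>
     0 < c \<and> 0 < \<alpha>\<^sub>0 \<and> real_distribution \<mu> \<and> (AE x in \<mu>. 0 \<le> x) \<and>
     (\<exists>\<mu>\<^sub>0. GNBC_pair a \<pi> \<mu>\<^sub>0 \<and>
        (\<forall>z\<in>{0<..1}. pgf \<mu> z = z powr c * pgf \<mu>\<^sub>0 (z powr \<alpha>\<^sub>0)))"

definition LGNBC_subordinator ::
    "'a measure \<Rightarrow> real \<Rightarrow> real \<Rightarrow> real \<Rightarrow> real measure \<Rightarrow> (real \<Rightarrow> 'a \<Rightarrow> real) \<Rightarrow> bool" where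
  "LGNBC_subordinator M c \<alpha>\<^sub>0 a \<pi> T \<longleftrightarrow>
     levy_process M T \<and> LGNBC_law c \<alpha>\<^sub>0 a \<pi> (distr M borel (T 1))"

definition gamma_law :: "real \<Rightarrow> real \<Rightarrow> real measure" where
  "gamma_law a b = density lborel
     (\<lambda>x. ennreal (if 0 < x then b powr a / Gamma a * x powr (a - 1) * exp (- b * x) else 0))"

definition thorin_subordinator :: "'a measure \<Rightarrow> (real \<Rightarrow> 'a \<Rightarrow> real) \<Rightarrow> bool" where
  "thorin_subordinator M Y \<longleftrightarrow>
     levy_process M Y \<and> increasing_process M Y \<and>
     distr M borel (Y 1) \<in>
       weak_limits (finite_convolutions {gamma_law a b |a b. 0 < a \<and> 0 < b})"

definition thorin_measure :: "real measure \<Rightarrow> bool" where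
  "thorin_measure \<tau> \<longleftrightarrow>
     measure_on {0<..} \<tau> \<and>
     (\<integral>\<^sup>+x\<in>{0<..1}. ennreal (1 + \<bar>ln x\<bar>) \<partial>\<tau>) +
     (\<integral>\<^sup>+x\<in>{1<..}. ennreal (1 / x\<^sup>2) \<partial>\<tau>) < \<infinity>"

text \<open>The Thorin triplet \<open>(b, 0, \<tau>)\<close> of the law \<open>\<mu>\<close> of \<open>Y\<^sub>1\<close>. The logarithm of the characteristic
  function is the one that is continuous and vanishes at \<open>0\<close>; as the right-hand side of the defining
  formula has both properties, exponentiating loses nothing.\<close>

definition thorin_triplet :: "real \<Rightarrow> real measure \<Rightarrow> real measure \<Rightarrow> bool" where
  "thorin_triplet b \<tau> \<mu> \<longleftrightarrow>
     thorin_measure \<tau> \<and>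
     (\<forall>z. char \<mu> z = exp (\<i> * complex_of_real (z * b) -
        (LINT x:{0<..}|\<tau>. Ln (1 - \<i> * complex_of_real (z / x)) +
           \<i> * complex_of_real (z / x * indicator {1..} x))))"

definition selfdecomposable :: "real measure \<Rightarrow> bool" where
  "selfdecomposable \<mu> \<longleftrightarrow>
     (\<forall>b. 0 < b \<longrightarrow> b < 1 \<longrightarrow>
        (\<exists>\<rho>. real_distribution \<rho> \<and> (\<forall>z. char \<mu> z = char \<mu> (b * z) * char \<rho> z)))"

text \<open>\<open>\<nu>\<close> is the measure in the Levy--Khintchine representation of \<open>\<mu>\<close>, with location parameter \<open>g\<close>
  and Gaussian variance \<open>v\<close>.\<close>

definition levy_measure_of :: "real measure \<Rightarrow> real measure \<Rightarrow> bool" where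
  "levy_measure_of \<mu> \<nu> \<longleftrightarrow>
     measure_on (- {0}) \<nu> \<and> (\<integral>\<^sup>+x. ennreal (min 1 (x\<^sup>2)) \<partial>\<nu>) < \<infinity> \<and>
     (\<exists>g v. 0 \<le> v \<and>
        (\<forall>z. char \<mu> z = exp (\<i> * complex_of_real (g * z) - complex_of_real (v * z\<^sup>2 / 2) +
           (LINT x|\<nu>. iexp (z * x) - 1 - \<i> * complex_of_real (z * x * indicator {-1..1} x)))))"

definition blumenthal_getoor_index :: "real measure \<Rightarrow> real" where
  "blumenthal_getoor_index \<nu> =
     Inf {p. 0 < p \<and> (\<integral>\<^sup>+x\<in>{-1..1}. ennreal (\<bar>x\<bar> powr p) \<partial>\<nu>) < \<infinity>}"

text \<open>A self-decomposable law on the half-line has Levy density \<open>k x / x\<close> with \<open>k\<close> nonincreasing;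
  monotonicity singles out a version of \<open>k\<close> up to its jumps, so that \<open>k(0+)\<close> is well defined.\<close>

definition BG0 :: "'a measure \<Rightarrow> real \<Rightarrow> (real \<Rightarrow> 'a \<Rightarrow> real) \<Rightarrow> bool" where
  "BG0 M \<zeta> Y \<longleftrightarrow>
     levy_process M Y \<and> increasing_process M Y \<and>
     selfdecomposable (distr M borel (Y 1)) \<and> 0 < \<zeta> \<and>
     (\<exists>\<nu> k. levy_measure_of (distr M borel (Y 1)) \<nu> \<and>
        blumenthal_getoor_index \<nu> = 0 \<and>
        (\<forall>x>0. 0 \<le> k x) \<and> antimono_on {0<..} k \<and>
        \<nu> = density lborel (\<lambda>x. ennreal (if 0 < x then k x / x else 0)) \<and>
        (k \<longlongrightarrow> \<zeta>) (at_right 0))"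

end

theory Submission
  imports Defs "HOL-Complex_Analysis.Conformal_Mappings"
begin

text \<open>Write \<open>u = 1 - \<i>z/\<beta>\<close>. Since \<open>X\<^sub>s\<close> has characteristic function \<open>u powr (-\<alpha>s)\<close>, conditioning on \<open>T\<close>
  gives \<open>E exp (\<i>zY\<^sub>1) = E exp (-\<alpha> (Ln u) T\<^sub>1)\<close>, the Laplace transform of \<open>T\<^sub>1\<close> at a point of the right
  half-plane. The generating function prescribes this transform on the positive axis only; analytic
  continuation carries it to the half-plane, and \<open>u - q = (1 - q) (1 - \<i>z/(\<beta>(1 - q)))\<close> turns the
  result into the exponent of the Thorin measure \<open>\<tau>\<close>. All analytic claims about \<open>Y\<^sub>1\<close> then follow
  from the Frullani integral \<open>\<integral> (exp (\<i>zx) - 1) exp (-sx)/x dx = - Ln (1 - \<i>z/s)\<close>: discretising \<open>\<tau>\<close>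
  exhibits the law as a limit of gamma convolutions, integrating over \<open>\<tau>\<close> yields the Levy density,
  and for \<open>0 < b < 1\<close> the quotient of the characteristic functions at \<open>z\<close> and \<open>bz\<close> is compound
  Poisson. That \<open>Y\<close> is a Levy process follows by freezing the path of \<open>T\<close>, which is legitimate
  because the paths of \<open>X\<close> and \<open>T\<close> are independent.\<close>

section \<open>Gamma and Frullani integrals\<close>

text \<open>The hypotheses describe \<open>X\<close> and \<open>T\<close> only through their laws at
  time 1, so the monotonicity of their paths and the laws of \<open>X\<close> at other times must
  first be recovered from independent stationary increments and right-continuity. The scale
  1/\<alpha> of \<open>T\<close> makes the computation close: with L = Ln u the Laplace transform is
  taken at \<alpha> L, and the generating function receives exp (- L) = 1/u. This point lies in the
  open unit disc only for z different from 0, so z = 0 is treated apart. The drift contributes - c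
  \<alpha> L; the negative binomial part returns \<theta> L minus an integral over the image of
  \<pi>. What is left, - (c \<alpha> - \<theta>) L, is the exponent of an atom at \<beta>, whose
  mass is nonnegative because c \<alpha> \<ge> \<theta>. So \<tau> has finite mass c \<alpha> and
  bounded support, and the condition on log (1 - q) becomes integrability of ln under \<tau>. Hence
  no compensator is required: the exponent is the plain integral of Ln (1 - iz/x), its drift in the
  Thorin normalisation is the integral of 1/x over [1,oo), and x times the Levy density tends to the
  mass of \<tau> at 0.\<close>

lemma has_field_derivative_integral:
  fixes f f' :: "complex \<Rightarrow> 'b \<Rightarrow> complex"
  assumes r: "0 < r"
    and int: "\<And>z. z \<in> ball z0 r \<Longrightarrow> integrable M (f z)"
    and der: "AE x in M. \<forall>z\<in>ball z0 r. ((\<lambda>w. f w x) has_field_derivative f' z x) (at z)"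
    and bnd: "AE x in M. \<forall>z\<in>ball z0 r. norm (f' z x) \<le> g x"
    and [measurable]: "f' z0 \<in> borel_measurable M"
    and g: "integrable M g"
  shows "((\<lambda>z. LINT x|M. f z x) has_field_derivative (LINT x|M. f' z0 x)) (at z0)"
  unfolding DERIV_def tendsto_at_iff_sequentially comp_def
proof safe
  fix X :: "nat \<Rightarrow> complex"
  assume X: "\<forall>i. X i \<in> UNIV - {0}" "X \<longlonglongrightarrow> 0"
  \<comment> \<open>Difference quotients, set to 0 at the finitely many indices where
    \<open>z0 + X i\<close> leaves the ball, so that the bound by \<open>g\<close> holds for every
    index.\<close>
  define s where "s i x = (if norm (X i) < r then (f (z0 + X i) x - f z0 x) / X i else 0)" for i x
  have z0: "z0 \<in> ball z0 r" using r by simp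
  have ev: "\<forall>\<^sub>F i in sequentially. norm (X i) < r"
    using X(2) r by (auto simp: tendsto_iff dist_norm)
  have mem: "z0 + X i \<in> ball z0 r" if "norm (X i) < r" for i
    using that by (simp add: dist_norm)
  have "(\<lambda>i. LINT x|M. s i x) \<longlonglongrightarrow> (LINT x|M. f' z0 x)"
  proof (rule integral_dominated_convergence[where w=g])
    show "s i \<in> borel_measurable M" for i
    proof (cases "norm (X i) < r")
      case True
      have [measurable]: "f z0 \<in> borel_measurable M" "f (z0 + X i) \<in> borel_measurable M"
        using int[OF z0] int[OF mem[OF True]] by auto
      show ?thesis unfolding s_def by measurable
    qed (simp add: s_def[abs_def])
    show "AE x in M. (\<lambda>i. s i x) \<longlonglongrightarrow> f' z0 x"
      using der
    proof eventually_elim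
      case (elim x)
      have "((\<lambda>h. (f (z0 + h) x - f z0 x) / h) \<longlongrightarrow> f' z0 x) (at 0)"
        using elim z0 by (auto simp: DERIV_def)
      then have "(\<lambda>i. (f (z0 + X i) x - f z0 x) / X i) \<longlonglongrightarrow> f' z0 x"
        using X unfolding tendsto_at_iff_sequentially comp_def by blast
      then show ?case
        by (rule Lim_transform_eventually) (use ev in eventually_elim, auto simp: s_def)
    qed
    show "AE x in M. norm (s i x) \<le> g x" for i
      using der bnd
    proof eventually_elim
      case (elim x)
      have gx: "0 \<le> g x" using elim(2) z0 norm_ge_zero order_trans by blast
      show ?case
      proof (cases "norm (X i) < r")
        case True
        \<comment> \<open>Mean value inequality on the convex ball.\<close>
        have "norm (f (z0 + X i) x - f z0 x) \<le> g x * norm (z0 + X i - z0)"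
        proof (rule field_differentiable_bound[where f="\<lambda>w. f w x" and f'="\<lambda>z. f' z x" and S="ball z0 r"])
          show "((\<lambda>w. f w x) has_field_derivative f' z x) (at z within ball z0 r)" if "z \<in> ball z0 r" for z
            using elim(1) that has_field_derivative_at_within by blast
        qed (use elim z0 mem[OF True] in auto)
        then show ?thesis
          using X(1) True by (simp add: s_def norm_divide divide_le_eq)
      qed (simp add: s_def gx)
    qed
  qed (use g in auto)
  then show "(\<lambda>i. ((LINT x|M. f (z0 + X i) x) - (LINT x|M. f z0 x)) / X i) \<longlonglongrightarrow> (LINT x|M. f' z0 x)"
  proof (rule Lim_transform_eventually)
    show "\<forall>\<^sub>F i in sequentially. (LINT x|M. s i x)
        = ((LINT x|M. f (z0 + X i) x) - (LINT x|M. f z0 x)) / X i"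
      using ev
      by eventually_elim (use int[OF z0] int[OF mem] in \<open>simp add: s_def\<close>)
  qed
qed

text \<open>The positive axis accumulates at the interior point 1 of the connected half-plane, so
  the identity theorem applies. It serves both the Gamma integral and the Laplace transform of
  \<open>T 1\<close>.\<close>

lemma right_half_plane_identity:
  fixes F G :: "complex \<Rightarrow> complex"
  assumes hol: "F holomorphic_on {z. 0 < Re z}" "G holomorphic_on {z. 0 < Re z}"
    and eq: "\<And>x::real. 0 < x \<Longrightarrow> F (of_real x) = G (of_real x)"
    and p: "0 < Re p"
  shows "F p = G p"
proof -
  have "F p - G p = 0"
  proof (rule analytic_continuation[of "\<lambda>z. F z - G z" "{z. 0 < Re z}" "of_real ` {0<..}" 1])
    show "(\<lambda>z. F z - G z) holomorphic_on {z. 0 < Re z}"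
      using hol by (intro holomorphic_intros)
    show "open {z. 0 < Re z}" by (rule open_halfspace_Re_gt)
    show "connected {z. 0 < Re z}" by (intro convex_connected convex_halfspace_Re_gt)
    show "(1::complex) islimpt (of_real ` {0<..})"
    proof (rule islimptI)
      fix T :: "complex set" assume "1 \<in> T" "open T"
      then obtain e where e: "0 < e" "ball 1 e \<subseteq> T" by (meson open_contains_ball)
      have "complex_of_real (1 + e/2) \<in> ball 1 e"
        using e by (simp add: dist_norm norm_divide)
      then show "\<exists>y\<in>complex_of_real ` {0<..}. y \<in> T \<and> y \<noteq> 1"
        using e by (intro bexI[of _ "complex_of_real (1 + e/2)"] conjI imageI) (auto simp: subset_eq)
    qed
  qed (use eq p in auto)
  then show ?thesis by simp
qed

lemma has_bochner_integral_gamma_real: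
  fixes a b :: real
  assumes "0 < a" "0 < b"
  shows "has_bochner_integral lborel (\<lambda>x. indicator {0<..} x *\<^sub>R (x powr (a - 1) * exp (- b * x)))
    (Gamma a / b powr a)"
proof (rule has_bochner_integral_nn_integral)
  \<comment> \<open>The shape \<open>0 + b * x\<close> fits the affine substitution rule with shift
    0 and slope \<open>b\<close>.\<close>
  have "(\<integral>\<^sup>+x. ennreal (indicator {0<..} x *\<^sub>R (x powr (a - 1) * exp (- b * x))) \<partial>lborel)
     = (\<integral>\<^sup>+x. ennreal (1 / b powr (a - 1)) * ennreal (indicator {0..} (0 + b * x) * (0 + b * x) powr (a - 1) / exp (0 + b * x)) \<partial>lborel)"
  proof (intro nn_integral_cong_AE)
    show "AE x in lborel. ennreal (indicator {0<..} x *\<^sub>R (x powr (a - 1) * exp (- b * x))) =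
     ennreal (1 / b powr (a - 1)) * ennreal (indicator {0..} (0 + b * x) * (0 + b * x) powr (a - 1) / exp (0 + b * x))"
      using AE_lborel_singleton[of 0]
    proof eventually_elim
      case (elim x)
      then show ?case
        using assms by (auto simp: ennreal_mult'[symmetric] powr_mult exp_minus field_simps zero_le_mult_iff split: split_indicator)
    qed
  qed
  also have "\<dots> = ennreal (1 / b powr (a - 1)) * (\<integral>\<^sup>+x. ennreal (indicator {0..} (0 + b * x) * (0 + b * x) powr (a - 1) / exp (0 + b * x)) \<partial>lborel)"
    by (rule nn_integral_cmult) measurable
  also have "(\<integral>\<^sup>+x. ennreal (indicator {0..} (0 + b * x) * (0 + b * x) powr (a - 1) / exp (0 + b * x)) \<partial>lborel)
      = ennreal (1 / b) * Gamma a"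
  proof -
    have "ennreal (Gamma a) = ennreal b * (\<integral>\<^sup>+x. ennreal (indicator {0..} (0 + b * x) * (0 + b * x) powr (a - 1) / exp (0 + b * x)) \<partial>lborel)"
      unfolding Gamma_conv_nn_integral_real[OF assms(1)]
      by (subst nn_integral_real_affine[where c=b and t=0]) (use assms in auto)
    then have "ennreal (1/b) * ennreal (Gamma a) = (ennreal (1/b) * ennreal b) * (\<integral>\<^sup>+x. ennreal (indicator {0..} (0 + b * x) * (0 + b * x) powr (a - 1) / exp (0 + b * x)) \<partial>lborel)"
      by (simp add: mult.assoc)
    then show ?thesis using assms by (simp add: ennreal_mult'[symmetric])
  qed
  also have "ennreal (1 / b powr (a - 1)) * (ennreal (1 / b) * Gamma a) = ennreal (Gamma a / b powr a)"
    using assms by (simp add: ennreal_mult''[symmetric] powr_diff field_simps)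
  finally show "(\<integral>\<^sup>+x. ennreal (indicator {0<..} x *\<^sub>R (x powr (a - 1) * exp (- b * x))) \<partial>lborel) = ennreal (Gamma a / b powr a)" .
qed (use assms in auto)

lemma set_integrable_gamma_complex:
  assumes "0 < a" "0 < Re p"
  shows "set_integrable lborel {0<..} (\<lambda>x. of_real (x powr (a - 1)) * exp (- p * of_real x))"
  unfolding set_integrable_def
proof (rule Bochner_Integration.integrable_bound)
  show "integrable lborel (\<lambda>x. indicator {0<..} x *\<^sub>R (x powr (a - 1) * exp (- Re p * x)))"
    using has_bochner_integral_gamma_real[OF assms] by (auto simp: has_bochner_integral_iff)
qed (auto simp: norm_mult split: split_indicator)

text \<open>Both sides are holomorphic in \<open>p\<close> on the right half-plane, and for real
  \<open>p\<close> the formula is the rescaled Gamma integral.\<close>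

lemma integral_gamma_complex:
  assumes a: "0 < a" and p: "0 < Re p"
  shows "(LINT x:{0<..}|lborel. of_real (x powr (a - 1)) * exp (- p * of_real x))
    = Gamma a * p powr (- of_real a)"
proof (rule right_half_plane_identity[OF _ _ _ p])
  have "((\<lambda>p. LINT x:{0<..}|lborel. of_real (x powr (a - 1)) * exp (- p * of_real x)) has_field_derivative
      (LINT x:{0<..}|lborel. - of_real x * of_real (x powr (a - 1)) * exp (- p * of_real x))) (at p)"
    if p: "0 < Re p" for p
    unfolding set_lebesgue_integral_def
  proof (rule has_field_derivative_integral[where r="Re p / 2" and
        f'="\<lambda>p x. indicator {0<..} x *\<^sub>R (- complex_of_real x * of_real (x powr (a - 1)) * exp (- p * of_real x))"
        and f="\<lambda>p x. indicator {0<..} x *\<^sub>R (complex_of_real (x powr (a - 1)) * exp (- p * of_real x))"])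
    have re: "Re p / 2 < Re z" if "z \<in> ball p (Re p / 2)" for z
      using that abs_Re_le_cmod[of "p - z"] by (auto simp: dist_norm)
    show "integrable lborel (\<lambda>x. indicator {0<..} x *\<^sub>R (complex_of_real (x powr (a - 1)) * exp (- z * of_real x)))"
      if "z \<in> ball p (Re p / 2)" for z
      using set_integrable_gamma_complex[of a z] a re[OF that] p unfolding set_integrable_def by simp
    show "AE x in lborel. \<forall>z\<in>ball p (Re p / 2).
        ((\<lambda>w. indicator {0<..} x *\<^sub>R (complex_of_real (x powr (a - 1)) * exp (- w * of_real x))) has_field_derivative
        indicator {0<..} x *\<^sub>R (- complex_of_real x * of_real (x powr (a - 1)) * exp (- z * of_real x))) (at z)"
      by (intro AE_I2 ballI) (auto intro!: derivative_eq_intros simp: indicator_def)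
    \<comment> \<open>Differentiating in \<open>p\<close> produces a factor \<open>x\<close>, so the
      dominating function is a Gamma integrand with exponent \<open>a + 1\<close>; its rate
      \<open>Re p / 2\<close> works on the whole ball.\<close>
    show "integrable lborel (\<lambda>x. indicator {0<..} x *\<^sub>R (x powr ((a + 1) - 1) * exp (- (Re p / 2) * x)))"
      using has_bochner_integral_gamma_real[of "a + 1" "Re p / 2"] a p by (auto simp: has_bochner_integral_iff)
    show "AE x in lborel. \<forall>z\<in>ball p (Re p / 2). norm (indicator {0<..} x *\<^sub>R (- complex_of_real x * of_real (x powr (a - 1)) * exp (- z * of_real x)))
       \<le> indicator {0<..} x *\<^sub>R (x powr ((a + 1) - 1) * exp (- (Re p / 2) * x))"
    proof (intro AE_I2 ballI)
      fix x :: real and z assume z: "z \<in> ball p (Re p / 2)"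
      show "norm (indicator {0<..} x *\<^sub>R (- complex_of_real x * of_real (x powr (a - 1)) * exp (- z * of_real x)))
       \<le> indicator {0<..} x *\<^sub>R (x powr ((a + 1) - 1) * exp (- (Re p / 2) * x))"
      proof (cases "0 < x")
        case True
        have "x * x powr (a - 1) = x powr a"
          using True by (simp add: powr_mult_base)
        then show ?thesis using True re[OF z] by (auto simp: norm_mult)
      qed simp
    qed
  qed (use p in auto)
  then show "(\<lambda>p. LINT x:{0<..}|lborel. complex_of_real (x powr (a - 1)) * exp (- p * of_real x)) holomorphic_on {z. 0 < Re z}"
    unfolding holomorphic_on_def field_differentiable_def
    by (metis (no_types, lifting) has_field_derivative_at_within mem_Collect_eq)
  show "(\<lambda>p. complex_of_real (Gamma a) * p powr - complex_of_real a) holomorphic_on {z. 0 < Re z}"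
    by (intro holomorphic_intros) (auto simp: complex_nonpos_Reals_iff)
  fix b :: real assume b: "0 < b"
  have "(LINT x:{0<..}|lborel. complex_of_real (x powr (a - 1)) * exp (- of_real b * of_real x))
     = (LINT x|lborel. complex_of_real (indicator {0<..} x *\<^sub>R (x powr (a - 1) * exp (- b * x))))"
    unfolding set_lebesgue_integral_def
    by (intro Bochner_Integration.integral_cong) (auto simp: exp_of_real[symmetric] split: split_indicator)
  also have "\<dots> = of_real (Gamma a / b powr a)"
    using has_bochner_integral_gamma_real[OF a b] by (subst integral_complex_of_real) (simp add: has_bochner_integral_iff)
  also have "\<dots> = Gamma a * complex_of_real b powr (- complex_of_real a)"
    using b by (simp add: powr_of_real[symmetric] powr_minus field_simps)
  finally show "(LINT x:{0<..}|lborel. complex_of_real (x powr (a - 1)) * exp (- of_real b * of_real x)) = Gamma a * complex_of_real b powr (- complex_of_real a)" .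
qed

lemma prob_space_gamma_law:
  assumes "0 < a" "0 < b"
  shows "prob_space (gamma_law a b)"
proof
  have "(\<integral>\<^sup>+x. ennreal (if 0 < x then b powr a / Gamma a * x powr (a - 1) * exp (- b * x) else 0) \<partial>lborel)
     = (\<integral>\<^sup>+x. ennreal (b powr a / Gamma a) * ennreal (indicator {0<..} x *\<^sub>R (x powr (a - 1) * exp (- b * x))) \<partial>lborel)"
    using assms Gamma_real_pos[of a] by (intro nn_integral_cong) (auto simp: ennreal_mult'[symmetric] mult.assoc split: split_indicator)
  also have "\<dots> = ennreal (b powr a / Gamma a) * (\<integral>\<^sup>+x. ennreal (indicator {0<..} x *\<^sub>R (x powr (a - 1) * exp (- b * x))) \<partial>lborel)"
    by (rule nn_integral_cmult) measurable
  also have "(\<integral>\<^sup>+x. ennreal (indicator {0<..} x *\<^sub>R (x powr (a - 1) * exp (- b * x))) \<partial>lborel) = ennreal (Gamma a / b powr a)"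
    using has_bochner_integral_gamma_real[OF assms]
    by (subst nn_integral_eq_integral) (auto simp: has_bochner_integral_iff)
  also have "ennreal (b powr a / Gamma a) * ennreal (Gamma a / b powr a) = 1"
    using assms Gamma_real_pos[of a] by (simp add: ennreal_mult'[symmetric] less_imp_neq[symmetric])
  finally show "emeasure (gamma_law a b) (space (gamma_law a b)) = 1"
    unfolding gamma_law_def by (simp add: emeasure_density)
qed

lemma real_distribution_gamma_law:
  assumes "0 < a" "0 < b"
  shows "real_distribution (gamma_law a b)"
proof -
  interpret prob_space "gamma_law a b" by (rule prob_space_gamma_law[OF assms])
  show ?thesis by standard (auto simp: gamma_law_def)
qed

lemma AE_gamma_law_pos: "AE x in gamma_law a b. 0 < x"
  unfolding gamma_law_def by (subst AE_density) auto

lemma char_gamma_law: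
  assumes "0 < a" "0 < b"
  shows "char (gamma_law a b) z = exp (- (of_real a * Ln (1 - \<i> * of_real (z / b))))"
proof -
  define p where "p = of_real b - \<i> * of_real z"
  have p: "0 < Re p" using assms by (simp add: p_def)
  have G: "Gamma a > 0" using assms by (simp add: Gamma_real_pos)
  have "char (gamma_law a b) z = (LINT x|lborel. (if 0 < x then b powr a / Gamma a * x powr (a - 1) * exp (- b * x) else 0) *\<^sub>R iexp (z * x))"
    unfolding char_def gamma_law_def using assms G
    by (subst integral_density) auto
  also have "\<dots> = (LINT x:{0<..}|lborel. of_real (b powr a / Gamma a) * (of_real (x powr (a - 1)) * exp (- p * of_real x)))"
    unfolding set_lebesgue_integral_def
    by (intro Bochner_Integration.integral_cong)
      (auto simp: p_def scaleR_conv_of_real exp_of_real[symmetric] mult.assoc exp_add[symmetric] algebra_simps split: split_indicator)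
  also have "\<dots> = of_real (b powr a / Gamma a) * (Gamma a * p powr (- of_real a))"
    using integral_gamma_complex[OF assms(1) p] by (simp only: set_integral_mult_right)
  also have "\<dots> = of_real (b powr a) * p powr (- of_real a)" using G by simp
  also have "\<dots> = exp (of_real a * of_real (ln b)) * exp (- of_real a * Ln p)"
    using p assms by (auto simp: powr_def exp_of_real[symmetric])
  also have "\<dots> = exp (- (of_real a * (Ln p - of_real (ln b))))"
    by (simp add: exp_add[symmetric] algebra_simps)
  \<comment> \<open>Dividing by a positive real leaves the argument unchanged, so no branch
    correction appears.\<close>
  also have "Ln p - of_real (ln b) = Ln (p / of_real b)"
    using assms p by (subst Ln_divide_of_real) auto
  also have "p / of_real b = 1 - \<i> * of_real (z / b)"
    using assms by (simp add: p_def field_simps)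
  finally show ?thesis .
qed

text \<open>Mean value inequality on the half-plane \<open>\<delta> \<le> Re w\<close>, where the
  derivative of exp (- w x) has norm at most x exp (- \<delta> x). The factor \<open>x\<close> is
  what later cancels the singularity 1/x.\<close>

lemma norm_exp_diff_le:
  assumes x: "0 \<le> x" and "\<delta> \<le> Re p" "\<delta> \<le> Re q"
  shows "norm (exp (- p * of_real x) - exp (- q * of_real x)) \<le> x * exp (- \<delta> * x) * norm (p - q)"
proof (rule field_differentiable_bound[where f="\<lambda>w. exp (- w * of_real x)" and S="{w. \<delta> \<le> Re w}"
      and f'="\<lambda>w. - of_real x * exp (- w * of_real x)"])
  show "convex {w. \<delta> \<le> Re w}" using convex_halfspace_Re_ge[of \<delta>] by simp
  show "norm (- of_real x * exp (- w * of_real x)) \<le> x * exp (- \<delta> * x)" if "w \<in> {w. \<delta> \<le> Re w}" for w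
    using that x by (auto simp: norm_mult intro!: mult_left_mono mult_right_mono)
qed (use assms in \<open>auto intro!: derivative_eq_intros\<close>)

lemma set_integrable_exp:
  fixes s :: real
  assumes "0 < s"
  shows "set_integrable lborel {0<..} (\<lambda>x. exp (- s * x))"
proof -
  have "integrable lborel (\<lambda>x. indicator {0<..} x *\<^sub>R (x powr (1 - 1) * exp (- s * x)))"
    using has_bochner_integral_gamma_real[OF zero_less_one assms] unfolding has_bochner_integral_iff by blast
  moreover have "(\<lambda>x. indicator {0<..} x *\<^sub>R (x powr (1 - 1) * exp (- s * x))) = (\<lambda>x. indicator {0<..} x *\<^sub>R exp (- s * x))"
    by (auto split: split_indicator)
  ultimately show ?thesis unfolding set_integrable_def by argo
qed

text \<open>After division by \<open>x\<close>, the bound \<open>norm_exp_diff_le\<close> leaves a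
  multiple of exp (- \<delta> x), with \<delta> the smaller of the two rates.\<close>

lemma set_integrable_frullani:
  assumes s: "0 < s" and p: "0 < Re p"
  shows "set_integrable lborel {0<..} (\<lambda>x. (exp (- p * of_real x) - exp (- of_real s * of_real x)) / of_real x)"
  unfolding set_integrable_def
proof (rule Bochner_Integration.integrable_bound)
  define \<delta> where "\<delta> = min (Re p) s"
  show "integrable lborel (\<lambda>x. norm (p - of_real s) * (indicator {0<..} x *\<^sub>R exp (- \<delta> * x)))"
    using set_integrable_exp[of \<delta>] s p unfolding set_integrable_def by (intro integrable_mult_right) (auto simp: \<delta>_def)
  have "norm ((exp (- p * of_real x) - exp (- of_real s * of_real x)) / of_real x) \<le> norm (p - of_real s) * exp (- \<delta> * x)"
    if "0 < x" for x
    using norm_exp_diff_le[of x \<delta> p "of_real s"] that by (simp add: \<delta>_def norm_divide field_simps)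
  then show "AE x in lborel. norm (indicator {0<..} x *\<^sub>R ((exp (- p * of_real x) - exp (- of_real s * of_real x)) / of_real x))
      \<le> norm (norm (p - of_real s) * (indicator {0<..} x *\<^sub>R exp (- \<delta> * x)))"
    by (intro AE_I2) (auto split: split_indicator)
qed measurable

text \<open>Differentiation in \<open>p\<close> removes the division by \<open>x\<close> and leaves
  - 1/p, so \<open>F + Ln\<close> is constant on the half-plane. The constant is read off at p = s,
  where the integrand vanishes.\<close>

lemma integral_frullani:
  assumes s: "0 < s" and p: "0 < Re p"
  shows "(LINT x:{0<..}|lborel. (exp (- p * of_real x) - exp (- of_real s * of_real x)) / of_real x)
    = of_real (ln s) - Ln p"
proof -
  define F where "F p = (LINT x:{0<..}|lborel. (exp (- p * of_real x) - exp (- complex_of_real s * of_real x)) / of_real x)" for p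
  have deriv: "(F has_field_derivative - (1 / p)) (at p)" if p: "0 < Re p" for p
  proof -
    have "(F has_field_derivative (LINT x|lborel. indicator {0<..} x *\<^sub>R (- exp (- p * of_real x)))) (at p)"
      unfolding F_def set_lebesgue_integral_def
    proof (rule has_field_derivative_integral[where r="Re p / 2" and
          f'="\<lambda>p x. indicator {0<..} x *\<^sub>R (- exp (- p * of_real x))"
          and f="\<lambda>p x. indicator {0<..} x *\<^sub>R ((exp (- p * of_real x) - exp (- complex_of_real s * of_real x)) / of_real x)"])
      have re: "Re p / 2 < Re z" if "z \<in> ball p (Re p / 2)" for z
        using that abs_Re_le_cmod[of "p - z"] by (auto simp: dist_norm)
      show "integrable lborel (\<lambda>x. indicator {0<..} x *\<^sub>R ((exp (- z * of_real x) - exp (- complex_of_real s * of_real x)) / of_real x))"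
        if "z \<in> ball p (Re p / 2)" for z
        using set_integrable_frullani[of s z] s re[OF that] p unfolding set_integrable_def by simp
      show "AE x in lborel. \<forall>z\<in>ball p (Re p / 2).
          ((\<lambda>w. indicator {0<..} x *\<^sub>R ((exp (- w * of_real x) - exp (- complex_of_real s * of_real x)) / of_real x)) has_field_derivative
          indicator {0<..} x *\<^sub>R (- exp (- z * of_real x))) (at z)"
        by (intro AE_I2 ballI) (auto intro!: derivative_eq_intros simp: indicator_def)
      show "integrable lborel (\<lambda>x. indicator {0<..} x *\<^sub>R exp (- (Re p / 2) * x))"
        using set_integrable_exp[of "Re p / 2"] p unfolding set_integrable_def by simp
      show "AE x in lborel. \<forall>z\<in>ball p (Re p / 2). norm (indicator {0<..} x *\<^sub>R (- exp (- z * of_real x)))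
         \<le> indicator {0<..} x *\<^sub>R exp (- (Re p / 2) * x)"
        using re by (intro AE_I2 ballI) (auto simp: indicator_def intro: less_imp_le)
    qed (use p in auto)
    also have "(LINT x|lborel. indicator {0<..} x *\<^sub>R (- exp (- p * of_real x))) = 
       - (LINT x:{0<..}|lborel. complex_of_real (x powr (1 - 1)) * exp (- p * of_real x))"
      unfolding set_lebesgue_integral_def Bochner_Integration.integral_minus[symmetric]
      by (intro Bochner_Integration.integral_cong) (auto split: split_indicator)
    also have "\<dots> = - (1 / p)"
      using p by (subst integral_gamma_complex) (auto simp: powr_minus divide_inverse)
    finally show ?thesis .
  qed
  have "\<exists>c. \<forall>q\<in>{q. 0 < Re q}. F q + Ln q = c"
  proof (rule has_field_derivative_zero_constant)
    show "convex {q. 0 < Re q}" by (rule convex_halfspace_Re_gt)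
    show "((\<lambda>q. F q + Ln q) has_field_derivative 0) (at q within {q. 0 < Re q})" if "q \<in> {q. 0 < Re q}" for q
    proof -
      have q: "0 < Re q" using that by simp
      then have "q \<notin> \<real>\<^sub>\<le>\<^sub>0" by (auto simp: complex_nonpos_Reals_iff)
      from DERIV_add[OF deriv[OF q] has_field_derivative_Ln[OF this]] show ?thesis
        by (auto simp: divide_inverse intro: has_field_derivative_at_within)
    qed
  qed
  then obtain c where "\<forall>q\<in>{q. 0 < Re q}. F q + Ln q = c" by blast
  then have "F p + Ln p = F (of_real s) + Ln (of_real s)"
    using s p by simp
  also have "F (of_real s) = 0" by (simp add: F_def)
  finally show ?thesis using s by (simp add: F_def algebra_simps Ln_of_real)
qed

lemma has_bochner_integral_frullani_real:
  fixes r s :: real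
  assumes "0 < s" "0 < r"
  shows "has_bochner_integral lborel (\<lambda>x. indicator {0<..} x *\<^sub>R ((exp (- s * x) - exp (- r * x)) / x)) (ln r - ln s)"
proof -
  have eq: "indicator {0<..} x *\<^sub>R ((exp (- of_real s * of_real x) - exp (- complex_of_real r * of_real x)) / of_real x)
     = complex_of_real (indicator {0<..} x *\<^sub>R ((exp (- s * x) - exp (- r * x)) / x))" for x
    by (auto simp: exp_of_real[symmetric] split: split_indicator)
  have "complex_of_real (LINT x|lborel. indicator {0<..} x *\<^sub>R ((exp (- s * x) - exp (- r * x)) / x)) = of_real (ln r - ln s)"
    using integral_frullani[of r "of_real s"] assms
    by (simp only: set_lebesgue_integral_def eq integral_complex_of_real Ln_of_real of_real_diff Re_complex_of_real)
  moreover have "integrable lborel (\<lambda>x. indicator {0<..} x *\<^sub>R ((exp (- s * x) - exp (- r * x)) / x))"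
    using set_integrable_frullani[of r "of_real s"] assms unfolding set_integrable_def eq by (simp only: complex_of_real_integrable_eq) simp
  ultimately show ?thesis by (simp add: has_bochner_integral_iff del: of_real_diff)
qed

lemma nn_integral_frullani:
  fixes r s :: real
  assumes "0 < s" "s \<le> r"
  shows "(\<integral>\<^sup>+x. ennreal (indicator {0<..} x *\<^sub>R ((exp (- s * x) - exp (- r * x)) / x)) \<partial>lborel) = ennreal (ln r - ln s)"
  using has_bochner_integral_frullani_real[of s r] assms
  by (subst nn_integral_eq_integral) (auto simp: has_bochner_integral_iff split: split_indicator)

text \<open>The Frullani integral at p = s - iz. It identifies exp (- s x)/x as the Levy density of
  the gamma law with shape 1 and rate \<open>s\<close>.\<close>

lemma levy_khintchine_gamma:
  assumes s: "0 < s"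
  shows "set_integrable lborel {0<..} (\<lambda>x. (iexp (z * x) - 1) * of_real (exp (- s * x) / x))"
    and "(LINT x:{0<..}|lborel. (iexp (z * x) - 1) * of_real (exp (- s * x) / x)) = - Ln (1 - \<i> * of_real (z / s))"
proof -
  define p where "p = of_real s - \<i> * of_real z"
  have p: "0 < Re p" using s by (simp add: p_def)
  have "exp (- p * of_real x) = iexp (z * x) * exp (- of_real s * of_real x)" for x
    unfolding exp_add[symmetric] p_def by (simp add: left_diff_distrib mult.assoc)
  then have eq: "(exp (- p * of_real x) - exp (- of_real s * of_real x)) / of_real x
     = (iexp (z * x) - 1) * of_real (exp (- s * x) / x)" for x
    by (simp add: left_diff_distrib flip: exp_of_real)
  show "set_integrable lborel {0<..} (\<lambda>x. (iexp (z * x) - 1) * of_real (exp (- s * x) / x))"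
    using set_integrable_frullani[OF s p] unfolding eq .
  have "p / of_real s = 1 - \<i> * of_real (z / s)"
    using s by (simp add: p_def field_simps)
  moreover have "Ln (p / of_real s) = Ln p - ln s"
    using s p by (subst Ln_divide_of_real) auto
  ultimately show "(LINT x:{0<..}|lborel. (iexp (z * x) - 1) * of_real (exp (- s * x) / x)) = - Ln (1 - \<i> * of_real (z / s))"
    using integral_frullani[OF s p] unfolding eq by simp
qed

text \<open>The function 1 - exp (- x) is the gauge for integrability against the Levy measure: it
  is comparable to min 1 x, and exp (- s x) (1 - exp (- x))/x is itself a Frullani integrand. The
  constant 2 comes from exp (- x) \<le> 1/(1 + x) and (1 + x) min 1 x \<le> 2 x.\<close>

lemma min_one_le_exp:
  fixes x :: real
  assumes "0 \<le> x"
  shows "min 1 x \<le> 2 * (1 - exp (- x))"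
proof -
  have "exp (- x) \<le> 1 / (1 + x)"
    using exp_ge_add_one_self[of x] assms by (simp add: exp_minus field_simps)
  moreover have "min 1 x * (1 + x) \<le> 2 * x"
    using assms by (cases "x \<le> 1") (auto simp: min_def algebra_simps mult_left_le)
  then have "min 1 x \<le> 2 * (x / (1 + x))"
    using assms by (simp add: field_simps)
  moreover have "x / (1 + x) = 1 - 1 / (1 + x)" using assms by (simp add: field_simps)
  ultimately show ?thesis by argo
qed

text \<open>The bounds |z| x and 2 combine to (2 + |z|) min 1 x; passing to the gauge doubles the
  constant.\<close>

lemma norm_iexp_minus_1_le:
  assumes "0 \<le> x"
  shows "norm (iexp (z * x) - 1) \<le> (4 + 2 * \<bar>z\<bar>) * (1 - exp (- x))"
proof -
  have "norm (iexp (z * x) - 1) \<le> \<bar>z\<bar> * x"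
    using iexp_approx1[of "z * x" 0] assms by (simp add: abs_mult)
  moreover have "norm (iexp (z * x) - 1) \<le> 2"
    using norm_triangle_ineq4[of "iexp (z * x)" 1] by simp
  ultimately have "norm (iexp (z * x) - 1) \<le> (2 + \<bar>z\<bar>) * min 1 x"
    using assms by (cases "x \<le> 1") (auto simp: min_def algebra_simps)
  also have "\<dots> \<le> (2 + \<bar>z\<bar>) * (2 * (1 - exp (- x)))"
    by (intro mult_left_mono min_one_le_exp assms) auto
  finally show ?thesis by (simp add: algebra_simps)
qed

section \<open>Thorin measures of bounded support\<close>

lemma real_distribution_convolution:
  assumes "real_distribution \<mu>" "real_distribution \<nu>"
  shows "real_distribution (\<mu> \<star> \<nu>)"
proof -
  interpret M: real_distribution \<mu> by fact
  interpret N: real_distribution \<nu> by fact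
  interpret P: pair_prob_space \<mu> \<nu> ..
  show ?thesis unfolding convolution_def
    by (intro P.real_distribution_distr) measurable
qed

lemma char_convolution:
  assumes "real_distribution \<mu>" "real_distribution \<nu>"
  shows "char (\<mu> \<star> \<nu>) z = char \<mu> z * char \<nu> z"
proof -
  interpret M: real_distribution \<mu> by fact
  interpret N: real_distribution \<nu> by fact
  interpret P: pair_prob_space \<mu> \<nu> ..
  have "char (\<mu> \<star> \<nu>) z = (LINT p|(\<mu> \<Otimes>\<^sub>M \<nu>). iexp (z * fst p) * iexp (z * snd p))"
    unfolding char_def convolution_def
    by (subst integral_distr)
      (auto simp: case_prod_beta exp_add[symmetric] algebra_simps intro!: Bochner_Integration.integral_cong)
  also have "\<dots> = (LINT x|\<mu>. LINT y|\<nu>. iexp (z * x) * iexp (z * y))"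
  proof (subst P.integral_fst'[symmetric])
    show "integrable (\<mu> \<Otimes>\<^sub>M \<nu>) (\<lambda>p. iexp (z * fst p) * iexp (z * snd p))"
      by (rule P.P.integrable_const_bound[where B=1]) (auto simp: norm_mult)
  qed simp
  also have "\<dots> = char \<mu> z * char \<nu> z"
    unfolding char_def by simp
  finally show ?thesis .
qed

text \<open>The induction starts from one element, since \<open>finite_convolutions\<close> begins
  with a member of the family and does not contain the point mass at 0 as an empty
  convolution.\<close>

lemma finite_convolutions_gamma:
  fixes J :: "'b set" and a b :: "'b \<Rightarrow> real"
  assumes "finite J" "J \<noteq> {}" "\<And>j. j \<in> J \<Longrightarrow> 0 < a j" "\<And>j. j \<in> J \<Longrightarrow> 0 < b j"
  shows "\<exists>\<mu> \<in> finite_convolutions {gamma_law a b |a b. 0 < a \<and> 0 < b}. real_distribution \<mu> \<and>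
    (\<forall>z. char \<mu> z = exp (- (\<Sum>j\<in>J. of_real (a j) * Ln (1 - \<i> * of_real (z / b j)))))"
  using assms
proof (induction J rule: finite_ne_induct)
  case (singleton j)
  then have "0 < a j" "0 < b j" by auto
  then show ?case
    by (intro bexI[of _ "gamma_law (a j) (b j)"] finite_convolutions.single)
      (auto simp: char_gamma_law real_distribution_gamma_law)
next
  case (insert j J)
  then obtain \<mu> where \<mu>: "\<mu> \<in> finite_convolutions {gamma_law a b |a b. 0 < a \<and> 0 < b}"
    "real_distribution \<mu>"
    "\<And>z. char \<mu> z = exp (- (\<Sum>j\<in>J. of_real (a j) * Ln (1 - \<i> * of_real (z / b j))))"
    by auto
  have ab: "0 < a j" "0 < b j" using insert.prems by auto
  show ?case
  proof (intro bexI[of _ "\<mu> \<star> gamma_law (a j) (b j)"] conjI allI)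
    show "(\<mu> \<star> gamma_law (a j) (b j)) \<in> finite_convolutions {gamma_law a b |a b. 0 < a \<and> 0 < b}"
      using \<mu>(1) ab by (intro finite_convolutions.conv) auto
    show "real_distribution (\<mu> \<star> gamma_law (a j) (b j))"
      using \<mu>(2) ab by (intro real_distribution_convolution real_distribution_gamma_law)
    show "char (\<mu> \<star> gamma_law (a j) (b j)) z = exp (- (\<Sum>j\<in>insert j J. of_real (a j) * Ln (1 - \<i> * of_real (z / b j))))" for z
      using insert.hyps \<mu> ab
      by (simp add: char_convolution real_distribution_gamma_law char_gamma_law exp_add[symmetric] algebra_simps)
  qed
qed

text \<open>The argument has real part 1, hence modulus between 1 and 1 + |z|/x, which bounds the
  real part of its logarithm; the imaginary part is at most pi. The bound decreases in
  \<open>x\<close>, so rounding \<open>x\<close> up keeps it valid.\<close>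

lemma norm_Ln_one_minus_le:
  assumes "0 < x"
  shows "norm (Ln (1 - \<i> * of_real (z / x))) \<le> ln (1 + \<bar>z\<bar> / x) + pi"
proof -
  define w where "w = 1 - \<i> * of_real (z / x)"
  have w: "1 \<le> norm w" "norm w \<le> 1 + \<bar>z\<bar> / x"
    using abs_Re_le_cmod[of w] norm_triangle_ineq4[of 1 "\<i> * of_real (z / x)"] assms
    by (auto simp: w_def norm_mult norm_divide)
  then have w0: "w \<noteq> 0" by auto
  have "norm (Ln w) \<le> \<bar>Re (Ln w)\<bar> + \<bar>Im (Ln w)\<bar>" by (rule cmod_le)
  also have "\<bar>Re (Ln w)\<bar> = ln (norm w)" using w w0 by (simp add: Re_Ln)
  also have "\<dots> \<le> ln (1 + \<bar>z\<bar> / x)" using w by (intro ln_mono) auto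
  also have "\<bar>Im (Ln w)\<bar> \<le> pi" using mpi_less_Im_Ln[OF w0] Im_Ln_le_pi[OF w0] by auto
  finally show ?thesis by (simp add: w_def)
qed

text \<open>The properties of \<tau> that the analysis of the law uses. Finite mass and
  \<open>integrable_ln\<close> make the exponent converge without a compensator; positive mass
  provides at least one gamma factor and a positive jump intensity.\<close>

locale bounded_thorin_measure = finite_measure \<tau> for \<tau> :: "real measure" +
  fixes \<beta> :: real
  assumes sets_eq [measurable_cong]: "sets \<tau> = sets borel"
    and AE_bounds: "AE x in \<tau>. 0 < x \<and> x \<le> \<beta>"
    and integrable_ln: "integrable \<tau> ln"
    and mass_pos: "0 < measure \<tau> UNIV"
begin

lemma space_eq [simp]: "space \<tau> = UNIV"
  using sets_eq_imp_space_eq[OF sets_eq] by simp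

lemma bound_pos: "0 < \<beta>"
proof (rule ccontr)
  assume "\<not> 0 < \<beta>"
  then have "AE x in \<tau>. False" using AE_bounds by auto
  then have "measure \<tau> UNIV = 0" using AE_iff_null[of \<tau> "\<lambda>_. False"] by (simp add: null_sets_def measure_def)
  then show False using mass_pos by simp
qed

text \<open>On the support ln (1 + c/x) = ln (x + c) - ln x, and the first term is bounded because c
  < x + c \<le> \<beta> + c.\<close>

lemma integrable_ln_shift:
  assumes "0 < c"
  shows "integrable \<tau> (\<lambda>x. ln (1 + c / x))"
proof -
  have "integrable \<tau> (\<lambda>x. ln (x + c) - ln x)"
  proof (intro Bochner_Integration.integrable_diff integrable_ln integrable_const_bound[where B="\<bar>ln c\<bar> + \<bar>ln (\<beta> + c)\<bar>"])
    show "AE x in \<tau>. norm (ln (x + c)) \<le> \<bar>ln c\<bar> + \<bar>ln (\<beta> + c)\<bar>"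
      using AE_bounds
    proof eventually_elim
      case (elim x)
      then have "ln c \<le> ln (x + c)" "ln (x + c) \<le> ln (\<beta> + c)" using assms by (auto intro!: ln_mono)
      then show ?case by auto
    qed
  qed measurable
  moreover have "AE x in \<tau>. ln (x + c) - ln x = ln (1 + c / x)"
    using AE_bounds by eventually_elim (use assms in \<open>simp add: ln_divide_pos[symmetric] add_divide_distrib\<close>)
  ultimately show ?thesis by (subst integrable_cong_AE[where g="\<lambda>x. ln (x + c) - ln x"]) auto
qed

text \<open>Minus the logarithm of the characteristic function. Compared with
  \<open>thorin_triplet\<close>, both the compensator and the drift are absent; they cancel each
  other.\<close>

definition thorin_exponent :: "real \<Rightarrow> complex" where
  "thorin_exponent z = (LINT x|\<tau>. Ln (1 - \<i> * of_real (z / x)))"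

lemma integrable_norm_Ln_bound: "integrable \<tau> (\<lambda>x. ln (1 + \<bar>z\<bar> / x) + pi)"
  using integrable_ln_shift[of "\<bar>z\<bar>"] by (cases "z = 0") auto

lemma integrable_thorin_exponent: "integrable \<tau> (\<lambda>x. Ln (1 - \<i> * of_real (z / x)))"
proof (rule Bochner_Integration.integrable_bound[OF integrable_norm_Ln_bound[of z]])
  show "AE x in \<tau>. norm (Ln (1 - \<i> * of_real (z / x))) \<le> norm (ln (1 + \<bar>z\<bar> / x) + pi)"
    using AE_bounds by eventually_elim (use norm_Ln_one_minus_le in force)
qed measurable

text \<open>The support is rounded up, not down, to a grid: the logarithms then stay dominated near \<open>0\<close>.\<close>

lemma weak_limit_gamma:
  assumes \<mu>: "real_distribution \<mu>" "\<And>z. char \<mu> z = exp (- thorin_exponent z)"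
  shows "\<mu> \<in> weak_limits (finite_convolutions {gamma_law a b |a b. 0 < a \<and> 0 < b})"
proof -
  define N where "N n = real (Suc n)" for n
  have N: "0 < N n" "N n \<noteq> 0" for n by (auto simp: N_def)
  note \<beta>0 = bound_pos less_imp_neq[OF bound_pos, symmetric]
  define A :: "nat \<Rightarrow> nat \<Rightarrow> real set" where "A n j = {x. \<lceil>N n * x / \<beta>\<rceil> = int j}" for n j
  define a where "a n j = measure \<tau> (A n j)" for n j
  define b where "b n j = real j * \<beta> / N n" for n j
  define g where "g n x = real_of_int \<lceil>N n * x / \<beta>\<rceil> * \<beta> / N n" for n x
  \<comment> \<open>Null cells are dropped because a gamma law needs a positive shape.\<close>
  define J where "J n = {j \<in> {1..Suc n}. 0 < a n j}" for n
  have [measurable]: "A n j \<in> sets borel" for n j unfolding A_def by measurable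
  \<comment> \<open>For 0 < x \<le> \<beta> the ceiling runs through 1, ..., n + 1, so
    \<open>g n\<close> takes the value \<open>b n j\<close> on the cell \<open>A n j\<close> and no
    other cell occurs.\<close>
  have step: "AE x in \<tau>. (f (g n x) :: complex) = (\<Sum>j\<in>{1..Suc n}. indicator (A n j) x *\<^sub>R f (b n j))" for n and f :: "real \<Rightarrow> complex"
    using AE_bounds
  proof eventually_elim
    case (elim x)
    define i where "i = nat \<lceil>N n * x / \<beta>\<rceil>"
    have pos: "0 < N n * x / \<beta>" using elim bound_pos N by simp
    have "N n * x / \<beta> \<le> N n" using elim bound_pos N[of n] by (simp add: pos_divide_le_eq)
    then have "\<lceil>N n * x / \<beta>\<rceil> \<le> int (Suc n)" by (subst ceiling_le_iff) (simp add: N_def)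
    moreover have "1 \<le> \<lceil>N n * x / \<beta>\<rceil>" using pos by linarith
    ultimately have i: "i \<in> {1..Suc n}" "\<lceil>N n * x / \<beta>\<rceil> = int i"
      unfolding i_def atLeastAtMost_iff by linarith+
    have "(\<Sum>j\<in>{1..Suc n}. indicator (A n j) x *\<^sub>R f (b n j)) = (\<Sum>j\<in>{1..Suc n}. if j = i then f (b n j) else 0)"
      using i by (intro sum.cong) (auto simp: A_def)
    also have "\<dots> = f (b n i)" using i by simp
    finally show ?case by (simp only: g_def b_def i(2) of_int_of_nat_eq)
  qed
  have int_step: "(LINT x|\<tau>. f (g n x)) = (\<Sum>j\<in>J n. of_real (a n j) * f (b n j))" for n and f :: "real \<Rightarrow> complex"
  proof -
    \<comment> \<open>Here \<open>f\<close> is arbitrary: \<open>g n\<close> factors through an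
      integer, and every function on a countable discrete space is measurable.\<close>
    have [measurable]: "(\<lambda>x. f (g n x)) \<in> borel_measurable \<tau>"
    proof -
      have "(\<lambda>i. f (real_of_int i * \<beta> / N n)) \<in> measurable (count_space UNIV) borel" by simp
      moreover have "(\<lambda>x. \<lceil>N n * x / \<beta>\<rceil>) \<in> measurable \<tau> (count_space UNIV)" by measurable
      ultimately show ?thesis unfolding g_def by (rule measurable_compose[rotated])
    qed
    have "(LINT x|\<tau>. f (g n x)) = (LINT x|\<tau>. (\<Sum>j\<in>{1..Suc n}. indicator (A n j) x *\<^sub>R f (b n j)))"
      by (intro integral_cong_AE step) measurable
    also have "\<dots> = (\<Sum>j\<in>{1..Suc n}. of_real (a n j) * f (b n j))"
      by (subst Bochner_Integration.integral_sum)
        (auto simp: a_def scaleR_conv_of_real emeasure_eq_measure)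
    also have "\<dots> = (\<Sum>j\<in>J n. of_real (a n j) * f (b n j))"
    proof (intro sum.mono_neutral_right ballI)
      fix j assume "j \<in> {1..Suc n} - J n"
      then have "a n j = 0" unfolding J_def a_def using measure_nonneg[of \<tau> "A n j"] by (auto simp: not_less)
      then show "of_real (a n j) * f (b n j) = 0" by simp
    qed (auto simp: J_def)
    finally show ?thesis .
  qed
  \<comment> \<open>The case f = 1 of \<open>int_step\<close> says that the weights sum to the total
    mass, which is positive.\<close>
  have "J n \<noteq> {}" for n
  proof
    assume "J n = {}"
    then have "complex_of_real (measure \<tau> UNIV) = 0" using int_step[of "\<lambda>_. 1" n] by simp
    then show False using mass_pos by simp
  qed
  then have "\<exists>\<mu> \<in> finite_convolutions {gamma_law a b |a b. 0 < a \<and> 0 < b}. real_distribution \<mu> \<and>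
    (\<forall>z. char \<mu> z = exp (- (\<Sum>j\<in>J n. of_real (a n j) * Ln (1 - \<i> * of_real (z / b n j)))))" for n
    by (intro finite_convolutions_gamma) (auto simp: J_def b_def bound_pos N)
  then obtain \<mu>s where \<mu>s: "\<And>n. \<mu>s n \<in> finite_convolutions {gamma_law a b |a b. 0 < a \<and> 0 < b}"
    "\<And>n. real_distribution (\<mu>s n)"
    "\<And>n z. char (\<mu>s n) z = exp (- (\<Sum>j\<in>J n. of_real (a n j) * Ln (1 - \<i> * of_real (z / b n j))))"
    by metis
  have "weak_conv_m \<mu>s \<mu>"
  proof (rule levy_continuity[OF \<mu>s(2) \<mu>(1)])
    fix z
    have lim_g: "(\<lambda>n. g n x) \<longlonglongrightarrow> x" for x
    proof (rule LIMSEQ_I)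
      fix r :: real assume "0 < r"
      then obtain N0 where N0: "\<beta> / r < real N0" using reals_Archimedean2 by blast
      have "norm (g n x - x) < r" if "n \<ge> N0" for n
      proof -
        define y where "y = N n * x / \<beta>"
        have "g n x - x = (real_of_int \<lceil>y\<rceil> - y) * (\<beta> / N n)"
          using \<beta>0 N[of n] by (simp add: g_def y_def left_diff_distrib diff_divide_distrib)
        also have "norm \<dots> \<le> 1 * (\<beta> / N n)"
          unfolding norm_mult using bound_pos by (intro mult_mono) (auto simp: N_def abs_if, linarith+)
        also have "\<dots> < r" 
        proof -
          have "\<beta> / r < N n" using N0 that by (simp add: N_def)
          then show ?thesis using \<open>0 < r\<close> N[of n] by (simp add: field_simps)
        qed
        finally show ?thesis .
      qed
      then show "\<exists>N0. \<forall>n\<ge>N0. norm (g n x - x) < r" by blast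
    qed
    have g_ge: "x \<le> g n x" for n x
      using bound_pos N[of n] le_of_int_ceiling[of "N n * x / \<beta>"]
      by (simp only: g_def pos_le_divide_eq pos_divide_le_eq mult.commute[of "N n"])
    have "(\<lambda>n. LINT x|\<tau>. Ln (1 - \<i> * of_real (z / g n x))) \<longlonglongrightarrow> (LINT x|\<tau>. Ln (1 - \<i> * of_real (z / x)))"
    proof (rule integral_dominated_convergence[OF _ _ integrable_norm_Ln_bound[of z]])
      show "AE x in \<tau>. (\<lambda>n. Ln (1 - \<i> * of_real (z / g n x))) \<longlonglongrightarrow> Ln (1 - \<i> * of_real (z / x))"
        using AE_bounds
        by eventually_elim (auto intro!: tendsto_intros lim_g simp: complex_nonpos_Reals_iff)
      show "AE x in \<tau>. norm (Ln (1 - \<i> * of_real (z / g n x))) \<le> ln (1 + \<bar>z\<bar> / x) + pi" for n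
        using AE_bounds
      proof eventually_elim
        case (elim x)
        then have "0 < g n x" using g_ge[of x n] by linarith
        then have "norm (Ln (1 - \<i> * of_real (z / g n x))) \<le> ln (1 + \<bar>z\<bar> / g n x) + pi"
          by (rule norm_Ln_one_minus_le)
        also have "ln (1 + \<bar>z\<bar> / g n x) \<le> ln (1 + \<bar>z\<bar> / x)"
          using elim g_ge[of x n] \<open>0 < g n x\<close> by (intro ln_mono add_left_mono divide_left_mono) (auto intro: add_pos_nonneg)
        finally show ?case by simp
      qed
    qed (unfold g_def, measurable)
    then have "(\<lambda>n. exp (- (LINT x|\<tau>. Ln (1 - \<i> * of_real (z / g n x))))) \<longlonglongrightarrow> exp (- thorin_exponent z)"
      unfolding thorin_exponent_def by (intro tendsto_intros)
    then show "(\<lambda>n. char (\<mu>s n) z) \<longlonglongrightarrow> char \<mu> z"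
      unfolding \<mu>s(3) \<mu>(2) int_step[of "\<lambda>x. Ln (1 - \<i> * of_real (z / x))", symmetric] .
  qed
  then show ?thesis
    using \<mu>s \<mu> by (auto simp: weak_limits_def)
qed

end

text \<open>The law is realised as a random walk with independent steps of law \<open>J\<close>,
  stopped at an independent Poisson number: given n steps the characteristic function is the n-th
  power of that of \<open>J\<close>, and the Poisson weights sum these powers to the
  exponential.\<close>

lemma char_compound_poisson:
  assumes J: "real_distribution J" and \<Lambda>: "0 < \<Lambda>"
  shows "\<exists>\<rho>. real_distribution \<rho> \<and> (\<forall>z. char \<rho> z = exp (of_real \<Lambda> * (char J z - 1)))"
proof -
  interpret J: real_distribution J by fact
  interpret I: product_prob_space "\<lambda>_::nat. J" UNIV ..
  define Q where "Q = (\<Pi>\<^sub>M i\<in>(UNIV :: nat set). J)"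
  interpret Q: prob_space Q unfolding Q_def by (rule I.prob_space_axioms)
  have [measurable_cong]: "sets Q = sets (\<Pi>\<^sub>M i\<in>UNIV. borel)"
    unfolding Q_def by (intro sets_PiM_cong) auto
  define N where "N = measure_pmf (poisson_pmf \<Lambda>)"
  interpret N: prob_space N unfolding N_def by (rule prob_space_measure_pmf)
  interpret P: pair_prob_space N Q ..
  define S where "S p = (\<Sum>i<fst p. snd p i)" for p :: "nat \<times> (nat \<Rightarrow> real)"
  have S [measurable]: "S \<in> borel_measurable (N \<Otimes>\<^sub>M Q)"
  proof -
    \<comment> \<open>The number of summands is random but countably valued, so measurability may be
      checked for each fixed number.\<close>
    have "S \<in> borel_measurable (count_space UNIV \<Otimes>\<^sub>M Q)"
    proof (rule measurable_pair_measure_countable1)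
      show "(\<lambda>y. S (n, y)) \<in> borel_measurable Q" for n
        unfolding S_def fst_conv snd_conv by measurable
    qed simp
    moreover have "sets (N \<Otimes>\<^sub>M Q) = sets (count_space UNIV \<Otimes>\<^sub>M Q)"
      unfolding N_def by (intro sets_pair_measure_cong) auto
    ultimately show ?thesis by (simp cong: measurable_cong_sets)
  qed
  have comp: "distr Q borel (\<lambda>\<omega>. \<omega> i) = J" for i
  proof -
    have "distr Q borel (\<lambda>\<omega>. \<omega> i) = distr Q J (\<lambda>\<omega>. \<omega> i)"
      by (rule distr_cong) auto
    then show ?thesis
      unfolding Q_def using distr_PiM_component[of UNIV "\<lambda>_. J" i] J.prob_space_axioms by simp
  qed
  have "Q.indep_vars (\<lambda>_. borel) (\<lambda>i \<omega>. \<omega> i) UNIV"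
  proof (subst Q.indep_vars_iff_distr_eq_PiM)
    have "distr Q (\<Pi>\<^sub>M i\<in>UNIV. borel) (\<lambda>x. \<lambda>i\<in>UNIV. x i) = distr Q Q (\<lambda>x. x)"
      by (rule distr_cong) (auto simp: \<open>sets Q = _\<close>)
    then show "distr Q (\<Pi>\<^sub>M i\<in>UNIV. borel) (\<lambda>x. \<lambda>i\<in>UNIV. x i) = (\<Pi>\<^sub>M i\<in>UNIV. distr Q borel (\<lambda>\<omega>. \<omega> i))"
      unfolding comp by (simp add: Q_def distr_id)
  qed measurable
  then have ind: "Q.indep_vars (\<lambda>_. borel) (\<lambda>i \<omega>. \<omega> i) {..<n}" for n
    by (rule Q.indep_vars_subset) simp
  have inner: "(LINT y|Q. iexp (z * S (n, y))) = char J z ^ n" for n z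
  proof -
    have "(LINT y|Q. iexp (z * S (n, y))) = char (distr Q borel (\<lambda>\<omega>. \<Sum>i<n. \<omega> i)) z"
      unfolding char_def S_def by (subst integral_distr) auto
    also have "\<dots> = char J z ^ n"
      using Q.char_distr_sum[OF ind] by (simp add: comp)
    finally show ?thesis .
  qed
  have "char (distr (N \<Otimes>\<^sub>M Q) borel S) z = exp (of_real \<Lambda> * (char J z - 1))" for z
  proof -
    define w where "w = char J z"
    have w: "norm w \<le> 1" unfolding w_def by (rule J.cmod_char_le_1)
    have "char (distr (N \<Otimes>\<^sub>M Q) borel S) z = (LINT p|(N \<Otimes>\<^sub>M Q). iexp (z * S p))"
      unfolding char_def by (subst integral_distr) auto
    also have "\<dots> = (LINT n|N. LINT y|Q. iexp (z * S (n, y)))"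
    proof (subst P.integral_fst'[symmetric])
      show "integrable (N \<Otimes>\<^sub>M Q) (\<lambda>p. iexp (z * S p))"
        by (rule P.P.integrable_const_bound[where B=1]) auto
    qed simp
    also have "\<dots> = (LINT n|N. w ^ n)" unfolding inner w_def ..
    also have "\<dots> = (LINT n|count_space UNIV. (\<Lambda> ^ n / fact n * exp (- \<Lambda>)) *\<^sub>R w ^ n)"
      unfolding N_def measure_pmf_eq_density using \<Lambda> by (subst integral_density) auto
    also have "\<dots> = exp (of_real \<Lambda> * (w - 1))"
    proof -
      have int: "integrable (count_space UNIV) (\<lambda>n. (\<Lambda> ^ n / fact n * exp (- \<Lambda>)) *\<^sub>R w ^ n)"
      proof -
        have "integrable N (\<lambda>n. w ^ n)"
          by (rule N.integrable_const_bound[where B=1])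
            (use w in \<open>auto simp: norm_power power_le_one N_def\<close>)
        then show ?thesis
          unfolding N_def measure_pmf_eq_density using \<Lambda> by (subst (asm) integrable_density) auto
      qed
      have "(\<lambda>n. exp (- of_real \<Lambda>) * ((of_real \<Lambda> * w) ^ n /\<^sub>R fact n)) sums (exp (- of_real \<Lambda>) * exp (of_real \<Lambda> * w))"
        by (intro sums_mult exp_converges)
      moreover have "exp (- of_real \<Lambda>) * ((of_real \<Lambda> * w) ^ n /\<^sub>R fact n) = (\<Lambda> ^ n / fact n * exp (- \<Lambda>)) *\<^sub>R w ^ n" for n
        by (simp add: scaleR_conv_of_real power_mult_distrib exp_of_real[symmetric] divide_inverse mult_ac)
      ultimately have "(\<lambda>n. (\<Lambda> ^ n / fact n * exp (- \<Lambda>)) *\<^sub>R w ^ n) sums (exp (- of_real \<Lambda>) * exp (of_real \<Lambda> * w))"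
        by simp
      from sums_unique2[OF this sums_integral_count_space_nat[OF int]]
      show ?thesis by (simp add: exp_add[symmetric] algebra_simps)
    qed
    finally show ?thesis by (simp add: w_def)
  qed
  moreover have "real_distribution (distr (N \<Otimes>\<^sub>M Q) borel S)"
    by (rule P.real_distribution_distr) measurable
  ultimately show ?thesis by blast
qed

context bounded_thorin_measure
begin

text \<open>The jump law is the image of a probability measure on pairs \<open>(s, x)\<close>, which avoids integrating
  its density over \<open>\<tau>\<close>.\<close>

lemma selfdecomposable_char:
  assumes b: "0 < b" "b < 1"
  shows "\<exists>\<rho>. real_distribution \<rho> \<and> (\<forall>z. char \<rho> z = exp (thorin_exponent (b * z) - thorin_exponent z))"
proof -
  interpret P: pair_sigma_finite \<tau> lborel ..
  \<comment> \<open>The total jump intensity: for every \<open>s\<close> the Frullani integral of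
    \<open>h s\<close> equals ln (s/b) - ln s = ln (1/b).\<close>
  define \<Lambda> where "\<Lambda> = measure \<tau> UNIV * ln (1 / b)"
  have \<Lambda>: "0 < \<Lambda>" unfolding \<Lambda>_def using mass_pos b by (intro mult_pos_pos ln_gt_zero) auto
  \<comment> \<open>Scaling the variable by \<open>b\<close> turns the gamma rate \<open>s\<close>
    into \<open>s / b\<close>, so the quotient of the characteristic functions at z and bz has the
    difference of the two Levy densities. It is nonnegative because b < 1; the guard
    \<open>0 < s\<close> keeps it so off the support of \<tau>.\<close>
  define h :: "real \<Rightarrow> real \<Rightarrow> real" where
    "h s x = (if 0 < s then indicator {0<..} x *\<^sub>R ((exp (- s * x) - exp (- (s / b) * x)) / x) else 0)" for s x
  have h_nonneg: "0 \<le> h s x" for s x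
  proof -
    have "exp (- (s / b) * x) \<le> exp (- s * x)" if "0 < s" "0 < x"
    proof -
      have "s * x * 1 \<le> s * x * (1 / b)" using b that by (intro mult_left_mono) auto
      then show ?thesis by simp
    qed
    then show ?thesis by (auto simp: h_def split: split_indicator)
  qed
  have h_meas [measurable]: "case_prod h \<in> borel_measurable (\<tau> \<Otimes>\<^sub>M lborel)"
    unfolding h_def by measurable
  have h_int: "has_bochner_integral lborel (h s) (ln (1 / b))" if "0 < s" for s
  proof -
    have "ln (s / b) - ln s = ln (1 / b)" using that b by (simp add: ln_div)
    then show ?thesis
      using has_bochner_integral_frullani_real[of s "s / b"] that b by (simp add: h_def[abs_def] del: real_scaleR_def)
  qed
  have nn_h: "(\<integral>\<^sup>+p. ennreal (case_prod h p) \<partial>(\<tau> \<Otimes>\<^sub>M lborel)) = ennreal \<Lambda>"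
  proof -
    have "(\<integral>\<^sup>+p. ennreal (case_prod h p) \<partial>(\<tau> \<Otimes>\<^sub>M lborel)) = (\<integral>\<^sup>+s. \<integral>\<^sup>+x. ennreal (h s x) \<partial>lborel \<partial>\<tau>)"
      by (subst lborel.nn_integral_fst[symmetric]) auto
    also have "\<dots> = (\<integral>\<^sup>+s. ennreal (ln (1 / b)) \<partial>\<tau>)"
    proof (intro nn_integral_cong_AE)
      show "AE s in \<tau>. (\<integral>\<^sup>+x. ennreal (h s x) \<partial>lborel) = ennreal (ln (1 / b))"
        using AE_bounds
      proof eventually_elim
        case (elim s)
        then show ?case using h_int[of s] h_nonneg
          by (subst nn_integral_eq_integral) (auto simp: has_bochner_integral_iff)
      qed
    qed
    also have "\<dots> = ennreal \<Lambda>"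
      using b by (simp add: \<Lambda>_def emeasure_eq_measure ennreal_mult''[symmetric] mult.commute)
    finally show ?thesis .
  qed
  \<comment> \<open>Normalised by \<Lambda>, the measure with density \<open>h\<close> on pairs is a
    probability; its second marginal is the jump law.\<close>
  define D where "D = density (\<tau> \<Otimes>\<^sub>M lborel) (\<lambda>p. ennreal (case_prod h p / \<Lambda>))"
  have [measurable_cong]: "sets D = sets (\<tau> \<Otimes>\<^sub>M lborel)" by (simp add: D_def)
  have "emeasure D (space D) = (\<integral>\<^sup>+p. 1 \<partial>D)" by simp
  also have "\<dots> = (\<integral>\<^sup>+p. ennreal (1 / \<Lambda>) * ennreal (case_prod h p) \<partial>(\<tau> \<Otimes>\<^sub>M lborel))"
    unfolding D_def using \<Lambda> h_nonneg
    by (subst nn_integral_density) (auto intro!: nn_integral_cong simp: ennreal_mult'[symmetric])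
  also have "\<dots> = ennreal (1 / \<Lambda>) * ennreal \<Lambda>"
    by (subst nn_integral_cmult) (auto simp: nn_h)
  also have "\<dots> = 1" using \<Lambda> by (simp add: ennreal_mult'[symmetric])
  finally interpret D: prob_space D by (rule prob_spaceI)
  define J where "J = distr D borel snd"
  have J: "real_distribution J" unfolding J_def by (rule D.real_distribution_distr) measurable
  have int_h: "integrable (\<tau> \<Otimes>\<^sub>M lborel) (case_prod h)"
    using nn_h h_nonneg by (intro integrableI_nonneg) auto
  have char_J: "char J z = 1 + (thorin_exponent (b * z) - thorin_exponent z) / of_real \<Lambda>" for z
  proof -
    have int_hz: "integrable (\<tau> \<Otimes>\<^sub>M lborel) (\<lambda>(s, x). (iexp (z * x) - 1) * of_real (h s x))"
    proof (rule Bochner_Integration.integrable_bound)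
      show "integrable (\<tau> \<Otimes>\<^sub>M lborel) (\<lambda>p. 2 * case_prod h p)"
        by (intro integrable_mult_right int_h)
      have "norm ((iexp (z * x) - 1) * of_real (h s x)) \<le> 2 * h s x" for s x
        using norm_triangle_ineq4[of "iexp (z * x)" 1] h_nonneg[of s x]
        by (auto simp: norm_mult intro!: mult_right_mono)
      then show "AE p in \<tau> \<Otimes>\<^sub>M lborel. norm (case p of (s, x) \<Rightarrow> (iexp (z * x) - 1) * of_real (h s x)) \<le> norm (2 * case_prod h p)"
        using h_nonneg by (intro AE_I2) (auto simp: case_prod_beta)
    qed measurable
    have inner: "(LINT x|lborel. (iexp (z * x) - 1) * of_real (h s x)) = Ln (1 - \<i> * of_real (b * z / s)) - Ln (1 - \<i> * of_real (z / s))"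
      if s: "0 < s" for s
    proof -
      have sb: "0 < s / b" using s b by simp
      have "(LINT x|lborel. (iexp (z * x) - 1) * of_real (h s x)) =
        (LINT x:{0<..}|lborel. (iexp (z * x) - 1) * of_real (exp (- s * x) / x) - (iexp (z * x) - 1) * of_real (exp (- (s / b) * x) / x))"
        unfolding set_lebesgue_integral_def using s
        by (intro Bochner_Integration.integral_cong)
          (auto simp: h_def right_diff_distrib diff_divide_distrib split: split_indicator)
      also have "\<dots> = - Ln (1 - \<i> * of_real (z / s)) - - Ln (1 - \<i> * of_real (z / (s / b)))"
        using levy_khintchine_gamma[OF s, of z] levy_khintchine_gamma[OF sb, of z]
        by (subst set_integral_diff) auto
      finally show ?thesis using b by (simp add: mult.commute)
    qed
    have "char J z = (LINT p|D. iexp (z * snd p))"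
      unfolding char_def J_def by (subst integral_distr) auto
    also have "\<dots> = 1 + (LINT p|D. iexp (z * snd p) - 1)"
    proof -
      have "integrable D (\<lambda>p. iexp (z * snd p))"
        by (rule D.integrable_const_bound[where B=1]) auto
      then show ?thesis by (simp add: D.prob_space)
    qed
    also have "(LINT p|D. iexp (z * snd p) - 1) = (LINT p|(\<tau> \<Otimes>\<^sub>M lborel). (case p of (s, x) \<Rightarrow> (iexp (z * x) - 1) * of_real (h s x)) / of_real \<Lambda>)"
      unfolding D_def using h_nonneg \<Lambda>
      by (subst integral_density)
        (auto intro!: Bochner_Integration.integral_cong simp: scaleR_conv_of_real case_prod_beta divide_simps)
    also have "\<dots> = (LINT s|\<tau>. LINT x|lborel. (iexp (z * x) - 1) * of_real (h s x)) / of_real \<Lambda>"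
      unfolding integral_divide_zero P.integral_fst'[OF int_hz, symmetric] prod.case ..
    also have "(LINT s|\<tau>. LINT x|lborel. (iexp (z * x) - 1) * of_real (h s x)) =
      (LINT s|\<tau>. Ln (1 - \<i> * of_real (b * z / s)) - Ln (1 - \<i> * of_real (z / s)))"
    proof (intro integral_cong_AE)
      show "(\<lambda>s. LINT x|lborel. (iexp (z * x) - 1) * of_real (h s x)) \<in> borel_measurable \<tau>"
        using P.integrable_fst'[OF int_hz] by simp
      show "AE s in \<tau>. (LINT x|lborel. (iexp (z * x) - 1) * of_real (h s x)) = Ln (1 - \<i> * of_real (b * z / s)) - Ln (1 - \<i> * of_real (z / s))"
        using AE_bounds by eventually_elim (use inner in blast)
    qed measurable
    also have "\<dots> = thorin_exponent (b * z) - thorin_exponent z"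
      unfolding thorin_exponent_def
      by (rule Bochner_Integration.integral_diff[OF integrable_thorin_exponent integrable_thorin_exponent])
    finally show ?thesis .
  qed
  obtain \<rho> where \<rho>: "real_distribution \<rho>" "\<And>z. char \<rho> z = exp (of_real \<Lambda> * (char J z - 1))"
    using char_compound_poisson[OF J \<Lambda>] by blast
  have "char \<rho> z = exp (thorin_exponent (b * z) - thorin_exponent z)" for z
    using \<Lambda> unfolding \<rho>(2) char_J by simp
  then show ?thesis using \<rho>(1) by blast
qed

lemma selfdecomposable_thorin:
  assumes "\<And>z. char \<mu> z = exp (- thorin_exponent z)"
  shows "selfdecomposable \<mu>"
  unfolding selfdecomposable_def
proof (intro allI impI)
  fix b :: real assume "0 < b" "b < 1"
  then obtain \<rho> where "real_distribution \<rho>" "\<And>z. char \<rho> z = exp (thorin_exponent (b * z) - thorin_exponent z)"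
    using selfdecomposable_char by blast
  then show "\<exists>\<rho>. real_distribution \<rho> \<and> (\<forall>z. char \<mu> z = char \<mu> (b * z) * char \<rho> z)"
    by (intro exI[of _ \<rho>]) (simp add: assms exp_add[symmetric])
qed

section \<open>The Levy measure of the law with exponent \<open>thorin_exponent\<close>\<close>

definition levy_k :: "real \<Rightarrow> real" where
  "levy_k x = (LINT s|\<tau>. exp (- (s * x)))"

text \<open>The mixture over \<tau> of the gamma Levy densities exp (- s x)/x, which is why the
  Laplace transform \<open>levy_k\<close> of \<tau> appears.\<close>

definition levy_measure :: "real measure" where
  "levy_measure = density lborel (\<lambda>x. ennreal (if 0 < x then levy_k x / x else 0))"

lemma measurable_levy_k [measurable]: "levy_k \<in> borel_measurable borel"
  unfolding levy_k_def[abs_def] by measurable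

lemma sets_levy_measure [measurable_cong, simp]: "sets levy_measure = sets borel"
  by (simp add: levy_measure_def)

lemma integrable_exp_neg:
  assumes "0 \<le> x"
  shows "integrable \<tau> (\<lambda>s. exp (- (s * x)))"
proof (rule integrable_const_bound[where B=1])
  show "AE s in \<tau>. norm (exp (- (s * x))) \<le> 1"
    using AE_bounds by eventually_elim (use assms in simp)
qed measurable

lemma levy_k_nonneg: "0 \<le> levy_k x"
  unfolding levy_k_def by (rule integral_nonneg_AE) simp

lemma levy_k_antimono: "antimono_on {0<..} levy_k"
proof (rule monotone_onI)
  fix x y :: real assume xy: "x \<in> {0<..}" "x \<le> y"
  have "AE s in \<tau>. exp (- (s * y)) \<le> exp (- (s * x))"
    using AE_bounds by eventually_elim (use xy in \<open>auto intro: mult_left_mono\<close>)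
  then show "levy_k y \<le> levy_k x"
    unfolding levy_k_def using xy by (intro integral_mono_AE integrable_exp_neg) auto
qed

lemma levy_k_le: 
  assumes "0 < x"
  shows "levy_k x \<le> measure \<tau> UNIV"
proof -
  have "AE s in \<tau>. exp (- (s * x)) \<le> 1"
    using AE_bounds by eventually_elim (use assms in simp)
  then have "levy_k x \<le> (LINT s|\<tau>. 1)"
    unfolding levy_k_def using assms by (intro integral_mono_AE integrable_exp_neg) auto
  then show ?thesis by simp
qed

lemma levy_k_tendsto: "(levy_k \<longlongrightarrow> measure \<tau> UNIV) (at_right 0)"
proof (rule tendsto_at_right_sequentially[of 0 1])
  fix S :: "nat \<Rightarrow> real" assume S: "\<And>n. 0 < S n" "S \<longlonglongrightarrow> 0"
  have "(\<lambda>n. LINT s|\<tau>. exp (- (s * S n))) \<longlonglongrightarrow> (LINT s|\<tau>. 1)"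
  proof (rule integral_dominated_convergence[where w="\<lambda>_. 1"])
    show "AE s in \<tau>. (\<lambda>n. exp (- (s * S n))) \<longlonglongrightarrow> 1"
    proof (intro AE_I2)
      fix s
      have "(\<lambda>n. exp (- (s * S n))) \<longlonglongrightarrow> exp (- (s * 0))" by (intro tendsto_intros S)
      then show "(\<lambda>n. exp (- (s * S n))) \<longlonglongrightarrow> 1" by simp
    qed
    show "AE s in \<tau>. norm (exp (- (s * S n))) \<le> 1" for n
      using AE_bounds by eventually_elim (use S(1)[of n] in simp)
  qed auto
  then show "(\<lambda>n. levy_k (S n)) \<longlonglongrightarrow> measure \<tau> UNIV"
    unfolding levy_k_def by simp
qed simp

text \<open>By Tonelli the integral over \<open>x\<close> is ln (1 + 1/s), which is integrable under
  \<tau>. Since the integrand equals exp (- s x) (1 - exp (- x))/x, the lemma both yields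
  integrability of the gauge under the Levy measure and dominates the integrand in the exchange of
  integrals below.\<close>

lemma integrable_frullani_pair:
  "integrable (\<tau> \<Otimes>\<^sub>M lborel) (\<lambda>(s, x). if 0 < s then indicator {0<..} x *\<^sub>R ((exp (- s * x) - exp (- (s + 1) * x)) / x) else 0)"
proof (rule integrableI_nonneg)
  let ?h = "\<lambda>s x. if 0 < s then indicator {0<..} x *\<^sub>R ((exp (- s * x) - exp (- (s + 1) * x)) / x) else (0::real)"
  have "exp (- (s + 1) * x) \<le> exp (- s * x)" if "0 < x" for s x :: real
    using that by (simp add: algebra_simps)
  then have nonneg: "0 \<le> ?h s x" for s x
    by (auto split: split_indicator)
  then show "AE p in \<tau> \<Otimes>\<^sub>M lborel. 0 \<le> case_prod ?h p" by auto
  have "(\<integral>\<^sup>+p. ennreal (case_prod ?h p) \<partial>(\<tau> \<Otimes>\<^sub>M lborel)) = (\<integral>\<^sup>+s. \<integral>\<^sup>+x. ennreal (?h s x) \<partial>lborel \<partial>\<tau>)"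
    by (subst lborel.nn_integral_fst[symmetric]) auto
  also have "\<dots> = (\<integral>\<^sup>+s. ennreal (ln (1 + 1 / s)) \<partial>\<tau>)"
  proof (intro nn_integral_cong_AE)
    show "AE s in \<tau>. (\<integral>\<^sup>+x. ennreal (?h s x) \<partial>lborel) = ennreal (ln (1 + 1 / s))"
      using AE_bounds
    proof eventually_elim
      case (elim s)
      then have "ln (s + 1) - ln s = ln (1 + 1 / s)"
        by (simp add: ln_divide_pos[symmetric] add_divide_distrib)
      then show ?case using nn_integral_frullani[of s "s + 1"] elim by simp
    qed
  qed
  also have "\<dots> < \<infinity>"
  proof -
    have "AE s in \<tau>. 0 \<le> ln (1 + 1 / s)"
      using AE_bounds by eventually_elim simp
    then show ?thesis using integrable_ln_shift[of 1] by (subst nn_integral_eq_integral) auto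
  qed
  finally show "(\<integral>\<^sup>+p. ennreal (case_prod ?h p) \<partial>(\<tau> \<Otimes>\<^sub>M lborel)) < \<infinity>" .
qed measurable

lemma AE_levy_measure_pos: "AE x in levy_measure. 0 < x"
  unfolding levy_measure_def by (subst AE_density) auto

lemma integrable_levy_measure_iff:
  fixes f :: "real \<Rightarrow> 'b::{banach, second_countable_topology}"
  assumes [measurable]: "f \<in> borel_measurable borel"
  shows "integrable levy_measure f \<longleftrightarrow> integrable lborel (\<lambda>x. (if 0 < x then levy_k x / x else 0) *\<^sub>R f x)"
  unfolding levy_measure_def using levy_k_nonneg by (subst integrable_density) auto

text \<open>Integrating the pair function of \<open>integrable_frullani_pair\<close> over
  \<open>s\<close> first leaves the gauge times the Levy density.\<close>

lemma integrable_levy_measure_exp: "integrable levy_measure (\<lambda>x. 1 - exp (- x))"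
proof -
  interpret P: pair_sigma_finite \<tau> lborel ..
  let ?h = "\<lambda>s x. if 0 < s then indicator {0<..} x *\<^sub>R ((exp (- s * x) - exp (- (s + 1) * x)) / x) else (0::real)"
  have "integrable lborel (\<lambda>x. LINT s|\<tau>. ?h s x)"
    by (rule P.integrable_snd[OF integrable_frullani_pair])
  also have "(\<lambda>x. LINT s|\<tau>. ?h s x) = (\<lambda>x. (if 0 < x then levy_k x / x else 0) *\<^sub>R (1 - exp (- x)))"
  proof
    fix x :: real
    have "(LINT s|\<tau>. ?h s x) = (LINT s|\<tau>. (if 0 < x then 1 / x else 0) * (1 - exp (- x)) * exp (- (s * x)))"
    proof (intro integral_cong_AE)
      show "AE s in \<tau>. ?h s x = (if 0 < x then 1 / x else 0) * (1 - exp (- x)) * exp (- (s * x))"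
        using AE_bounds
      proof eventually_elim
        case (elim s)
        have "exp (- (s + 1) * x) = exp (- x) * exp (- (s * x))"
          by (simp add: exp_add[symmetric] algebra_simps)
        then show ?case using elim by (simp add: algebra_simps diff_divide_distrib)
      qed
    qed measurable
    also have "\<dots> = (if 0 < x then levy_k x / x else 0) *\<^sub>R (1 - exp (- x))"
      by (simp add: levy_k_def)
    finally show "(LINT s|\<tau>. ?h s x) = (if 0 < x then levy_k x / x else 0) *\<^sub>R (1 - exp (- x))" .
  qed
  finally show ?thesis by (subst integrable_levy_measure_iff) auto
qed

lemma integrable_levy_measure_bound:
  fixes f :: "real \<Rightarrow> 'b::{banach, second_countable_topology}"
  assumes [measurable]: "f \<in> borel_measurable borel"
    and le: "\<And>x. 0 < x \<Longrightarrow> norm (f x) \<le> C * (1 - exp (- x))"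
  shows "integrable levy_measure f"
proof (rule Bochner_Integration.integrable_bound)
  show "integrable levy_measure (\<lambda>x. C * (1 - exp (- x)))"
    by (intro integrable_mult_right integrable_levy_measure_exp)
  show "AE x in levy_measure. norm (f x) \<le> norm (C * (1 - exp (- x)))"
    using AE_levy_measure_pos by eventually_elim (use le in force)
qed measurable

text \<open>Fubini for \<open>F\<close>: integration over \<open>s\<close> first produces the Levy
  density, integration over \<open>x\<close> first is \<open>levy_khintchine_gamma\<close>.
  Domination is by a multiple of the integrable pair function.\<close>

lemma integral_levy_measure_iexp:
  "(LINT x|levy_measure. iexp (z * x) - 1) = - thorin_exponent z"
proof -
  interpret P: pair_sigma_finite \<tau> lborel ..
  let ?h = "\<lambda>s x. if 0 < s then indicator {0<..} x *\<^sub>R ((exp (- s * x) - exp (- (s + 1) * x)) / x) else (0::real)"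
  define F :: "real \<Rightarrow> real \<Rightarrow> complex" where
    "F s x = (if 0 < s then indicator {0<..} x *\<^sub>R ((iexp (z * x) - 1) * of_real (exp (- s * x) / x)) else 0)" for s x
  have [measurable]: "case_prod F \<in> borel_measurable (\<tau> \<Otimes>\<^sub>M lborel)"
    unfolding F_def by measurable
  have int_F: "integrable (\<tau> \<Otimes>\<^sub>M lborel) (case_prod F)"
  proof (rule Bochner_Integration.integrable_bound)
    show "integrable (\<tau> \<Otimes>\<^sub>M lborel) (\<lambda>p. (4 + 2 * \<bar>z\<bar>) * case_prod ?h p)"
      by (intro integrable_mult_right integrable_frullani_pair)
    have "norm (F s x) \<le> (4 + 2 * \<bar>z\<bar>) * ?h s x" for s x
    proof (cases "0 < s \<and> 0 < x")
      case True
      then have "norm (F s x) = norm (iexp (z * x) - 1) * (exp (- s * x) / x)"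
        by (simp add: F_def norm_mult norm_divide)
      also have "\<dots> \<le> ((4 + 2 * \<bar>z\<bar>) * (1 - exp (- x))) * (exp (- s * x) / x)"
        using True by (intro mult_right_mono norm_iexp_minus_1_le) auto
      also have "\<dots> = (4 + 2 * \<bar>z\<bar>) * ((exp (- s * x) - exp (- (s + 1) * x)) / x)"
        by (simp add: left_diff_distrib distrib_right exp_diff exp_minus divide_simps)
      finally show ?thesis using True by simp
    qed (auto simp: F_def)
    then show "AE p in \<tau> \<Otimes>\<^sub>M lborel. norm (case_prod F p) \<le> norm ((4 + 2 * \<bar>z\<bar>) * case_prod ?h p)"
      by (intro AE_I2) (smt (verit, best) case_prod_beta real_norm_def)
  qed measurable
  have "(LINT x|levy_measure. iexp (z * x) - 1) = (LINT x|lborel. (if 0 < x then levy_k x / x else 0) *\<^sub>R (iexp (z * x) - 1))"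
    unfolding levy_measure_def using levy_k_nonneg by (subst integral_density) auto
  also have "\<dots> = (LINT x|lborel. LINT s|\<tau>. F s x)"
  proof (intro Bochner_Integration.integral_cong refl)
    fix x :: real
    have "(LINT s|\<tau>. F s x) = (LINT s|\<tau>. (if 0 < x then 1 / x else 0) *\<^sub>R ((iexp (z * x) - 1) * of_real (exp (- (s * x)))))"
    proof (intro integral_cong_AE)
      show "AE s in \<tau>. F s x = (if 0 < x then 1 / x else 0) *\<^sub>R ((iexp (z * x) - 1) * of_real (exp (- (s * x))))"
        using AE_bounds by eventually_elim (auto simp: F_def scaleR_conv_of_real)
    qed (unfold F_def, measurable)
    also have "\<dots> = (if 0 < x then levy_k x / x else 0) *\<^sub>R (iexp (z * x) - 1)"
      unfolding levy_k_def integral_scaleR_right integral_mult_right_zero integral_complex_of_real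
      by (simp add: scaleR_conv_of_real)
    finally show "(if 0 < x then levy_k x / x else 0) *\<^sub>R (iexp (z * x) - 1) = (LINT s|\<tau>. F s x)" ..
  qed
  also have "\<dots> = (LINT s|\<tau>. LINT x|lborel. F s x)"
    by (rule P.Fubini_integral[OF int_F])
  also have "\<dots> = (LINT s|\<tau>. - Ln (1 - \<i> * of_real (z / s)))"
  proof (intro integral_cong_AE)
    show "(\<lambda>s. LINT x|lborel. F s x) \<in> borel_measurable \<tau>"
      using P.integrable_fst[OF int_F] by simp
    show "AE s in \<tau>. (LINT x|lborel. F s x) = - Ln (1 - \<i> * of_real (z / s))"
      using AE_bounds
    proof eventually_elim
      case (elim s)
      then show ?case
        using levy_khintchine_gamma(2)[of s z] by (simp add: F_def set_lebesgue_integral_def)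
    qed
  qed measurable
  finally show ?thesis by (simp add: thorin_exponent_def)
qed

text \<open>The jumps of size at most 1 are integrable, so the truncation term can be split off and
  absorbed into the location \<open>g\<close>, its own integral. There is no Gaussian part.\<close>

lemma levy_measure_of_thorin:
  assumes "\<And>z. char \<mu> z = exp (- thorin_exponent z)"
  shows "levy_measure_of \<mu> levy_measure"
  unfolding levy_measure_of_def measure_on_def
proof (intro conjI)
  show "sets levy_measure = sets borel" by simp
  have "AE x in levy_measure. x \<notin> - (- {0})"
    using AE_levy_measure_pos by eventually_elim simp
  then show "emeasure levy_measure (- (- {0})) = 0"
    by (subst (asm) AE_iff_null_sets[symmetric]) (auto simp: null_sets_def)
  have "integrable levy_measure (\<lambda>x. min 1 (x\<^sup>2))"
  proof (rule integrable_levy_measure_bound[where C=2])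
    fix x :: real assume x: "0 < x"
    have "x\<^sup>2 \<le> x" if "x \<le> 1" using x that by (simp add: power2_eq_square mult_left_le)
    then have "min 1 (x\<^sup>2) \<le> min 1 x" by (cases "x \<le> 1") (auto simp: min_def)
    also have "\<dots> \<le> 2 * (1 - exp (- x))" using x by (intro min_one_le_exp) simp
    finally show "norm (min 1 (x\<^sup>2)) \<le> 2 * (1 - exp (- x))" by simp
  qed measurable
  then show "(\<integral>\<^sup>+x. ennreal (min 1 (x\<^sup>2)) \<partial>levy_measure) < \<infinity>"
    by (subst nn_integral_eq_integral) auto
  define g where "g = (LINT x|levy_measure. x * indicator {-1..1} x)"
  have int1: "integrable levy_measure (\<lambda>x. x * indicator {-1..1} x)"
  proof (rule integrable_levy_measure_bound[where C=2])
    fix x :: real assume x: "0 < x"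
    then show "norm (x * indicator {-1..1} x) \<le> 2 * (1 - exp (- x))"
      using min_one_le_exp[of x] by (auto simp: min_def split: split_indicator if_splits)
  qed measurable
  have int2: "integrable levy_measure (\<lambda>x. iexp (z * x) - 1)" for z
  proof (rule integrable_levy_measure_bound)
    show "norm (iexp (z * x) - 1) \<le> (4 + 2 * \<bar>z\<bar>) * (1 - exp (- x))" if "0 < x" for x
      using that by (intro norm_iexp_minus_1_le) simp
  qed measurable
  have "char \<mu> z = exp (\<i> * complex_of_real (g * z) - complex_of_real (0 * z\<^sup>2 / 2) +
           (LINT x|levy_measure. iexp (z * x) - 1 - \<i> * complex_of_real (z * x * indicator {-1..1} x)))" for z
  proof -
    have "(LINT x|levy_measure. iexp (z * x) - 1 - \<i> * complex_of_real (z * x * indicator {-1..1} x))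
      = (LINT x|levy_measure. (iexp (z * x) - 1) - \<i> * of_real z * complex_of_real (x * indicator {-1..1} x))"
      by (intro Bochner_Integration.integral_cong) (auto simp: algebra_simps)
    also have "\<dots> = (LINT x|levy_measure. iexp (z * x) - 1) - (LINT x|levy_measure. \<i> * of_real z * complex_of_real (x * indicator {-1..1} x))"
      by (intro Bochner_Integration.integral_diff int2 integrable_mult_right integrable_of_real int1)
    also have "\<dots> = - thorin_exponent z - \<i> * of_real z * of_real g"
      unfolding integral_levy_measure_iexp integral_mult_right_zero integral_complex_of_real g_def ..
    finally show ?thesis by (simp add: assms algebra_simps)
  qed
  then show "\<exists>g v. 0 \<le> v \<and> (\<forall>z. char \<mu> z = exp (\<i> * complex_of_real (g * z) - complex_of_real (v * z\<^sup>2 / 2) +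
           (LINT x|levy_measure. iexp (z * x) - 1 - \<i> * complex_of_real (z * x * indicator {-1..1} x))))"
    by (intro exI[of _ g] exI[of _ 0]) simp
qed

text \<open>As \<open>levy_k\<close> is bounded by the mass of \<tau>, the integrand near 0 is at
  most a constant times x powr (p - 1), integrable for every positive \<open>p\<close>. The infimum
  is thus that of all positive reals.\<close>

lemma blumenthal_getoor_index_levy_measure: "blumenthal_getoor_index levy_measure = 0"
proof -
  have "(\<integral>\<^sup>+x\<in>{-1..1}. ennreal (\<bar>x\<bar> powr p) \<partial>levy_measure) < \<infinity>" if p: "0 < p" for p
  proof -
    have "(\<integral>\<^sup>+x\<in>{-1..1}. ennreal (\<bar>x\<bar> powr p) \<partial>levy_measure)
      = (\<integral>\<^sup>+x. ennreal (if 0 < x then levy_k x / x else 0) * (ennreal (\<bar>x\<bar> powr p) * indicator {-1..1} x) \<partial>lborel)"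
      unfolding levy_measure_def by (subst nn_integral_density) auto
    \<comment> \<open>On (0,1] the factor exp 1 * exp (- x) is at least 1; inserting it replaces the
      truncated power by a Gamma integrand on the half-line.\<close>
    also have "\<dots> \<le> (\<integral>\<^sup>+x. ennreal (measure \<tau> UNIV * exp 1) * ennreal (indicator {0<..} x *\<^sub>R (x powr (p - 1) * exp (- 1 * x))) \<partial>lborel)"
    proof (intro nn_integral_mono)
      fix x :: real
      show "ennreal (if 0 < x then levy_k x / x else 0) * (ennreal (\<bar>x\<bar> powr p) * indicator {-1..1} x)
        \<le> ennreal (measure \<tau> UNIV * exp 1) * ennreal (indicator {0<..} x *\<^sub>R (x powr (p - 1) * exp (- 1 * x)))"
      proof (cases "0 < x \<and> x \<le> 1")
        case True
        then have x: "0 < x" "x \<le> 1" by auto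
        have "levy_k x / x * x powr p = levy_k x * x powr (p - 1)"
          using x by (simp add: powr_diff)
        also have "\<dots> \<le> (measure \<tau> UNIV * 1) * x powr (p - 1)"
          using levy_k_le[of x] x by (intro mult_right_mono) auto
        also have "\<dots> \<le> (measure \<tau> UNIV * (exp 1 * exp (- x))) * x powr (p - 1)"
          using x by (intro mult_right_mono mult_left_mono) (auto simp: exp_add[symmetric])
        finally show ?thesis using x levy_k_nonneg[of x]
          by (simp add: ennreal_mult'[symmetric] mult_ac)
      qed (auto split: split_indicator)
    qed
    also have "\<dots> = ennreal (measure \<tau> UNIV * exp 1) * (\<integral>\<^sup>+x. ennreal (indicator {0<..} x *\<^sub>R (x powr (p - 1) * exp (- 1 * x))) \<partial>lborel)"
      by (rule nn_integral_cmult) measurable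
    also have "\<dots> < \<infinity>"
      using has_bochner_integral_gamma_real[of p 1] p
      by (subst nn_integral_eq_integral) (auto simp: has_bochner_integral_iff ennreal_mult_less_top)
    finally show ?thesis .
  qed
  then have "{p. 0 < p \<and> (\<integral>\<^sup>+x\<in>{-1..1}. ennreal (\<bar>x\<bar> powr p) \<partial>levy_measure) < \<infinity>} = {0<..}"
    by auto
  then show ?thesis unfolding blumenthal_getoor_index_def by simp
qed

lemma thorin_measure: "thorin_measure \<tau>"
  unfolding thorin_measure_def measure_on_def
proof (intro conjI)
  have "AE x in \<tau>. x \<notin> - {0<..}"
    using AE_bounds by eventually_elim simp
  then show "emeasure \<tau> (- {0<..}) = 0"
    by (subst (asm) AE_iff_null_sets[symmetric]) (auto simp: null_sets_def)
  have "(\<integral>\<^sup>+x\<in>{0<..1}. ennreal (1 + \<bar>ln x\<bar>) \<partial>\<tau>) \<le> (\<integral>\<^sup>+x. ennreal (1 + \<bar>ln x\<bar>) \<partial>\<tau>)"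
    by (intro nn_integral_mono) (auto split: split_indicator)
  also have "\<dots> < \<infinity>"
    using integrable_abs[OF integrable_ln] by (subst nn_integral_eq_integral) auto
  finally have 1: "(\<integral>\<^sup>+x\<in>{0<..1}. ennreal (1 + \<bar>ln x\<bar>) \<partial>\<tau>) < \<infinity>" .
  have "(\<integral>\<^sup>+x\<in>{1<..}. ennreal (1 / x\<^sup>2) \<partial>\<tau>) \<le> (\<integral>\<^sup>+x. 1 \<partial>\<tau>)"
    by (intro nn_integral_mono) (auto split: split_indicator simp: one_le_power)
  also have "\<dots> < \<infinity>" by (simp add: emeasure_eq_measure)
  finally show "(\<integral>\<^sup>+x\<in>{0<..1}. ennreal (1 + \<bar>ln x\<bar>) \<partial>\<tau>) + (\<integral>\<^sup>+x\<in>{1<..}. ennreal (1 / x\<^sup>2) \<partial>\<tau>) < \<infinity>"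
    using 1 by (simp add: ennreal_add_less_top)
qed (rule sets_eq)

text \<open>On [1,oo) the function 1/x is bounded and \<tau> is finite, so the compensator
  integrates separately, to iz times the drift. This cancellation is the origin of the value of
  \<open>c'\<close>.\<close>

lemma thorin_triplet:
  assumes "\<And>z. char \<mu> z = exp (- thorin_exponent z)"
  shows "thorin_triplet (LINT x:{1..}|\<tau>. 1 / x) \<tau> \<mu>"
  unfolding thorin_triplet_def
proof (intro conjI allI thorin_measure)
  fix z
  have int: "integrable \<tau> (\<lambda>x. indicator {1..} x *\<^sub>R (1 / x))"
    by (rule integrable_const_bound[where B=1]) (auto split: split_indicator)
  have "(LINT x:{0<..}|\<tau>. Ln (1 - \<i> * complex_of_real (z / x)) + \<i> * complex_of_real (z / x * indicator {1..} x))
    = (LINT x|\<tau>. Ln (1 - \<i> * complex_of_real (z / x)) + \<i> * of_real z * complex_of_real (indicator {1..} x *\<^sub>R (1 / x)))"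
    unfolding set_lebesgue_integral_def
  proof (intro integral_cong_AE)
    show "AE x in \<tau>. indicator {0<..} x *\<^sub>R (Ln (1 - \<i> * complex_of_real (z / x)) + \<i> * complex_of_real (z / x * indicator {1..} x))
      = Ln (1 - \<i> * complex_of_real (z / x)) + \<i> * of_real z * complex_of_real (indicator {1..} x *\<^sub>R (1 / x))"
      using AE_bounds by eventually_elim (auto split: split_indicator)
  qed measurable
  also have "\<dots> = thorin_exponent z + \<i> * of_real z * of_real (LINT x:{1..}|\<tau>. 1 / x)"
    unfolding thorin_exponent_def set_lebesgue_integral_def integral_complex_of_real[symmetric]
      integral_mult_right_zero[symmetric]
    by (intro Bochner_Integration.integral_add integrable_thorin_exponent integrable_mult_right integrable_of_real int)
  finally show "char \<mu> z = exp (\<i> * complex_of_real (z * (LINT x:{1..}|\<tau>. 1 / x)) -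
        (LINT x:{0<..}|\<tau>. Ln (1 - \<i> * complex_of_real (z / x)) + \<i> * complex_of_real (z / x * indicator {1..} x)))"
    by (simp add: assms algebra_simps)
qed

end

section \<open>Levy processes on dyadic times\<close>

text \<open>For nonnegative \<open>s\<close>, the least point of the grid of mesh 1/2^m strictly
  above \<open>s\<close>. Strictness, due to the summand 1, makes the approximation run inside
  \<open>at_right s\<close>; \<open>nat\<close> keeps the value an admissible time for every real
  \<open>s\<close>.\<close>

definition dyadic_above :: "nat \<Rightarrow> real \<Rightarrow> real" where
  "dyadic_above m s = real (nat (\<lfloor>2 ^ m * s\<rfloor> + 1)) / 2 ^ m"

lemma dyadic_above_bounds:
  assumes "0 \<le> s"
  shows "s < dyadic_above m s" "dyadic_above m s \<le> s + (1 / 2) ^ m"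
proof -
  have "0 \<le> \<lfloor>2 ^ m * s\<rfloor>" using assms by simp
  then have eq: "real (nat (\<lfloor>2 ^ m * s\<rfloor> + 1)) = real_of_int \<lfloor>2 ^ m * s\<rfloor> + 1"
    by simp
  have "2 ^ m * s < real_of_int \<lfloor>2 ^ m * s\<rfloor> + 1" "real_of_int \<lfloor>2 ^ m * s\<rfloor> \<le> 2 ^ m * s"
    by linarith+
  then show "s < dyadic_above m s" "dyadic_above m s \<le> s + (1 / 2) ^ m"
    unfolding dyadic_above_def eq by (auto simp: field_simps)
qed

lemma dyadic_above_tendsto:
  assumes "0 \<le> s"
  shows "(\<lambda>m. dyadic_above m s) \<longlonglongrightarrow> s"
proof (rule tendsto_sandwich[where f="\<lambda>_. s" and h="\<lambda>m. s + (1 / 2) ^ m"])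
  have "(\<lambda>m. s + (1 / 2) ^ m) \<longlonglongrightarrow> s + 0"
    by (intro tendsto_intros LIMSEQ_power_zero) auto
  then show "(\<lambda>m. s + (1 / 2) ^ m) \<longlonglongrightarrow> s" by simp
  show "\<forall>\<^sub>F m in sequentially. s \<le> dyadic_above m s"
    using dyadic_above_bounds(1)[OF assms] by (intro always_eventually) (auto intro: less_imp_le)
  show "\<forall>\<^sub>F m in sequentially. dyadic_above m s \<le> s + (1 / 2) ^ m"
    using dyadic_above_bounds(2)[OF assms] by (intro always_eventually) auto
qed auto

lemma cadlag_dyadic_above:
  assumes "cadlag x" "0 \<le> s"
  shows "(\<lambda>m. x (dyadic_above m s)) \<longlonglongrightarrow> x s"
proof -
  have "(x \<longlongrightarrow> x s) (at_right s)" using assms by (simp add: cadlag_def)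
  moreover have "filterlim (\<lambda>m. dyadic_above m s) (at_right s) sequentially"
    using dyadic_above_tendsto[OF assms(2)] dyadic_above_bounds(1)[OF assms(2)]
    by (auto simp: filterlim_at intro!: always_eventually less_imp_neq[symmetric])
  ultimately show ?thesis by (rule filterlim_compose)
qed

text \<open>Rounding up to the grid preserves order, on the grid monotonicity is a chain of single
  steps, and right-continuity passes it to the limit.\<close>

lemma cadlag_mono_on_dyadic:
  assumes x: "cadlag x" and step: "\<And>m i. x (real i / 2 ^ m) \<le> x (real (Suc i) / 2 ^ m)"
  shows "mono_on {0..} x"
proof (rule mono_onI)
  fix r s :: real assume rs: "r \<in> {0..}" "s \<in> {0..}" "r \<le> s"
  have "x (dyadic_above m r) \<le> x (dyadic_above m s)" for m
  proof -
    have "nat (\<lfloor>2 ^ m * r\<rfloor> + 1) \<le> nat (\<lfloor>2 ^ m * s\<rfloor> + 1)"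
      using rs by (intro nat_mono add_right_mono floor_mono mult_left_mono) auto
    then show ?thesis
      unfolding dyadic_above_def
      by (rule lift_Suc_mono_le[of "\<lambda>i. x (real i / 2 ^ m)", rotated]) (rule step)
  qed
  then show "x r \<le> x s"
    using rs by (intro LIMSEQ_le[OF cadlag_dyadic_above[OF x] cadlag_dyadic_above[OF x]]) auto
qed

locale levy = prob_space M for M :: "'a measure" +
  fixes X :: "real \<Rightarrow> 'a \<Rightarrow> real"
  assumes levy_process: "levy_process M X"
begin

lemma measurable_levy: "0 \<le> t \<Longrightarrow> X t \<in> borel_measurable M"
  using levy_process by (simp add: levy_process_def)

lemma AE_zero: "AE \<omega> in M. X 0 \<omega> = 0"
  using levy_process by (simp add: levy_process_def)

lemma indep_increments:
  fixes t :: "nat \<Rightarrow> real"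
  assumes "0 \<le> t 0" "\<And>i. i < n \<Longrightarrow> t i \<le> t (Suc i)"
  shows "indep_vars (\<lambda>_. borel) (\<lambda>i \<omega>. X (t (Suc i)) \<omega> - X (t i) \<omega>) {..<n}"
  using levy_process assms by (simp add: levy_process_def)

lemma distr_increment:
  assumes "0 \<le> s" "0 \<le> h"
  shows "distr M borel (\<lambda>\<omega>. X (s + h) \<omega> - X s \<omega>) = distr M borel (X h)"
  using levy_process assms by (simp add: levy_process_def)

lemma AE_cadlag: "AE \<omega> in M. cadlag (\<lambda>t. X t \<omega>)"
  using levy_process by (simp add: levy_process_def)

lemma distr_step:
  assumes "0 \<le> \<delta>"
  shows "distr M borel (\<lambda>\<omega>. X (real (Suc i) * \<delta>) \<omega> - X (real i * \<delta>) \<omega>) = distr M borel (X \<delta>)"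
  using distr_increment[of "real i * \<delta>" \<delta>] assms by (simp add: algebra_simps)

lemma indep_steps:
  assumes "0 \<le> \<delta>"
  shows "indep_vars (\<lambda>_. borel) (\<lambda>i \<omega>. X (real (Suc i) * \<delta>) \<omega> - X (real i * \<delta>) \<omega>) {..<n}"
  using assms by (intro indep_increments[where t="\<lambda>i. real i * \<delta>"]) (auto intro!: mult_right_mono)

lemma sum_steps: "(\<Sum>i<n. X (real (Suc i) * \<delta>) \<omega> - X (real i * \<delta>) \<omega>) = X (real n * \<delta>) \<omega> - X 0 \<omega>"
  using sum_lessThan_telescope[of "\<lambda>i. X (real i * \<delta>) \<omega>" n] by simp

text \<open>If all n increments over steps of length 1/n were negative, X 1 would be negative, which
  is a null event. Independence and stationarity make its probability the n-th power of that of X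
  (1/n) < 0, which must then vanish.\<close>

lemma AE_step_nonneg:
  assumes pos: "AE \<omega> in M. 0 \<le> X 1 \<omega>" and n: "0 < n"
  shows "AE \<omega> in M. 0 \<le> X (1 / real n) \<omega>"
proof -
  define \<delta> where "\<delta> = 1 / real n"
  have \<delta>: "0 \<le> \<delta>" "real n * \<delta> = 1" using n by (auto simp: \<delta>_def)
  define D where "D i \<omega> = X (real (Suc i) * \<delta>) \<omega> - X (real i * \<delta>) \<omega>" for i \<omega>
  have [measurable]: "D i \<in> borel_measurable M" for i
    unfolding D_def using \<delta> by (intro borel_measurable_diff measurable_levy) auto
  have [measurable]: "X \<delta> \<in> borel_measurable M" using \<delta> by (intro measurable_levy)
  have "prob (\<Inter>i\<in>{..<n}. D i -` {..<0} \<inter> space M) = (\<Prod>i\<in>{..<n}. prob (D i -` {..<0} \<inter> space M))"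
    using indep_steps[OF \<delta>(1), of n] n unfolding D_def by (intro indep_varsD_finite) auto
  also have "prob (D i -` {..<0} \<inter> space M) = prob (X \<delta> -` {..<0} \<inter> space M)" for i
  proof -
    have "measure (distr M borel (D i)) {..<0} = measure (distr M borel (X \<delta>)) {..<0}"
      using distr_step[OF \<delta>(1), of i] unfolding D_def by simp
    then show ?thesis by (simp add: measure_distr)
  qed
  then have "(\<Prod>i\<in>{..<n}. prob (D i -` {..<0} \<inter> space M)) = prob (X \<delta> -` {..<0} \<inter> space M) ^ n"
    by simp
  also have "prob (\<Inter>i\<in>{..<n}. D i -` {..<0} \<inter> space M) = 0"
  proof -
    have "AE \<omega> in M. \<omega> \<notin> (\<Inter>i\<in>{..<n}. D i -` {..<0} \<inter> space M)"
      using pos AE_zero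
    proof eventually_elim
      case (elim \<omega>)
      have False if "\<forall>i<n. D i \<omega> < 0"
      proof -
        have "(\<Sum>i<n. D i \<omega>) < (\<Sum>i<n. 0)" using that n by (intro sum_strict_mono) auto
        then show False using elim \<delta> sum_steps[of \<delta> \<omega> n] unfolding D_def by simp
      qed
      then show ?case by auto
    qed
    moreover have "(\<Inter>i\<in>{..<n}. D i -` {..<0} \<inter> space M) \<in> sets M"
      using n by (intro sets.finite_INT) auto
    ultimately show ?thesis by (subst prob_eq_0) auto
  qed
  finally have "prob (X \<delta> -` {..<0} \<inter> space M) = 0" using n by simp
  then have "AE \<omega> in M. \<omega> \<notin> X \<delta> -` {..<0} \<inter> space M" by (subst (asm) prob_eq_0) auto
  then show ?thesis unfolding \<delta>_def by (rule AE_mp) (auto intro!: AE_I2)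
qed

text \<open>Dyadic increments are nonnegative outside one null set, there being countably many, and
  right-continuity covers the remaining times. This makes both \<open>X\<close> and \<open>T\<close>
  increasing, although only their laws at time 1 are prescribed.\<close>

lemma increasing:
  assumes "AE \<omega> in M. 0 \<le> X 1 \<omega>"
  shows "increasing_process M X"
proof -
  have "AE \<omega> in M. X (real i / 2 ^ m) \<omega> \<le> X (real (Suc i) / 2 ^ m) \<omega>" for m i
  proof -
    have "AE \<omega> in M. 0 \<le> X (1 / real (2 ^ m)) \<omega>" by (rule AE_step_nonneg[OF assms]) simp
    then have "AE x in distr M borel (X (1 / 2 ^ m)). 0 \<le> x"
      by (subst AE_distr_iff) (auto intro: measurable_levy)
    then have "AE x in distr M borel (\<lambda>\<omega>. X (real (Suc i) * (1 / 2 ^ m)) \<omega> - X (real i * (1 / 2 ^ m)) \<omega>). 0 \<le> x"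
      by (subst distr_step) auto
    then have "AE \<omega> in M. 0 \<le> X (real (Suc i) * (1 / 2 ^ m)) \<omega> - X (real i * (1 / 2 ^ m)) \<omega>"
      by (subst (asm) AE_distr_iff) (auto intro!: borel_measurable_diff measurable_levy)
    then show ?thesis by simp
  qed
  then have "AE \<omega> in M. \<forall>m i. X (real i / 2 ^ m) \<omega> \<le> X (real (Suc i) / 2 ^ m) \<omega>"
    by (simp add: AE_all_countable)
  with AE_cadlag show ?thesis
    unfolding increasing_process_def
    by eventually_elim (intro cadlag_mono_on_dyadic, auto)
qed

lemma char_step:
  assumes "0 \<le> \<delta>"
  shows "char (distr M borel (X (real k * \<delta>))) z = char (distr M borel (X \<delta>)) z ^ k"
proof -
  define D where "D i \<omega> = X (real (Suc i) * \<delta>) \<omega> - X (real i * \<delta>) \<omega>" for i \<omega>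
  have [measurable]: "D i \<in> borel_measurable M" for i
    unfolding D_def using assms by (intro borel_measurable_diff measurable_levy) auto
  have [measurable]: "X (real k * \<delta>) \<in> borel_measurable M" using assms by (intro measurable_levy) auto
  have "distr M borel (X (real k * \<delta>)) = distr M borel (\<lambda>\<omega>. \<Sum>i<k. D i \<omega>)"
  proof (rule distr_cong_AE)
    show "AE \<omega> in M. X (real k * \<delta>) \<omega> = (\<Sum>i<k. D i \<omega>)"
      using AE_zero by eventually_elim (simp add: D_def sum_steps del: of_nat_Suc)
  qed auto
  then have "char (distr M borel (X (real k * \<delta>))) z = (\<Prod>i<k. char (distr M borel (D i)) z)"
    using char_distr_sum[OF indep_steps[OF assms]] by (simp add: D_def[abs_def])
  also have "\<dots> = char (distr M borel (X \<delta>)) z ^ k"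
    unfolding D_def using distr_step[OF assms] by simp
  finally show ?thesis .
qed

lemma char_dyadic_tendsto:
  assumes "0 \<le> s"
  shows "(\<lambda>m. char (distr M borel (X (dyadic_above m s))) z) \<longlonglongrightarrow> char (distr M borel (X s)) z"
proof -
  have [measurable]: "X (dyadic_above m s) \<in> borel_measurable M" for m
    by (intro measurable_levy) (simp add: dyadic_above_def)
  have [measurable]: "X s \<in> borel_measurable M" using assms by (rule measurable_levy)
  have "(\<lambda>m. LINT \<omega>|M. iexp (z * X (dyadic_above m s) \<omega>)) \<longlonglongrightarrow> (LINT \<omega>|M. iexp (z * X s \<omega>))"
  proof (rule integral_dominated_convergence[where w="\<lambda>_. 1"])
    show "AE \<omega> in M. (\<lambda>m. iexp (z * X (dyadic_above m s) \<omega>)) \<longlonglongrightarrow> iexp (z * X s \<omega>)"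
      using AE_cadlag by eventually_elim (intro tendsto_intros cadlag_dyadic_above assms)
  qed auto
  then show ?thesis unfolding char_def by (simp add: integral_distr)
qed

text \<open>An infinitely divisible characteristic function determines its continuous roots: the
  quotient of two continuous \<open>n\<close>-th roots takes values in a finite set.\<close>

lemma char_exponent:
  assumes \<psi>: "continuous_on UNIV \<psi>" "\<psi> 0 = 0" "\<And>z. char (distr M borel (X 1)) z = exp (- \<psi> z)"
    and s: "0 \<le> s"
  shows "char (distr M borel (X s)) z = exp (- (of_real s * \<psi> z))"
proof -
  have root: "char (distr M borel (X (1 / real n))) z = exp (- (of_real (1 / real n) * \<psi> z))"
    if n: "0 < n" for n z
  proof -
    have [measurable]: "X (1 / real n) \<in> borel_measurable M" by (rule measurable_levy) simp
    interpret D: real_distribution "distr M borel (X (1 / real n))"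
      by (rule real_distribution_distr) measurable
    define h where "h z = char (distr M borel (X (1 / real n))) z * exp (of_real (1 / real n) * \<psi> z)" for z
    have "h z ^ n = 1" for z
    proof -
      have "char (distr M borel (X (1 / real n))) z ^ n = exp (- \<psi> z)"
        using char_step[of "1 / real n" n z] n \<psi>(3) by simp
      moreover have "exp (of_real (1 / real n) * \<psi> z) ^ n = exp (\<psi> z)"
        using n by (simp add: exp_of_nat_mult[symmetric])
      ultimately show ?thesis by (simp add: h_def power_mult_distrib exp_minus)
    qed
    then have "finite (range h)"
      using n by (intro finite_subset[OF _ finite_roots_unity[of n]]) auto
    moreover have "connected (range h)"
      unfolding h_def
      by (intro connected_continuous_image continuous_intros \<psi>(1))
        (simp_all add: continuous_on_eq_continuous_at D.isCont_char)
    ultimately obtain a where a: "range h = {a}" using connected_finite_iff_sing[of "range h"] by auto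
    have "h z = h 0" using a by (metis rangeI singletonD)
    also have "h 0 = 1" by (simp add: h_def \<psi>(2) D.char_zero)
    finally show ?thesis by (simp add: h_def exp_minus field_simps)
  qed
  \<comment> \<open>A grid time is a multiple of 1/2^m, so its characteristic function is a power of
    the root of order 2^m; \<open>char_dyadic_tendsto\<close> then reaches every
    \<open>s\<close>.\<close>
  have "char (distr M borel (X (dyadic_above m s))) z = exp (- (of_real (dyadic_above m s) * \<psi> z))" for m
  proof -
    define k where "k = nat (\<lfloor>2 ^ m * s\<rfloor> + 1)"
    have d: "dyadic_above m s = real k * (1 / real (2 ^ m))" by (simp add: dyadic_above_def k_def)
    have "char (distr M borel (X (dyadic_above m s))) z = exp (- (of_real (1 / real (2 ^ m)) * \<psi> z)) ^ k"
      unfolding d by (subst char_step) (simp_all only: root zero_less_power zero_less_numeral of_nat_0_le_iff zero_le_divide_1_iff)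
    also have "\<dots> = exp (- (of_real (dyadic_above m s) * \<psi> z))"
      unfolding d by (simp add: exp_of_nat_mult[symmetric])
    finally show ?thesis .
  qed
  then have "(\<lambda>m. exp (- (of_real (dyadic_above m s) * \<psi> z))) \<longlonglongrightarrow> char (distr M borel (X s)) z"
    using char_dyadic_tendsto[OF s, of z] by simp
  moreover have "(\<lambda>m. exp (- (of_real (dyadic_above m s) * \<psi> z))) \<longlonglongrightarrow> exp (- (of_real s * \<psi> z))"
    by (intro tendsto_intros dyadic_above_tendsto s)
  ultimately show ?thesis by (rule LIMSEQ_unique)
qed

end

section \<open>Subordination\<close>

text \<open>The restriction to nonnegative times makes this a point of the product space in which
  \<open>independent_processes\<close> is stated.\<close>

definition sample_path :: "(real \<Rightarrow> 'a \<Rightarrow> real) \<Rightarrow> 'a \<Rightarrow> real \<Rightarrow> real" where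
  "sample_path Z \<omega> = (\<lambda>t\<in>{0..}. Z t \<omega>)"

text \<open>Evaluation of a path at a time is not jointly measurable in both arguments; its regularisation
  from the right is, and agrees with it on right-continuous paths.\<close>

definition path_eval :: "real \<Rightarrow> (real \<Rightarrow> real) \<Rightarrow> real" where
  "path_eval s x = lim (\<lambda>m. x (dyadic_above m s))"

text \<open>At level \<open>m\<close> the evaluation time is one of countably many grid points, so
  evaluation is a countable gluing of coordinate maps; the limit in \<open>m\<close> keeps
  measurability.\<close>

lemma measurable_path_eval:
  "(\<lambda>p. path_eval (fst p) (snd p)) \<in> borel_measurable (borel \<Otimes>\<^sub>M (\<Pi>\<^sub>M t\<in>{0..}. borel))"
  unfolding path_eval_def
proof (rule borel_measurable_lim_metric)
  fix m
  have "(\<lambda>p. snd p (real k / 2 ^ m)) \<in> borel_measurable (borel \<Otimes>\<^sub>M (\<Pi>\<^sub>M t\<in>{0..}. borel))" for k :: nat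
    by (intro measurable_compose[OF measurable_snd measurable_component_singleton]) simp
  moreover have "(\<lambda>p. nat (\<lfloor>2 ^ m * (fst p :: real)\<rfloor> + 1)) \<in> measurable (borel \<Otimes>\<^sub>M (\<Pi>\<^sub>M t\<in>{0..}. borel)) (count_space UNIV)"
    by measurable
  ultimately show "(\<lambda>p. snd p (dyadic_above m (fst p))) \<in> borel_measurable (borel \<Otimes>\<^sub>M (\<Pi>\<^sub>M t\<in>{0..}. borel))"
    unfolding dyadic_above_def by (rule measurable_compose_countable)
qed

lemma measurable_path_eval_compose [measurable (raw)]:
  assumes "f \<in> borel_measurable N" "g \<in> measurable N (\<Pi>\<^sub>M t\<in>{0..}. borel)"
  shows "(\<lambda>y. path_eval (f y) (g y)) \<in> borel_measurable N"
  using measurable_compose[OF measurable_Pair[OF assms] measurable_path_eval] by simp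

lemma path_eval_sample_path:
  assumes "cadlag (\<lambda>t. Z t \<omega>)" "0 \<le> s"
  shows "path_eval s (sample_path Z \<omega>) = Z s \<omega>"
proof -
  have "(\<lambda>m. sample_path Z \<omega> (dyadic_above m s)) = (\<lambda>m. Z (dyadic_above m s) \<omega>)"
    by (simp add: sample_path_def dyadic_above_def)
  then show ?thesis
    unfolding path_eval_def using cadlag_dyadic_above[OF assms] by (simp add: limI)
qed

text \<open>The limit is the supremum over [0,t). Through it the left limits of \<open>Y\<close>
  come from monotonicity, without any analysis of the composition at jumps of
  \<open>T\<close>.\<close>

lemma mono_on_left_limit:
  fixes f :: "real \<Rightarrow> real"
  assumes f: "mono_on {0..} f" and t: "0 < t"
  shows "\<exists>l. (f \<longlongrightarrow> l) (at_left t)"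
proof
  have bdd: "bdd_above (f ` {0..<t})"
    using t by (intro bdd_aboveI2[of _ _ "f t"] mono_onD[OF f]) auto
  show "(f \<longlongrightarrow> Sup (f ` {0..<t})) (at_left t)"
  proof (rule increasing_tendsto)
    show "\<forall>\<^sub>F s in at_left t. f s \<le> Sup (f ` {0..<t})"
      using eventually_at_left_real[OF t] by eventually_elim (auto intro!: cSup_upper bdd)
    fix y assume "y < Sup (f ` {0..<t})"
    then obtain r where r: "0 \<le> r" "r < t" "y < f r"
      using t less_cSup_iff[OF _ bdd, of y] by auto
    show "\<forall>\<^sub>F s in at_left t. y < f s"
      using eventually_at_left_real[OF r(2)]
      by eventually_elim (rule less_le_trans[OF r(3) mono_onD[OF f]], use r in auto)
  qed
qed

lemma (in levy) measurable_sample_path [measurable]: "sample_path X \<in> measurable M (\<Pi>\<^sub>M t\<in>{0..}. borel)"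
  unfolding sample_path_def by (intro measurable_restrict measurable_levy) simp

locale levy_subordination = levy M X + T: levy M T
  for M :: "'a measure" and X T :: "real \<Rightarrow> 'a \<Rightarrow> real" +
  fixes Y :: "real \<Rightarrow> 'a \<Rightarrow> real"
  assumes increasing_X: "increasing_process M X"
    and increasing_T: "increasing_process M T"
    and independent: "independent_processes M X T"
    and time_change: "time_change M X T Y"
begin

abbreviation path_space :: "(real \<Rightarrow> real) measure" where
  "path_space \<equiv> (\<Pi>\<^sub>M t\<in>{0..}. borel)"

lemma measurable_Y: "0 \<le> t \<Longrightarrow> Y t \<in> borel_measurable M"
  using time_change by (simp add: time_change_def)

lemma AE_Y: "AE \<omega> in M. \<forall>t\<ge>0. Y t \<omega> = X (T t \<omega>) \<omega>"
  using time_change by (simp add: time_change_def)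

lemma AE_T_mono: "AE \<omega> in M. mono_on {0..} (\<lambda>t. T t \<omega>)"
  using increasing_T by (simp add: increasing_process_def)

lemma AE_T_nonneg: "AE \<omega> in M. \<forall>t\<ge>0. 0 \<le> T t \<omega>"
  using AE_T_mono T.AE_zero
proof eventually_elim
  case (elim \<omega>)
  have "T 0 \<omega> \<le> T t \<omega>" if "0 \<le> t" for t
    by (rule mono_onD[OF elim(1)]) (use that in auto)
  then show ?case using elim(2) by simp
qed

text \<open>This writes \<open>Y\<close> as a jointly measurable functional of the two paths, to
  which their product law applies, outside one null set for all times.\<close>

lemma AE_Y_path:
  "AE \<omega> in M. \<forall>t\<ge>0. Y t \<omega> = path_eval (sample_path T \<omega> t) (sample_path X \<omega>)"
  using AE_Y AE_T_nonneg AE_cadlag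
proof eventually_elim
  case (elim \<omega>)
  have "sample_path T \<omega> t = T t \<omega>" if "0 \<le> t" for t
    using that by (simp add: sample_path_def)
  then show ?case using elim by (simp add: path_eval_sample_path)
qed

lemma distr_paths:
  "distr M path_space (sample_path X) \<Otimes>\<^sub>M distr M path_space (sample_path T)
    = distr M (path_space \<Otimes>\<^sub>M path_space) (\<lambda>\<omega>. (sample_path X \<omega>, sample_path T \<omega>))"
proof -
  have "indep_var path_space (sample_path X) path_space (sample_path T)"
    using independent unfolding independent_processes_def sample_path_def[abs_def] .
  then show ?thesis by (simp add: indep_var_distribution_eq)
qed

text \<open>By independence the joint law of the paths is a product, so Tonelli allows integrating
  over \<open>X\<close> with the path of \<open>T\<close> frozen.\<close>

lemma nn_integral_paths:
  assumes [measurable]: "(\<lambda>p. \<Phi> (fst p) (snd p)) \<in> borel_measurable (path_space \<Otimes>\<^sub>M path_space)"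
  shows "(\<integral>\<^sup>+\<omega>. \<Phi> (sample_path X \<omega>) (sample_path T \<omega>) \<partial>M) = (\<integral>\<^sup>+\<omega>'. \<integral>\<^sup>+\<omega>. \<Phi> (sample_path X \<omega>) (sample_path T \<omega>') \<partial>M \<partial>M)"
proof -
  let ?A = "distr M path_space (sample_path X)" and ?B = "distr M path_space (sample_path T)"
  interpret A: prob_space ?A by (rule prob_space_distr) measurable
  interpret B: prob_space ?B by (rule prob_space_distr) measurable
  interpret P: pair_prob_space ?A ?B ..
  have sets: "sets (?A \<Otimes>\<^sub>M ?B) = sets (path_space \<Otimes>\<^sub>M path_space)"
    by (intro sets_pair_measure_cong) auto
  note [measurable_cong] = sets
  have "(\<integral>\<^sup>+\<omega>. \<Phi> (sample_path X \<omega>) (sample_path T \<omega>) \<partial>M) = (\<integral>\<^sup>+p. \<Phi> (fst p) (snd p) \<partial>(?A \<Otimes>\<^sub>M ?B))"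
    unfolding distr_paths by (subst nn_integral_distr) auto
  also have "\<dots> = (\<integral>\<^sup>+y. \<integral>\<^sup>+x. \<Phi> x y \<partial>?A \<partial>?B)"
    by (subst P.nn_integral_snd[symmetric]) (auto simp: case_prod_beta)
  also have "\<dots> = (\<integral>\<^sup>+\<omega>'. \<integral>\<^sup>+x. \<Phi> x (sample_path T \<omega>') \<partial>?A \<partial>M)"
  proof (rule nn_integral_distr)
    have "(\<lambda>p. \<Phi> (snd p) (fst p)) \<in> borel_measurable (path_space \<Otimes>\<^sub>M ?A)"
      using measurable_compose[OF measurable_Pair[OF measurable_snd measurable_fst] assms] by simp
    then show "(\<lambda>y. \<integral>\<^sup>+x. \<Phi> x y \<partial>?A) \<in> borel_measurable (distr M path_space (sample_path T))"
      using A.borel_measurable_nn_integral[of "\<lambda>y x. \<Phi> x y" path_space]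
      by (simp add: case_prod_beta)
  qed measurable
  also have "\<dots> = (\<integral>\<^sup>+\<omega>'. \<integral>\<^sup>+\<omega>. \<Phi> (sample_path X \<omega>) (sample_path T \<omega>') \<partial>M \<partial>M)"
  proof (intro nn_integral_cong)
    fix \<omega>' assume "\<omega>' \<in> space M"
    then have "sample_path T \<omega>' \<in> space path_space" by (rule measurable_space[OF T.measurable_sample_path])
    then have "(\<lambda>x. (x, sample_path T \<omega>')) \<in> measurable path_space (path_space \<Otimes>\<^sub>M path_space)" by measurable
    from measurable_compose[OF this assms]
    show "(\<integral>\<^sup>+x. \<Phi> x (sample_path T \<omega>') \<partial>?A) = (\<integral>\<^sup>+\<omega>. \<Phi> (sample_path X \<omega>) (sample_path T \<omega>') \<partial>M)"
      by (subst nn_integral_distr) auto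
  qed
  finally show ?thesis .
qed

text \<open>With T t frozen at a value s, the inner integral is the characteristic function of X s.
  The function \<open>G\<close> is a Borel version of its dependence on s, free outside the
  nonnegative reals.\<close>

lemma char_subordination:
  assumes t: "0 \<le> t"
    and G: "\<And>s. 0 \<le> s \<Longrightarrow> char (distr M borel (X s)) z = G s" "G \<in> borel_measurable borel"
  shows "char (distr M borel (Y t)) z = (LINT \<omega>|M. G (T t \<omega>))"
proof -
  let ?A = "distr M path_space (sample_path X)" and ?B = "distr M path_space (sample_path T)"
  interpret A: prob_space ?A by (rule prob_space_distr) measurable
  interpret B: prob_space ?B by (rule prob_space_distr) measurable
  interpret P: pair_prob_space ?A ?B ..
  have sets: "sets (?A \<Otimes>\<^sub>M ?B) = sets (path_space \<Otimes>\<^sub>M path_space)"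
    by (intro sets_pair_measure_cong) auto
  note [measurable_cong] = sets
  have [measurable]: "Y t \<in> borel_measurable M" using t by (rule measurable_Y)
  have [measurable]: "(\<lambda>x. x t) \<in> borel_measurable path_space" using t by (intro measurable_component_singleton) auto
  define F where "F x y = iexp (z * path_eval (y t) x)" for x y
  have F: "case_prod F \<in> borel_measurable (path_space \<Otimes>\<^sub>M path_space)"
    unfolding F_def by measurable
  then have F': "case_prod F \<in> borel_measurable (?A \<Otimes>\<^sub>M ?B)" by measurable
  have int: "integrable (?A \<Otimes>\<^sub>M ?B) (case_prod F)"
    by (rule P.P.integrable_const_bound[where B=1, OF _ F']) (simp add: F_def case_prod_beta)
  have "char (distr M borel (Y t)) z = (LINT \<omega>|M. iexp (z * Y t \<omega>))"
    unfolding char_def by (subst integral_distr) auto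
  also have "\<dots> = (LINT \<omega>|M. case_prod F (sample_path X \<omega>, sample_path T \<omega>))"
  proof (rule integral_cong_AE)
    show "(\<lambda>\<omega>. case_prod F (sample_path X \<omega>, sample_path T \<omega>)) \<in> borel_measurable M"
      by (rule measurable_compose[OF _ F]) measurable
    show "AE \<omega> in M. iexp (z * Y t \<omega>) = case_prod F (sample_path X \<omega>, sample_path T \<omega>)"
      using AE_Y_path by eventually_elim (simp add: F_def t)
  qed measurable
  also have "\<dots> = (LINT p|(?A \<Otimes>\<^sub>M ?B). case_prod F p)"
    unfolding distr_paths by (subst integral_distr[OF _ F]) auto
  also have "\<dots> = (LINT y|?B. LINT x|?A. F x y)"
    by (rule P.integral_snd[OF int, symmetric])
  also have "\<dots> = (LINT \<omega>|M. LINT x|?A. F x (sample_path T \<omega>))"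
    by (subst integral_distr[where N=path_space]) (use P.integrable_snd[OF int] in auto)
  also have "\<dots> = (LINT \<omega>|M. G (T t \<omega>))"
  proof (rule integral_cong_AE)
    show "AE \<omega> in M. (LINT x|?A. F x (sample_path T \<omega>)) = G (T t \<omega>)"
      using AE_T_nonneg AE_space
    proof eventually_elim
      case (elim \<omega>)
      have [measurable]: "X (T t \<omega>) \<in> borel_measurable M" using elim t by (intro measurable_levy) auto
      have T: "sample_path T \<omega> t = T t \<omega>" using t by (simp add: sample_path_def)
      have "(LINT x|?A. F x (sample_path T \<omega>)) = (LINT \<omega>'|M. iexp (z * path_eval (T t \<omega>) (sample_path X \<omega>')))"
        unfolding F_def T by (subst integral_distr) auto
      also have "\<dots> = (LINT \<omega>'|M. iexp (z * X (T t \<omega>) \<omega>'))"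
      proof (rule integral_cong_AE)
        show "AE \<omega>' in M. iexp (z * path_eval (T t \<omega>) (sample_path X \<omega>')) = iexp (z * X (T t \<omega>) \<omega>')"
          using AE_cadlag by eventually_elim (use elim t in \<open>simp add: path_eval_sample_path\<close>)
      qed measurable
      also have "\<dots> = char (distr M borel (X (T t \<omega>))) z"
        unfolding char_def by (subst integral_distr) auto
      finally show ?case using G(1) elim t by simp
    qed
    show "(\<lambda>\<omega>. G (T t \<omega>)) \<in> borel_measurable M"
      using T.measurable_levy[OF t] G(2) by (rule measurable_compose)
    show "(\<lambda>\<omega>. LINT x|?A. F x (sample_path T \<omega>)) \<in> borel_measurable M"
      by (rule measurable_compose[OF T.measurable_sample_path]) (use P.integrable_snd[OF int] in auto)
  qed
  finally show ?thesis .
qed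

text \<open>For nonnegative \<open>s\<close> this is the probability that X s lies in
  \<open>A\<close>; writing it with \<open>path_eval\<close> makes it a Borel function of
  \<open>s\<close>, so that random times can be inserted.\<close>

definition step_prob :: "real set \<Rightarrow> real \<Rightarrow> ennreal" where
  "step_prob A s = (\<integral>\<^sup>+\<omega>. indicator A (path_eval s (sample_path X \<omega>)) \<partial>M)"

lemma measurable_step_prob [measurable]:
  assumes [measurable]: "A \<in> sets borel"
  shows "step_prob A \<in> borel_measurable borel"
  unfolding step_prob_def by measurable

lemma emeasure_increment_X:
  assumes [measurable]: "A \<in> sets borel" and s: "0 \<le> s" "s \<le> r"
  shows "(\<integral>\<^sup>+\<omega>. indicator A (X r \<omega> - X s \<omega>) \<partial>M) = step_prob A (r - s)"
proof -
  have [measurable]: "X r \<in> borel_measurable M" "X s \<in> borel_measurable M" "X (r - s) \<in> borel_measurable M"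
    using s by (auto intro: measurable_levy)
  have "(\<integral>\<^sup>+\<omega>. indicator A (X r \<omega> - X s \<omega>) \<partial>M) = (\<integral>\<^sup>+x. indicator A x \<partial>distr M borel (\<lambda>\<omega>. X (s + (r - s)) \<omega> - X s \<omega>))"
    by (subst nn_integral_distr) auto
  also have "\<dots> = (\<integral>\<^sup>+x. indicator A x \<partial>distr M borel (X (r - s)))"
    using s by (subst distr_increment) auto
  also have "\<dots> = (\<integral>\<^sup>+\<omega>. indicator A (X (r - s) \<omega>) \<partial>M)"
    by (subst nn_integral_distr) auto
  also have "\<dots> = step_prob A (r - s)"
    unfolding step_prob_def
  proof (rule nn_integral_cong_AE)
    show "AE \<omega> in M. indicator A (X (r - s) \<omega>) = (indicator A (path_eval (r - s) (sample_path X \<omega>)) :: ennreal)"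
      using AE_cadlag by eventually_elim (use s in \<open>simp add: path_eval_sample_path\<close>)
  qed
  finally show ?thesis .
qed

text \<open>Meant for \<open>u i = T (t i)\<close> along a frozen path of \<open>T\<close>.\<close>

lemma nn_integral_increments_X:
  fixes u :: "nat \<Rightarrow> real"
  assumes A [measurable]: "\<And>i. A i \<in> sets borel" and u: "0 \<le> u 0" "\<And>i. i < n \<Longrightarrow> u i \<le> u (Suc i)"
  shows "(\<integral>\<^sup>+\<omega>. (\<Prod>i<n. indicator (A i) (path_eval (u (Suc i)) (sample_path X \<omega>) - path_eval (u i) (sample_path X \<omega>))) \<partial>M)
    = (\<Prod>i<n. step_prob (A i) (u (Suc i) - u i))"
proof -
  have u_nonneg: "0 \<le> u i" if "i \<le> n" for i
    using that by (induction i) (use u in \<open>auto intro: order_trans\<close>)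
  have "(\<integral>\<^sup>+\<omega>. (\<Prod>i<n. indicator (A i) (path_eval (u (Suc i)) (sample_path X \<omega>) - path_eval (u i) (sample_path X \<omega>))) \<partial>M)
    = (\<integral>\<^sup>+\<omega>. (\<Prod>i<n. indicator (A i) (X (u (Suc i)) \<omega> - X (u i) \<omega>)) \<partial>M)"
  proof (rule nn_integral_cong_AE)
    show "AE \<omega> in M. (\<Prod>i<n. indicator (A i) (path_eval (u (Suc i)) (sample_path X \<omega>) - path_eval (u i) (sample_path X \<omega>)))
      = (\<Prod>i<n. (indicator (A i) (X (u (Suc i)) \<omega> - X (u i) \<omega>) :: ennreal))"
      using AE_cadlag
      by eventually_elim (intro prod.cong refl, use u_nonneg in \<open>simp add: path_eval_sample_path\<close>)
  qed
  also have "\<dots> = (\<Prod>i<n. \<integral>\<^sup>+\<omega>. indicator (A i) (X (u (Suc i)) \<omega> - X (u i) \<omega>) \<partial>M)"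
  proof (rule indep_vars_nn_integral)
    show "indep_vars (\<lambda>_. borel) (\<lambda>i \<omega>. indicator (A i) (X (u (Suc i)) \<omega> - X (u i) \<omega>) :: ennreal) {..<n}"
      by (rule indep_vars_compose2[OF indep_increments[OF u]]) measurable
  qed auto
  also have "\<dots> = (\<Prod>i<n. step_prob (A i) (u (Suc i) - u i))"
    by (intro prod.cong refl emeasure_increment_X A) (use u u_nonneg in auto)
  finally show ?thesis .
qed

text \<open>Along a frozen path of \<open>T\<close> the increments of \<open>X\<close> factor into
  values of \<open>step_prob\<close> at the increments of \<open>T\<close>; independence and
  stationarity of the latter then factor the outer integral. This one formula carries both
  properties of the increments of \<open>Y\<close>: stationarity is read off from n = 1,
  independence from general n.\<close>

lemma nn_integral_increments_Y:
  fixes t :: "nat \<Rightarrow> real"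
  assumes A [measurable]: "\<And>i. A i \<in> sets borel" and t: "0 \<le> t 0" "\<And>i. i < n \<Longrightarrow> t i \<le> t (Suc i)"
  shows "(\<integral>\<^sup>+\<omega>. (\<Prod>i<n. indicator (A i) (Y (t (Suc i)) \<omega> - Y (t i) \<omega>)) \<partial>M)
    = (\<Prod>i<n. \<integral>\<^sup>+\<omega>. step_prob (A i) (T (t (Suc i) - t i) \<omega>) \<partial>M)"
proof -
  have t_nonneg: "0 \<le> t i" if "i \<le> n" for i
    using that by (induction i) (use t in \<open>auto intro: order_trans\<close>)
  define \<Phi> :: "(real \<Rightarrow> real) \<Rightarrow> (real \<Rightarrow> real) \<Rightarrow> ennreal" where
    "\<Phi> x y = (\<Prod>i<n. indicator (A i) (path_eval (y (t (Suc i))) x - path_eval (y (t i)) x))" for x y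
  have "(\<lambda>p. \<Phi> (fst p) (snd p)) \<in> borel_measurable (path_space \<Otimes>\<^sub>M path_space)"
    unfolding \<Phi>_def
  proof (rule borel_measurable_prod_ennreal)
    fix i assume "i \<in> {..<n}"
    then have [measurable]: "(\<lambda>x. x (t (Suc i))) \<in> borel_measurable path_space" "(\<lambda>x. x (t i)) \<in> borel_measurable path_space"
      by (auto intro!: measurable_component_singleton t_nonneg)
    show "(\<lambda>p. indicator (A i) (path_eval (snd p (t (Suc i))) (fst p) - path_eval (snd p (t i)) (fst p)) :: ennreal)
      \<in> borel_measurable (path_space \<Otimes>\<^sub>M path_space)"
      by measurable
  qed
  note split = nn_integral_paths[OF this]
  have "(\<integral>\<^sup>+\<omega>. (\<Prod>i<n. indicator (A i) (Y (t (Suc i)) \<omega> - Y (t i) \<omega>)) \<partial>M) = (\<integral>\<^sup>+\<omega>. \<Phi> (sample_path X \<omega>) (sample_path T \<omega>) \<partial>M)"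
  proof (rule nn_integral_cong_AE)
    show "AE \<omega> in M. (\<Prod>i<n. indicator (A i) (Y (t (Suc i)) \<omega> - Y (t i) \<omega>)) = \<Phi> (sample_path X \<omega>) (sample_path T \<omega>)"
      using AE_Y_path unfolding \<Phi>_def
      by eventually_elim (intro prod.cong refl, use t_nonneg in simp)
  qed
  also have "\<dots> = (\<integral>\<^sup>+\<omega>'. (\<Prod>i<n. step_prob (A i) (T (t (Suc i)) \<omega>' - T (t i) \<omega>')) \<partial>M)"
    unfolding split
  proof (rule nn_integral_cong_AE)
    show "AE \<omega>' in M. (\<integral>\<^sup>+\<omega>. \<Phi> (sample_path X \<omega>) (sample_path T \<omega>') \<partial>M) = (\<Prod>i<n. step_prob (A i) (T (t (Suc i)) \<omega>' - T (t i) \<omega>'))"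
      using AE_T_mono AE_T_nonneg
    proof eventually_elim
      case (elim \<omega>')
      have "(\<integral>\<^sup>+\<omega>. \<Phi> (sample_path X \<omega>) (sample_path T \<omega>') \<partial>M) =
        (\<integral>\<^sup>+\<omega>. (\<Prod>i<n. indicator (A i) (path_eval (T (t (Suc i)) \<omega>') (sample_path X \<omega>) - path_eval (T (t i) \<omega>') (sample_path X \<omega>))) \<partial>M)"
        unfolding \<Phi>_def by (intro nn_integral_cong prod.cong refl) (use t_nonneg in \<open>simp add: sample_path_def\<close>)
      also have "\<dots> = (\<Prod>i<n. step_prob (A i) (T (t (Suc i)) \<omega>' - T (t i) \<omega>'))"
      proof (rule nn_integral_increments_X[OF A, where u="\<lambda>i. T (t i) \<omega>'"])
        show "T (t i) \<omega>' \<le> T (t (Suc i)) \<omega>'" if "i < n" for i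
          using elim(1) t(2)[OF that] t_nonneg[of i] that by (auto intro: mono_onD)
      qed (use elim t in auto)
      finally show ?case .
    qed
  qed
  also have "\<dots> = (\<Prod>i<n. \<integral>\<^sup>+\<omega>'. step_prob (A i) (T (t (Suc i)) \<omega>' - T (t i) \<omega>') \<partial>M)"
  proof (rule indep_vars_nn_integral)
    show "indep_vars (\<lambda>_. borel) (\<lambda>i \<omega>. step_prob (A i) (T (t (Suc i)) \<omega> - T (t i) \<omega>)) {..<n}"
      by (rule indep_vars_compose2[OF T.indep_increments[OF t]]) measurable
  qed auto
  also have "\<dots> = (\<Prod>i<n. \<integral>\<^sup>+\<omega>. step_prob (A i) (T (t (Suc i) - t i) \<omega>) \<partial>M)"
  proof (intro prod.cong refl)
    fix i assume i: "i \<in> {..<n}"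
    define s h where "s = t i" and "h = t (Suc i) - t i"
    have sh: "0 \<le> s" "0 \<le> h" "t (Suc i) = s + h" using i t_nonneg[of i] t(2)[of i] by (auto simp: s_def h_def)
    have [measurable]: "T (s + h) \<in> borel_measurable M" "T s \<in> borel_measurable M" "T h \<in> borel_measurable M"
      using sh by (auto intro: T.measurable_levy)
    have "(\<integral>\<^sup>+\<omega>'. step_prob (A i) (T (s + h) \<omega>' - T s \<omega>') \<partial>M)
      = (\<integral>\<^sup>+x. step_prob (A i) x \<partial>distr M borel (\<lambda>\<omega>. T (s + h) \<omega> - T s \<omega>))"
      by (subst nn_integral_distr) auto
    also have "\<dots> = (\<integral>\<^sup>+\<omega>. step_prob (A i) (T h \<omega>) \<partial>M)"
      using sh by (subst T.distr_increment) (auto simp: nn_integral_distr)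
    finally show "(\<integral>\<^sup>+\<omega>'. step_prob (A i) (T (t (Suc i)) \<omega>' - T (t i) \<omega>') \<partial>M) = (\<integral>\<^sup>+\<omega>. step_prob (A i) (T (t (Suc i) - t i) \<omega>) \<partial>M)"
      unfolding h_def[symmetric] unfolding sh(3) s_def[symmetric] .
  qed
  finally show ?thesis .
qed

lemma AE_Y_zero: "AE \<omega> in M. Y 0 \<omega> = 0"
  using AE_Y AE_zero T.AE_zero by eventually_elim simp

lemma nn_integral_increment_Y:
  assumes A [measurable]: "A \<in> sets borel" and s: "0 \<le> s" "s \<le> r"
  shows "(\<integral>\<^sup>+\<omega>. indicator A (Y r \<omega> - Y s \<omega>) \<partial>M) = (\<integral>\<^sup>+\<omega>. step_prob A (T (r - s) \<omega>) \<partial>M)"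
  using nn_integral_increments_Y[of "\<lambda>_. A" "\<lambda>i. if i = 0 then s else r" 1] assms by simp

lemma emeasure_increment_Y:
  assumes A [measurable]: "A \<in> sets borel" and s: "0 \<le> s" "s \<le> r"
  shows "emeasure M ((\<lambda>\<omega>. Y r \<omega> - Y s \<omega>) -` A \<inter> space M) = (\<integral>\<^sup>+\<omega>. step_prob A (T (r - s) \<omega>) \<partial>M)"
proof -
  have [measurable]: "Y r \<in> borel_measurable M" "Y s \<in> borel_measurable M"
    using s by (auto intro: measurable_Y)
  have "emeasure M ((\<lambda>\<omega>. Y r \<omega> - Y s \<omega>) -` A \<inter> space M) = (\<integral>\<^sup>+\<omega>. indicator ((\<lambda>\<omega>. Y r \<omega> - Y s \<omega>) -` A \<inter> space M) \<omega> \<partial>M)"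
    by simp
  also have "\<dots> = (\<integral>\<^sup>+\<omega>. indicator A (Y r \<omega> - Y s \<omega>) \<partial>M)"
    by (intro nn_integral_cong) (auto split: split_indicator)
  finally show ?thesis using nn_integral_increment_Y[OF assms] by simp
qed

text \<open>The probability computed in \<open>emeasure_increment_Y\<close> depends on the times
  only through their difference.\<close>

lemma distr_increment_Y:
  assumes "0 \<le> s" "0 \<le> h"
  shows "distr M borel (\<lambda>\<omega>. Y (s + h) \<omega> - Y s \<omega>) = distr M borel (Y h)"
proof -
  have [measurable]: "Y (s + h) \<in> borel_measurable M" "Y s \<in> borel_measurable M" "Y h \<in> borel_measurable M" "Y 0 \<in> borel_measurable M"
    using assms by (auto intro: measurable_Y)
  have "distr M borel (Y h) = distr M borel (\<lambda>\<omega>. Y h \<omega> - Y 0 \<omega>)"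
    by (rule distr_cong_AE) (use AE_Y_zero in auto)
  also have "\<dots> = distr M borel (\<lambda>\<omega>. Y (s + h) \<omega> - Y s \<omega>)"
    by (rule measure_eqI) (use assms in \<open>simp_all add: emeasure_distr emeasure_increment_Y\<close>)
  finally show ?thesis ..
qed

lemma indep_increments_Y:
  fixes t :: "nat \<Rightarrow> real"
  assumes t: "0 \<le> t 0" "\<And>i. i < n \<Longrightarrow> t i \<le> t (Suc i)"
  shows "indep_vars (\<lambda>_. borel) (\<lambda>i \<omega>. Y (t (Suc i)) \<omega> - Y (t i) \<omega>) {..<n}"
\<comment> \<open>An empty intersection would be \<open>UNIV\<close> and not an event, so the empty
  family is separated.\<close>
proof (cases "n = 0")
  case True
  then show ?thesis by (simp add: indep_vars_def indep_sets_def)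
next
  case False
  have t_nonneg: "0 \<le> t i" if "i \<le> n" for i
    using that by (induction i) (use t in \<open>auto intro: order_trans\<close>)
  define D where "D i \<omega> = Y (t (Suc i)) \<omega> - Y (t i) \<omega>" for i \<omega>
  have D: "D i \<in> borel_measurable M" if "i < n" for i
    unfolding D_def using that by (intro borel_measurable_diff measurable_Y t_nonneg) auto
  have "indep_vars (\<lambda>_. borel) D {..<n}"
  proof (subst indep_vars_finite[where E="\<lambda>_. sets borel"])
    show "\<forall>A\<in>{..<n} \<rightarrow> sets borel. prob (\<Inter>j\<in>{..<n}. D j -` A j \<inter> space M) = (\<Prod>j<n. prob (D j -` A j \<inter> space M))"
    proof
      fix A assume "A \<in> {..<n} \<rightarrow> sets (borel :: real measure)"
      then have A: "A i \<in> sets borel" if "i < n" for i using that by auto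
      \<comment> \<open>Padding by \<open>UNIV\<close> makes every member of the sequence Borel, as
        \<open>nn_integral_increments_Y\<close> demands.\<close>
      define B where "B i = (if i < n then A i else UNIV)" for i
      have [measurable]: "B i \<in> sets borel" for i using A by (simp add: B_def)
      have meas: "(\<Inter>j\<in>{..<n}. D j -` A j \<inter> space M) \<in> sets M"
        using False A D by (intro sets.finite_INT) (auto intro: measurable_sets)
      have "emeasure M (\<Inter>j\<in>{..<n}. D j -` A j \<inter> space M) = (\<integral>\<^sup>+\<omega>. indicator (\<Inter>j\<in>{..<n}. D j -` A j \<inter> space M) \<omega> \<partial>M)"
        using meas by simp
      also have "\<dots> = (\<integral>\<^sup>+\<omega>. (\<Prod>i<n. indicator (B i) (Y (t (Suc i)) \<omega> - Y (t i) \<omega>)) \<partial>M)"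
      proof (rule nn_integral_cong)
        fix \<omega> assume "\<omega> \<in> space M"
        then show "indicator (\<Inter>j\<in>{..<n}. D j -` A j \<inter> space M) \<omega> = (\<Prod>i<n. indicator (B i) (Y (t (Suc i)) \<omega> - Y (t i) \<omega>) :: ennreal)"
          using False by (auto simp: indicator_def D_def B_def prod_zero_iff intro!: prod.neutral)
      qed
      also have "\<dots> = (\<Prod>i<n. \<integral>\<^sup>+\<omega>. step_prob (B i) (T (t (Suc i) - t i) \<omega>) \<partial>M)"
        by (rule nn_integral_increments_Y[OF _ t]) auto
      also have "\<dots> = (\<Prod>i<n. emeasure M (D i -` A i \<inter> space M))"
        unfolding D_def by (intro prod.cong refl, subst emeasure_increment_Y) (auto simp: B_def A t_nonneg t)
      finally show "prob (\<Inter>j\<in>{..<n}. D j -` A j \<inter> space M) = (\<Prod>j<n. prob (D j -` A j \<inter> space M))"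
        by (simp add: emeasure_eq_measure prod_ennreal prod_nonneg)
    qed
    show "sets borel = sigma_sets (space borel) (sets (borel :: real measure))"
      by (rule sets.sigma_sets_eq[symmetric])
    show "Int_stable (sets (borel :: real measure))"
      by (auto simp: Int_stable_def)
  qed (use False D in auto)
  then show ?thesis unfolding D_def .
qed

lemma AE_Y_mono: "AE \<omega> in M. mono_on {0..} (\<lambda>t. Y t \<omega>)"
  using AE_Y AE_T_mono AE_T_nonneg increasing_X[unfolded increasing_process_def]
proof eventually_elim
  case (elim \<omega>)
  show ?case
  proof (rule mono_onI)
    fix r s :: real assume rs: "r \<in> {0..}" "s \<in> {0..}" "r \<le> s"
    then have "T r \<omega> \<le> T s \<omega>" using elim(2) by (auto intro: mono_onD)
    then have "X (T r \<omega>) \<omega> \<le> X (T s \<omega>) \<omega>"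
      using elim(3) rs by (intro mono_onD[OF elim(4)]) auto
    then show "Y r \<omega> \<le> Y s \<omega>" using elim(1) rs by simp
  qed
qed

text \<open>As t is approached from the right, T tends to its value at t and, being increasing,
  stays at or above it, which is the side on which \<open>X\<close> is continuous. Monotonicity
  supplies the left limits.\<close>

lemma AE_Y_cadlag: "AE \<omega> in M. cadlag (\<lambda>t. Y t \<omega>)"
  using AE_Y AE_T_mono AE_T_nonneg AE_cadlag T.AE_cadlag AE_Y_mono
proof eventually_elim
  case (elim \<omega>)
  have "((\<lambda>t. Y t \<omega>) \<longlongrightarrow> Y t \<omega>) (at_right t)" if t: "0 \<le> t" for t
  proof -
    have "continuous (at (T t \<omega>) within {T t \<omega>..}) (\<lambda>t. X t \<omega>)"
    proof -
      have "((\<lambda>t. X t \<omega>) \<longlongrightarrow> X (T t \<omega>) \<omega>) (at_right (T t \<omega>))"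
        using elim(3,4) t by (simp add: cadlag_def)
      moreover have "at (T t \<omega>) within {T t \<omega>..} = at_right (T t \<omega>)"
        by (metis at_within_Ici_at_right)
      ultimately show ?thesis by (simp add: continuous_within)
    qed
    moreover have "((\<lambda>t. T t \<omega>) \<longlongrightarrow> T t \<omega>) (at_right t)"
      using elim(5) t by (simp add: cadlag_def)
    moreover have "\<forall>\<^sub>F s in at_right t. T s \<omega> \<in> {T t \<omega>..}"
      using eventually_at_right_less[of t]
      by eventually_elim (use mono_onD[OF elim(2), of t] t in auto)
    ultimately have "((\<lambda>s. X (T s \<omega>) \<omega>) \<longlongrightarrow> X (T t \<omega>) \<omega>) (at_right t)"
      by (intro continuous_within_tendsto_compose[where f="\<lambda>t. X t \<omega>"])
    then have "((\<lambda>s. X (T s \<omega>) \<omega>) \<longlongrightarrow> Y t \<omega>) (at_right t)" using elim(1) t by simp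
    then show ?thesis
    proof (rule Lim_transform_eventually)
      show "\<forall>\<^sub>F s in at_right t. X (T s \<omega>) \<omega> = Y s \<omega>"
        using eventually_at_right_less[of t] by eventually_elim (use elim(1) t in auto)
    qed
  qed
  then show ?case
    unfolding cadlag_def using mono_on_left_limit[OF elim(6)] by blast
qed

lemma levy_process_Y: "levy_process M Y"
  unfolding levy_process_def
  using prob_space_axioms measurable_Y AE_Y_zero indep_increments_Y distr_increment_Y AE_Y_cadlag
  by blast

lemma increasing_Y: "increasing_process M Y"
  unfolding increasing_process_def by (rule AE_Y_mono)

end

section \<open>Laplace transforms of generalized negative binomial laws\<close>

lemma space_measure_plus: "space (measure_plus \<mu> \<nu>) = space \<mu>"
  by (rule sets_eq_imp_space_eq) simp

lemma nn_integral_measure_plus: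
  assumes sets: "sets \<nu> = sets \<mu>" and f: "f \<in> borel_measurable \<mu>"
  shows "(\<integral>\<^sup>+x. f x \<partial>measure_plus \<mu> \<nu>) = (\<integral>\<^sup>+x. f x \<partial>\<mu>) + (\<integral>\<^sup>+x. f x \<partial>\<nu>)"
proof -
  note [measurable_cong] = sets sets_measure_plus[of \<mu> \<nu>]
  have space: "space \<nu> = space \<mu>" "space (measure_plus \<mu> \<nu>) = space \<mu>"
    using sets_eq_imp_space_eq[OF sets] by (auto simp: space_measure_plus)
  from f show ?thesis
  proof (induction rule: borel_measurable_induct)
    case (cong f g)
    have "integral\<^sup>N N f = integral\<^sup>N N g" if "space N = space \<mu>" for N
      using cong(3) that by (intro nn_integral_cong) auto
    then show ?case using cong(4) space by simp
  next
    case (set A)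
    then show ?case by (simp add: emeasure_measure_plus sets)
  next
    case (mult u c)
    then show ?case by (simp add: nn_integral_cmult distrib_left)
  next
    case (add u v)
    then show ?case by (simp add: nn_integral_add ac_simps)
  next
    case (seq U)
    have inc: "incseq (\<lambda>i. integral\<^sup>N \<mu> (U i))" "incseq (\<lambda>i. integral\<^sup>N \<nu> (U i))"
      using seq by (auto simp: incseq_def le_fun_def intro!: nn_integral_mono)
    show ?case
      using seq by (simp add: SUP_apply nn_integral_monotone_convergence_SUP ennreal_SUP_add[OF inc] image_comp)
  qed
qed

lemma integrable_measure_plus:
  fixes f :: "'a \<Rightarrow> 'b::{banach, second_countable_topology}"
  assumes sets: "sets \<nu> = sets \<mu>"
  shows "integrable (measure_plus \<mu> \<nu>) f \<longleftrightarrow> integrable \<mu> f \<and> integrable \<nu> f"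
proof -
  have [simp]: "f \<in> borel_measurable (measure_plus \<mu> \<nu>) \<longleftrightarrow> f \<in> borel_measurable \<mu>"
    "f \<in> borel_measurable \<nu> \<longleftrightarrow> f \<in> borel_measurable \<mu>"
    using sets by (simp_all cong: measurable_cong_sets)
  show ?thesis
    unfolding integrable_iff_bounded using nn_integral_measure_plus[OF sets, of "\<lambda>x. ennreal (norm (f x))"]
    by (auto simp: ennreal_add_less_top)
qed

lemma integral_measure_plus:
  fixes f :: "'a \<Rightarrow> 'b::{banach, second_countable_topology}"
  assumes sets: "sets \<nu> = sets \<mu>" and f: "integrable (measure_plus \<mu> \<nu>) f"
  shows "(LINT x|measure_plus \<mu> \<nu>. f x) = (LINT x|\<mu>. f x) + (LINT x|\<nu>. f x)"
  using f
proof (induction rule: integrable_induct)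
  case (base A c)
  then have A: "A \<in> sets \<mu>" "A \<in> sets \<nu>" "emeasure \<mu> A < \<infinity>" "emeasure \<nu> A < \<infinity>"
    using sets by (auto simp: emeasure_measure_plus ennreal_add_less_top)
  then have "measure (measure_plus \<mu> \<nu>) A = measure \<mu> A + measure \<nu> A"
    unfolding measure_def using sets by (simp add: emeasure_measure_plus enn2real_plus)
  then show ?case
    using base A sets by (simp add: scaleR_add_left)
next
  case (add f g)
  then show ?case
    using integrable_measure_plus[OF sets, of f] integrable_measure_plus[OF sets, of g]
    by (simp add: Bochner_Integration.integral_add ac_simps)
next
  case (lim f s)
  note int = integrable_measure_plus[OF sets, THEN iffD1]
  have space: "space \<nu> = space \<mu>" "space (measure_plus \<mu> \<nu>) = space \<mu>"
    using sets_eq_imp_space_eq[OF sets] by (auto simp: space_measure_plus)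
  have conv: "(\<lambda>i. LINT x|N. s i x) \<longlonglongrightarrow> (LINT x|N. f x)"
    if N: "integrable N f" "\<And>i. integrable N (s i)" "space N = space \<mu>" for N
  proof (rule integral_dominated_convergence[where w="\<lambda>x. 2 * norm (f x)"])
    show "AE x in N. (\<lambda>i. s i x) \<longlonglongrightarrow> f x"
      using lim(2) N(3) space by (intro AE_I2) auto
    show "AE x in N. norm (s i x) \<le> 2 * norm (f x)" for i
      using lim(3) N(3) space by (intro AE_I2) auto
  qed (use N in auto)
  have "(\<lambda>i. LINT x|measure_plus \<mu> \<nu>. s i x) \<longlonglongrightarrow> (LINT x|\<mu>. f x) + (LINT x|\<nu>. f x)"
    unfolding lim(5) using int[OF lim(4)] int[OF lim(1)] space by (intro tendsto_add conv) auto
  moreover have "(\<lambda>i. LINT x|measure_plus \<mu> \<nu>. s i x) \<longlonglongrightarrow> (LINT x|measure_plus \<mu> \<nu>. f x)"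
    using lim(1,4) space by (intro conv) auto
  ultimately show ?case by (rule LIMSEQ_unique[rotated])
qed

lemma scale_measure_eq_density: "scale_measure r M = density M (\<lambda>_. r)"
  by (rule measure_eqI) (auto simp: emeasure_density nn_integral_cmult_indicator)

section \<open>The Laplace transform of an LGNBC law on the right half-plane\<close>

lemma mult_exp_le:
  fixes \<delta> x :: real
  assumes "0 < \<delta>" "0 \<le> x"
  shows "x * exp (- \<delta> * x) \<le> 1 / \<delta>"
proof -
  have "\<delta> * x \<le> exp (\<delta> * x)" using exp_ge_add_one_self[of "\<delta> * x"] by linarith
  then show ?thesis using assms by (simp add: exp_minus field_simps)
qed

text \<open>On the ball of radius Re l / 2 the differentiated integrand is bounded by the constant 2
  / Re l, by \<open>mult_exp_le\<close>; this dominates even when the law has no finite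
  mean.\<close>

lemma laplace_transform_holomorphic:
  assumes \<mu>: "real_distribution \<mu>" and pos: "AE x in \<mu>. 0 \<le> x"
  shows "(\<lambda>l. LINT x|\<mu>. exp (- (l * complex_of_real x))) holomorphic_on {l. 0 < Re l}"
proof -
  interpret real_distribution \<mu> by fact
  have "((\<lambda>l. LINT x|\<mu>. exp (- (l * complex_of_real x))) has_field_derivative
      (LINT x|\<mu>. - complex_of_real x * exp (- (l * complex_of_real x)))) (at l)" if l: "0 < Re l" for l
  proof (rule has_field_derivative_integral[where r="Re l / 2" and g="\<lambda>_. 2 / Re l"
        and f'="\<lambda>l x. - complex_of_real x * exp (- (l * complex_of_real x))"])
    have re: "Re l / 2 < Re z" if "z \<in> ball l (Re l / 2)" for z
      using that abs_Re_le_cmod[of "l - z"] by (auto simp: dist_norm)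
    show "integrable \<mu> (\<lambda>x. exp (- (z * complex_of_real x)))" if "z \<in> ball l (Re l / 2)" for z
    proof (rule integrable_const_bound[where B=1])
      show "AE x in \<mu>. norm (exp (- (z * complex_of_real x))) \<le> 1"
        using pos by eventually_elim (use re[OF that] l in simp)
    qed measurable
    show "AE x in \<mu>. \<forall>z\<in>ball l (Re l / 2). ((\<lambda>w. exp (- (w * complex_of_real x))) has_field_derivative
        - complex_of_real x * exp (- (z * complex_of_real x))) (at z)"
      by (intro AE_I2 ballI) (auto intro!: derivative_eq_intros)
    show "AE x in \<mu>. \<forall>z\<in>ball l (Re l / 2). norm (- complex_of_real x * exp (- (z * complex_of_real x))) \<le> 2 / Re l"
      using pos
    proof eventually_elim
      case (elim x)
      show ?case
      proof
        fix z assume z: "z \<in> ball l (Re l / 2)"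
        have "norm (- complex_of_real x * exp (- (z * complex_of_real x))) = x * exp (- (Re z * x))"
          using elim by (simp add: norm_mult)
        also have "\<dots> \<le> x * exp (- (Re l / 2) * x)"
          using elim mult_right_mono[OF less_imp_le[OF re[OF z]] elim] by (intro mult_left_mono) auto
        also have "\<dots> \<le> 1 / (Re l / 2)"
          using elim l by (intro mult_exp_le) auto
        finally show "norm (- complex_of_real x * exp (- (z * complex_of_real x))) \<le> 2 / Re l" by simp
      qed
    qed
  qed (use l in auto)
  then show ?thesis
    unfolding holomorphic_on_def field_differentiable_def
    by (metis (no_types, lifting) has_field_derivative_at_within mem_Collect_eq)
qed

locale gnbc_finite =
  fixes \<pi> :: "real measure" and \<theta> :: real
  assumes gnbc: "GNBC_measure \<pi>" and mass: "emeasure \<pi> {0..1} = ennreal \<theta>" and \<theta>_pos: "0 < \<theta>"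
begin

lemma sets_pi [measurable_cong]: "sets \<pi> = sets borel"
  using gnbc by (simp add: GNBC_measure_def measure_on_def)

lemma space_pi [simp]: "space \<pi> = UNIV"
  using sets_eq_imp_space_eq[OF sets_pi] by simp

lemma AE_pi: "AE q in \<pi>. 0 \<le> q \<and> q < 1"
proof -
  have "- {0..1} \<in> null_sets \<pi>" "{1} \<in> null_sets \<pi>"
    using gnbc by (auto simp: GNBC_measure_def measure_on_def null_sets_def sets_pi)
  from this[THEN AE_not_in] show ?thesis by eventually_elim auto
qed

lemma emeasure_pi_UNIV: "emeasure \<pi> UNIV = ennreal \<theta>"
proof -
  have "emeasure \<pi> UNIV = emeasure \<pi> {0..1}"
    by (rule emeasure_eq_AE) (use AE_pi in \<open>auto simp: sets_pi\<close>)
  then show ?thesis using mass by simp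
qed

sublocale finite_measure \<pi>
  by standard (simp add: emeasure_pi_UNIV)

lemma measure_pi_UNIV: "measure \<pi> UNIV = \<theta>"
  using emeasure_pi_UNIV \<theta>_pos by (simp add: measure_def)

text \<open>Near 1 this is the integrability condition in \<open>GNBC_measure\<close>; below 1/2 the
  logarithm is at most ln 2 in modulus and \<pi> is finite.\<close>

lemma integrable_ln_pi: "integrable \<pi> (\<lambda>q. ln (1 - q))"
proof -
  have "integrable \<pi> (\<lambda>q. indicator {1/2..1} q * \<bar>ln (1 - q)\<bar>)"
  proof (rule integrableI_nonneg)
    have "(\<integral>\<^sup>+q. ennreal (indicator {1/2..1} q * \<bar>ln (1 - q)\<bar>) \<partial>\<pi>) = (\<integral>\<^sup>+q\<in>{1/2..1}. ennreal \<bar>ln (1 - q)\<bar> \<partial>\<pi>)"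
      by (intro nn_integral_cong) (auto split: split_indicator)
    then show "(\<integral>\<^sup>+q. ennreal (indicator {1/2..1} q * \<bar>ln (1 - q)\<bar>) \<partial>\<pi>) < \<infinity>"
      using gnbc by (simp add: GNBC_measure_def)
  qed auto
  then have "integrable \<pi> (\<lambda>q. indicator {1/2..1} q * \<bar>ln (1 - q)\<bar> + ln 2)" by simp
  then show ?thesis
  proof (rule Bochner_Integration.integrable_bound)
    show "AE q in \<pi>. norm (ln (1 - q)) \<le> norm (indicator {1/2..1} q * \<bar>ln (1 - q)\<bar> + ln 2)"
      using AE_pi
    proof eventually_elim
      case (elim q)
      show ?case
      proof (cases "q < 1 / 2")
        case True
        then have "- ln (1 - q) \<le> ln 2"
          using elim by (subst ln_inverse[symmetric]) (auto intro!: ln_mono simp: field_simps)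
        moreover have "ln (1 - q) \<le> 0" using elim by simp
        ultimately show ?thesis using True by simp
      qed (use elim in auto)
    qed
  qed measurable
qed

text \<open>For |w| < 1 the argument 1 - q w has modulus between 1 - |w| and 2 for all q in [0,1),
  so its logarithm is bounded.\<close>

lemma integrable_Ln_pi:
  assumes w: "norm w < 1"
  shows "integrable \<pi> (\<lambda>q. Ln (1 - complex_of_real q * w))"
proof (rule integrable_const_bound[where B="\<bar>ln (1 - norm w)\<bar> + ln 2 + pi"])
  show "AE q in \<pi>. norm (Ln (1 - complex_of_real q * w)) \<le> \<bar>ln (1 - norm w)\<bar> + ln 2 + pi"
    using AE_pi
  proof eventually_elim
    case (elim q)
    define v where "v = 1 - complex_of_real q * w"
    have qw: "norm (complex_of_real q * w) \<le> norm w"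
      using elim by (simp add: norm_mult mult_left_le_one_le)
    then have v: "1 - norm w \<le> norm v" "norm v \<le> 2"
      using norm_triangle_ineq2[of 1 "complex_of_real q * w"] norm_triangle_ineq4[of 1 "complex_of_real q * w"] w
      by (auto simp: v_def)
    then have v0: "v \<noteq> 0" using w by auto
    have "norm (Ln v) \<le> \<bar>Re (Ln v)\<bar> + \<bar>Im (Ln v)\<bar>" by (rule cmod_le)
    also have "\<bar>Re (Ln v)\<bar> \<le> \<bar>ln (1 - norm w)\<bar> + ln 2"
    proof -
      have "ln (1 - norm w) \<le> ln (norm v)" "ln (norm v) \<le> ln 2"
        using v w v0 by (auto intro!: ln_mono)
      moreover have "0 \<le> ln (2::real)" by simp
      ultimately show ?thesis unfolding Re_Ln[OF v0] by linarith
    qed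
    also have "\<bar>Im (Ln v)\<bar> \<le> pi" using mpi_less_Im_Ln[OF v0] Im_Ln_le_pi[OF v0] by auto
    finally show ?case by (simp add: v_def)
  qed
qed measurable

text \<open>The logarithm of the generating function with a = 0, continued to the unit disc.
  Splitting the quotient into two principal logarithms keeps \<open>w\<close> away from the singular
  factor 1 - q.\<close>

definition gnbc_exponent :: "complex \<Rightarrow> complex" where
  "gnbc_exponent w = (LINT q|\<pi>. of_real (ln (1 - q)) - Ln (1 - complex_of_real q * w))"

text \<open>Within distance (1 - |w|)/2 of \<open>w\<close> one has |z| < (1 + |w|)/2, hence Re (1 -
  q z) is at least (1 - |w|)/2. This both avoids the branch cut and bounds the derivative of the
  integrand.\<close>

lemma gnbc_exponent_holomorphic: "gnbc_exponent holomorphic_on ball 0 1"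
proof -
  have "(gnbc_exponent has_field_derivative (LINT q|\<pi>. complex_of_real q / (1 - complex_of_real q * w))) (at w)"
    if w: "norm w < 1" for w
    unfolding gnbc_exponent_def
  proof (rule has_field_derivative_integral[where r="(1 - norm w) / 2" and g="\<lambda>_. 2 / (1 - norm w)"
        and f'="\<lambda>w q. complex_of_real q / (1 - complex_of_real q * w)"])
    have z: "norm z < (1 + norm w) / 2" if "z \<in> ball w ((1 - norm w) / 2)" for z
      using that norm_triangle_ineq2[of z w] by (auto simp: dist_norm norm_minus_commute field_simps)
    have z1: "norm z < 1" if "z \<in> ball w ((1 - norm w) / 2)" for z
      using z[OF that] w by simp
    show "integrable \<pi> (\<lambda>q. of_real (ln (1 - q)) - Ln (1 - complex_of_real q * z))"
      if "z \<in> ball w ((1 - norm w) / 2)" for z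
      using z1[OF that] by (intro Bochner_Integration.integrable_diff integrable_of_real integrable_ln_pi integrable_Ln_pi)
    have bound: "(1 - norm w) / 2 \<le> Re (1 - complex_of_real q * z)"
      if "z \<in> ball w ((1 - norm w) / 2)" "0 \<le> q \<and> q < 1" for z q
    proof -
      have "Re (complex_of_real q * z) \<le> norm (complex_of_real q * z)" by (rule complex_Re_le_cmod)
      also have "\<dots> \<le> norm z" using that by (simp add: norm_mult mult_left_le_one_le)
      finally show ?thesis using z[OF that(1)] by (simp add: field_simps)
    qed
    show "AE q in \<pi>. \<forall>z\<in>ball w ((1 - norm w) / 2).
      ((\<lambda>w. of_real (ln (1 - q)) - Ln (1 - complex_of_real q * w)) has_field_derivative
        complex_of_real q / (1 - complex_of_real q * z)) (at z)"
      using AE_pi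
    proof eventually_elim
      case (elim q)
      show ?case
      proof
        fix z assume z: "z \<in> ball w ((1 - norm w) / 2)"
        have "0 < Re (1 - complex_of_real q * z)" using bound[OF z elim] w by simp
        then have "1 - complex_of_real q * z \<notin> \<real>\<^sub>\<le>\<^sub>0" by (auto simp: complex_nonpos_Reals_iff)
        then show "((\<lambda>w. of_real (ln (1 - q)) - Ln (1 - complex_of_real q * w)) has_field_derivative
          complex_of_real q / (1 - complex_of_real q * z)) (at z)"
          by (auto intro!: derivative_eq_intros simp: divide_inverse)
      qed
    qed
    show "AE q in \<pi>. \<forall>z\<in>ball w ((1 - norm w) / 2). norm (complex_of_real q / (1 - complex_of_real q * z)) \<le> 2 / (1 - norm w)"
      using AE_pi
    proof eventually_elim
      case (elim q)
      show ?case
      proof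
        fix z assume z: "z \<in> ball w ((1 - norm w) / 2)"
        have "(1 - norm w) / 2 \<le> norm (1 - complex_of_real q * z)"
          using bound[OF z elim] complex_Re_le_cmod[of "1 - complex_of_real q * z"] by linarith
        then have "norm (complex_of_real q / (1 - complex_of_real q * z)) \<le> 1 / ((1 - norm w) / 2)"
          unfolding norm_divide using elim w by (intro frac_le) auto
        then show "norm (complex_of_real q / (1 - complex_of_real q * z)) \<le> 2 / (1 - norm w)" by simp
      qed
    qed
  qed (use w in auto)
  then show ?thesis
    unfolding holomorphic_on_def field_differentiable_def
    by (metis has_field_derivative_at_within mem_ball_0)
qed

lemma gnbc_exponent_of_real:
  assumes w: "0 < w" "w < 1"
  shows "gnbc_exponent (of_real w) = of_real (LINT q:{0..1}|\<pi>. ln ((1 - q) / (1 - q * w)))"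
proof -
  have "gnbc_exponent (of_real w) = (LINT q|\<pi>. complex_of_real (indicator {0..1} q *\<^sub>R ln ((1 - q) / (1 - q * w))))"
    unfolding gnbc_exponent_def
  proof (rule integral_cong_AE)
    show "AE q in \<pi>. of_real (ln (1 - q)) - Ln (1 - complex_of_real q * of_real w)
      = complex_of_real (indicator {0..1} q *\<^sub>R ln ((1 - q) / (1 - q * w)))"
      using AE_pi
    proof eventually_elim
      case (elim q)
      have "q * w < 1 * 1" using elim w by (intro mult_strict_mono) auto
      then have pos: "0 < 1 - q * w" by simp
      have "Ln (1 - complex_of_real q * of_real w) = Ln (of_real (1 - q * w))" by simp
      also have "\<dots> = of_real (ln (1 - q * w))" using pos by (rule Ln_of_real)
      finally show ?case using elim pos by (simp add: ln_divide_pos)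
    qed
  qed measurable
  then show ?thesis by (simp only: integral_complex_of_real set_lebesgue_integral_def)
qed

text \<open>At z = exp (- s) the generating function is the Laplace transform at s > 0. Since exp (-
  a l) stays in the unit disc for Re l > 0, the right side is holomorphic there and the identity
  continues.\<close>

lemma laplace_LGNBC:
  assumes law: "LGNBC_law c a 0 \<pi> \<mu>" and l: "0 < Re l"
  shows "(LINT x|\<mu>. exp (- (l * complex_of_real x))) = exp (- (of_real c * l) + gnbc_exponent (exp (- (of_real a * l))))"
proof (rule right_half_plane_identity[OF _ _ _ l])
  have \<mu>: "real_distribution \<mu>" "AE x in \<mu>. 0 \<le> x" and a: "0 < a"
    using law by (auto simp: LGNBC_law_def)
  show "(\<lambda>l. LINT x|\<mu>. exp (- (l * complex_of_real x))) holomorphic_on {l. 0 < Re l}"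
    by (rule laplace_transform_holomorphic[OF \<mu>])
  have "(gnbc_exponent \<circ> (\<lambda>l. exp (- (of_real a * l)))) holomorphic_on {l. 0 < Re l}"
    by (rule holomorphic_on_compose_gen[OF _ gnbc_exponent_holomorphic])
      (use a in \<open>auto intro!: holomorphic_intros\<close>)
  then show "(\<lambda>l. exp (- (of_real c * l) + gnbc_exponent (exp (- (of_real a * l))))) holomorphic_on {l. 0 < Re l}"
    by (intro holomorphic_intros) (simp_all add: o_def)
  fix s :: real assume s: "0 < s"
  define z where "z = exp (- s)"
  have z: "z \<in> {0<..1}" "0 < z powr a" "z powr a < 1" "z powr a = exp (- (a * s))"
    using s a by (auto simp: z_def powr_def)
  obtain \<mu>\<^sub>0 where \<mu>\<^sub>0: "GNBC_pair 0 \<pi> \<mu>\<^sub>0" "\<forall>z\<in>{0<..1}. pgf \<mu> z = z powr c * pgf \<mu>\<^sub>0 (z powr a)"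
    using law by (auto simp: LGNBC_law_def)
  have "(LINT x|\<mu>. exp (- (of_real s * complex_of_real x))) = (LINT x|\<mu>. complex_of_real (z powr x))"
    by (intro Bochner_Integration.integral_cong) (auto simp: z_def powr_def exp_of_real[symmetric] mult.commute)
  also have "\<dots> = of_real (pgf \<mu> z)" by (simp add: pgf_def)
  also have "pgf \<mu> z = z powr c * exp (LINT q:{0..1}|\<pi>. ln ((1 - q) / (1 - q * z powr a)))"
    using \<mu>\<^sub>0 z by (simp add: GNBC_pair_def)
  also have "complex_of_real \<dots> = exp (- (of_real c * of_real s)) * exp (gnbc_exponent (of_real (z powr a)))"
    using gnbc_exponent_of_real[OF z(2,3)] by (simp add: exp_of_real z_def powr_def flip: exp_of_real)
  also have "\<dots> = exp (- (of_real c * of_real s) + gnbc_exponent (exp (- (of_real a * of_real s))))"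
    unfolding z(4) exp_add by (simp flip: exp_of_real)
  finally show "(LINT x|\<mu>. exp (- (of_real s * complex_of_real x)))
    = exp (- (of_real c * of_real s) + gnbc_exponent (exp (- (of_real a * of_real s))))" .
qed

text \<open>The factorisation of u - q passes to principal logarithms because u and 1 - q/u have
  positive real part, so their arguments add up to less than pi in modulus, and 1 - q is a positive
  real. The condition on \<open>z\<close> gives |u| > 1, placing 1/u in the disc.\<close>

lemma gnbc_exponent_gamma:
  fixes u :: complex
  assumes \<beta>: "0 < \<beta>" and u: "u = 1 - \<i> * of_real (z / \<beta>)" and z: "z \<noteq> 0"
  shows "gnbc_exponent (1 / u) = of_real \<theta> * Ln u - (LINT q|\<pi>. Ln (1 - \<i> * of_real (z / (\<beta> * (1 - q)))))"
proof -
  have Reu: "Re u = 1" by (simp add: u)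
  then have u0: "u \<noteq> 0" by auto
  have "Im u \<noteq> 0" using \<beta> z by (simp add: u)
  then have "1 < norm u"
    unfolding cmod_def Reu by simp
  then have "1 / norm u < 1" by (subst pos_divide_less_eq) auto
  then have w: "norm (1 / u) < 1" by (simp add: norm_divide)
  have eq: "AE q in \<pi>. Ln (1 - \<i> * of_real (z / (\<beta> * (1 - q))))
    = Ln u - (of_real (ln (1 - q)) - Ln (1 - complex_of_real q * (1 / u)))"
    using AE_pi
  proof eventually_elim
    case (elim q)
    define v where "v = 1 - complex_of_real q * (1 / u)"
    define y where "y = 1 - \<i> * of_real (z / (\<beta> * (1 - q)))"
    have "Re (complex_of_real q * (1 / u)) \<le> norm (complex_of_real q * (1 / u))" by (rule complex_Re_le_cmod)
    also have "\<dots> \<le> norm (1 / u)" using elim by (simp add: norm_mult mult_left_le_one_le norm_divide divide_right_mono)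
    finally have v: "0 < Re v" using w by (simp add: v_def)
    then have v0: "v \<noteq> 0" by auto
    have "\<bar>Im (Ln v)\<bar> < pi / 2" by (rule Re_Ln_pos_lt_imp[OF v])
    moreover have "\<bar>Im (Ln u)\<bar> < pi / 2" by (rule Re_Ln_pos_lt_imp) (simp add: Reu)
    ultimately have Ln_uv: "Ln (u * v) = Ln u + Ln v"
      using u0 v0 by (intro Ln_times_simple) auto
    have uv: "u * v = of_real (1 - q) * y"
    proof -
      have "u * v = u - of_real q" using u0 by (simp add: v_def right_diff_distrib)
      also have "\<dots> = of_real (1 - q) * y"
        using elim \<beta> by (simp add: y_def u field_simps)
      finally show ?thesis .
    qed
    have "Re y = 1" by (simp add: y_def)
    then have y0: "y \<noteq> 0" by auto
    have "Ln (of_real (1 - q) * y) = of_real (ln (1 - q)) + Ln y"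
      using Ln_times_of_real[of "1 - q" y] Ln_of_real[of "1 - q"] elim y0 by simp
    then have "Ln u + Ln v = of_real (ln (1 - q)) + Ln y" using Ln_uv uv by simp
    then show ?case unfolding v_def[symmetric] y_def[symmetric] by (simp add: algebra_simps)
  qed
  have int1: "integrable \<pi> (\<lambda>q. of_real (ln (1 - q)) - Ln (1 - complex_of_real q * (1 / u)))"
    using w by (intro Bochner_Integration.integrable_diff integrable_of_real integrable_ln_pi integrable_Ln_pi)
  have "(LINT q|\<pi>. Ln (1 - \<i> * of_real (z / (\<beta> * (1 - q))))) = (LINT q|\<pi>. Ln u - (of_real (ln (1 - q)) - Ln (1 - complex_of_real q * (1 / u))))"
    by (rule integral_cong_AE[OF _ _ eq]) measurable
  also have "\<dots> = of_real \<theta> * Ln u - gnbc_exponent (1 / u)"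
    unfolding gnbc_exponent_def Bochner_Integration.integral_diff[OF integrable_const int1]
    by (simp only: lebesgue_integral_const space_pi measure_pi_UNIV scaleR_conv_of_real)
  finally show "gnbc_exponent (1 / u) = of_real \<theta> * Ln u - (LINT q|\<pi>. Ln (1 - \<i> * of_real (z / (\<beta> * (1 - q)))))"
    by (simp add: algebra_simps)
qed

end

section \<open>Gamma processes\<close>

lemma continuous_on_Ln_one_minus:
  assumes "0 < \<beta>"
  shows "continuous_on UNIV (\<lambda>z. Ln (1 - \<i> * complex_of_real (z / \<beta>)))"
  by (intro continuous_intros) (use assms in \<open>auto simp: complex_nonpos_Reals_iff\<close>)

text \<open>Uniqueness of characteristic functions identifies the law of X 1 as
  \<open>gamma_law\<close>, which lives on the positive axis. The definition of a gamma process
  contains no positivity itself.\<close>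

lemma gamma_process_one:
  assumes X: "gamma_process M \<alpha> \<beta> X" and pos: "0 < \<alpha>" "0 < \<beta>"
  shows "AE \<omega> in M. 0 \<le> X 1 \<omega>"
    and "char (distr M borel (X 1)) z = exp (- (of_real \<alpha> * Ln (1 - \<i> * of_real (z / \<beta>))))"
proof -
  have char: "char (distr M borel (X 1)) z = exp (- (of_real \<alpha> * Ln (1 - \<i> * of_real (z / \<beta>))))" for z
  proof -
    have "Re (1 - \<i> * complex_of_real z / complex_of_real \<beta>) = 1" by simp
    then have "1 - \<i> * complex_of_real z / complex_of_real \<beta> \<noteq> 0" by auto
    then show ?thesis using X by (simp add: gamma_process_def powr_def)
  qed
  then show "char (distr M borel (X 1)) z = exp (- (of_real \<alpha> * Ln (1 - \<i> * of_real (z / \<beta>))))" .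
  have levy: "levy_process M X" using X by (simp add: gamma_process_def)
  then interpret levy M X by (intro levy.intro levy_axioms.intro) (simp_all add: levy_process_def)
  have [measurable]: "X 1 \<in> borel_measurable M" by (rule measurable_levy) simp
  have gamma: "distr M borel (X 1) = gamma_law \<alpha> \<beta>"
    by (rule Levy_uniqueness) (auto simp: real_distribution_gamma_law pos char char_gamma_law fun_eq_iff simp del: of_real_divide)
  have "AE x in distr M borel (X 1). 0 \<le> x"
    unfolding gamma using AE_gamma_law_pos by eventually_elim simp
  then show "AE \<omega> in M. 0 \<le> X 1 \<omega>" by (subst (asm) AE_distr_iff) auto
qed

theorem proposition8:
  fixes M :: "'a measure"
    and X T Y :: "real \<Rightarrow> 'a \<Rightarrow> real"
    and \<pi> \<tau> :: "real measure"
    and f :: "real \<Rightarrow> real"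
    and \<alpha> \<beta> c c' \<theta> :: real
  assumes "prob_space M"
    and "0 < \<alpha>" and "0 < \<beta>"
    and "gamma_process M \<alpha> \<beta> X"
    and "LGNBC_subordinator M c (1 / \<alpha>) 0 \<pi> T"
    and "independent_processes M X T"
    and "emeasure \<pi> {0..1} = ennreal \<theta>" and "0 < \<theta>" and "c * \<alpha> \<ge> \<theta>"
    and "time_change M X T Y"
    and f: "f = (\<lambda>x. \<beta> * (1 - x))"
    and \<tau>: "\<tau> = measure_plus (distr \<pi> borel f)
                (scale_measure (ennreal (c * \<alpha> - \<theta>)) (return borel \<beta>))"
    and c': "c' = (LINT x:{1..}|\<tau>. 1 / x)"
  shows "thorin_subordinator M Y \<and>
    thorin_triplet c' \<tau> (distr M borel (Y 1)) \<and>
    measure_support \<tau> \<subseteq> {0..\<beta>} \<and>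
    BG0 M (c * \<alpha>) Y"
proof -
  note pos = assms(2,3)
  have law: "LGNBC_law c (1 / \<alpha>) 0 \<pi> (distr M borel (T 1))" and levy_T: "levy_process M T"
    using assms(5) by (auto simp: LGNBC_subordinator_def)
  have levy_X: "levy_process M X" using assms(4) by (simp add: gamma_process_def)
  interpret X: levy M X using assms(1) levy_X by (intro levy.intro levy_axioms.intro)
  interpret T: levy M T using assms(1) levy_T by (intro levy.intro levy_axioms.intro)
  have T1 [measurable]: "T 1 \<in> borel_measurable M" by (rule T.measurable_levy) simp
  have AE_T1: "AE x in distr M borel (T 1). 0 \<le> x" using law by (simp add: LGNBC_law_def)
  then have "AE \<omega> in M. 0 \<le> T 1 \<omega>" by (subst (asm) AE_distr_iff) auto
  then have inc_T: "increasing_process M T" by (rule T.increasing)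
  have inc_X: "increasing_process M X"
    by (rule X.increasing[OF gamma_process_one(1)[OF assms(4) pos]])
  interpret S: levy_subordination M X T Y
    using inc_X inc_T assms(6,10) by unfold_locales
  interpret G: gnbc_finite \<pi> \<theta>
    using law assms(7,8) by unfold_locales (auto simp: LGNBC_law_def GNBC_pair_def)

  have [measurable]: "f \<in> borel_measurable borel" unfolding f by measurable
  define \<kappa> where "\<kappa> = c * \<alpha> - \<theta>"
  have \<kappa>: "0 \<le> \<kappa>" using assms(9) by (simp add: \<kappa>_def)
  define \<tau>\<^sub>1 \<tau>\<^sub>2 where "\<tau>\<^sub>1 = distr \<pi> borel f" and "\<tau>\<^sub>2 = density (return borel \<beta>) (\<lambda>_. ennreal \<kappa>)"
  \<comment> \<open>The scaled point mass becomes a density, for which integrals of vector-valued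
    functions are available.\<close>
  have \<tau>_eq: "\<tau> = measure_plus \<tau>\<^sub>1 \<tau>\<^sub>2"
    unfolding \<tau> \<tau>\<^sub>1_def \<tau>\<^sub>2_def \<kappa>_def scale_measure_eq_density ..
  have sets12 [measurable_cong, simp]: "sets \<tau>\<^sub>1 = sets borel" "sets \<tau>\<^sub>2 = sets borel" "sets \<tau> = sets borel"
    by (simp_all add: \<tau>\<^sub>1_def \<tau>\<^sub>2_def \<tau>_eq)
  have sets21: "sets \<tau>\<^sub>2 = sets \<tau>\<^sub>1" by simp
  have emeasure_\<tau>: "emeasure \<tau> A = emeasure \<pi> (f -` A) + ennreal \<kappa> * indicator A \<beta>" if "A \<in> sets borel" for A
    using that unfolding \<tau>_eq
    by (simp add: emeasure_measure_plus sets21)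
      (simp add: \<tau>\<^sub>1_def \<tau>\<^sub>2_def emeasure_distr flip: scale_measure_eq_density)
  have mass: "emeasure \<tau> UNIV = ennreal (c * \<alpha>)"
    using \<kappa> assms(8) by (simp add: emeasure_\<tau> G.emeasure_pi_UNIV ennreal_plus[symmetric] \<kappa>_def del: ennreal_plus)
  have c\<alpha>: "0 < c * \<alpha>" using assms(8,9) by linarith
  \<comment> \<open>As \<pi> has no atom at 1, almost every \<open>f q\<close> is strictly positive;
    the extra atom sits at the endpoint \<beta>, inside the interval.\<close>
  have outside: "emeasure \<tau> (- {0<..\<beta>}) = 0"
  proof -
    have "AE q in \<pi>. q \<notin> f -` (- {0<..\<beta>})"
      using G.AE_pi by eventually_elim (use pos in \<open>auto simp: f mult_left_le\<close>)
    moreover have "f -` (- {0<..\<beta>}) \<in> sets \<pi>"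
      using measurable_sets[of f borel borel "- {0<..\<beta>}"] by (simp add: G.sets_pi)
    ultimately have "emeasure \<pi> (f -` (- {0<..\<beta>})) = 0"
      by (subst (asm) AE_iff_null_sets[symmetric]) auto
    then show ?thesis using pos by (simp add: emeasure_\<tau>)
  qed
  have int_1: "integrable \<tau>\<^sub>1 (h :: real \<Rightarrow> 'b::{banach, second_countable_topology}) \<longleftrightarrow> integrable \<pi> (\<lambda>q. h (f q))"
    "(LINT x|\<tau>\<^sub>1. h x) = (LINT q|\<pi>. h (f q))" if "h \<in> borel_measurable borel" for h
    using that unfolding \<tau>\<^sub>1_def by (auto simp: integrable_distr_eq integral_distr)
  have int_2: "integrable \<tau>\<^sub>2 (h :: real \<Rightarrow> 'b::{banach, second_countable_topology})"
    "(LINT x|\<tau>\<^sub>2. h x) = \<kappa> *\<^sub>R h \<beta>" if [measurable]: "h \<in> borel_measurable borel" for h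
  proof -
    interpret R: prob_space "return borel \<beta>" by (rule prob_space_return) simp
    have "integrable (return borel \<beta>) h"
      by (rule R.integrable_const_bound[where B="norm (h \<beta>)"]) (auto simp: AE_return)
    then show "integrable \<tau>\<^sub>2 h"
      unfolding \<tau>\<^sub>2_def using \<kappa> by (subst integrable_density) auto
    show "(LINT x|\<tau>\<^sub>2. h x) = \<kappa> *\<^sub>R h \<beta>"
      unfolding \<tau>\<^sub>2_def using \<kappa> by (subst integral_density) (auto simp: integral_return)
  qed
  interpret B: bounded_thorin_measure \<tau> \<beta>
  proof (intro bounded_thorin_measure.intro bounded_thorin_measure_axioms.intro)
    show "finite_measure \<tau>"
      using mass sets_eq_imp_space_eq[OF sets12(3)] by (intro finite_measureI) simp
    show "sets \<tau> = sets borel" by simp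
    have "AE x in \<tau>. x \<notin> - {0<..\<beta>}" using outside by (intro AE_not_in) (simp add: null_sets_def)
    then show "AE x in \<tau>. 0 < x \<and> x \<le> \<beta>" by eventually_elim simp
    \<comment> \<open>Up to the constant ln \<beta>, integrability of ln under the image measure is
      that of ln (1 - q) under \<pi>.\<close>
    have "integrable \<pi> (\<lambda>q. ln \<beta> + ln (1 - q))"
      by (intro Bochner_Integration.integrable_add G.integrable_const G.integrable_ln_pi)
    moreover have "AE q in \<pi>. ln (f q) = ln \<beta> + ln (1 - q)"
      using G.AE_pi by eventually_elim (use pos in \<open>simp add: f ln_mult_pos\<close>)
    ultimately have "integrable \<pi> (\<lambda>q. ln (f q))"
      by (subst integrable_cong_AE) auto
    then show "integrable \<tau> ln"
      unfolding \<tau>_eq integrable_measure_plus[OF sets21] by (simp add: int_1 int_2)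
    show "0 < measure \<tau> UNIV" using mass c\<alpha> by (simp add: measure_def)
  qed
  have mass': "measure \<tau> UNIV = c * \<alpha>" using mass c\<alpha> by (simp add: measure_def)

  have [measurable]: "Y 1 \<in> borel_measurable M" by (rule S.measurable_Y) simp
  have Y1: "real_distribution (distr M borel (Y 1))" by (rule X.real_distribution_distr) measurable
  \<comment> \<open>The Laplace transform is available only where Re L = ln (norm u) is positive,
    that is for z different from 0. At z = 0 both sides are 1.\<close>
  have char_Y: "char (distr M borel (Y 1)) z = exp (- B.thorin_exponent z)" for z
  proof (cases "z = 0")
    case True
    then show ?thesis using real_distribution.char_zero[OF Y1] by (simp add: B.thorin_exponent_def)
  next
    case False
    define u where "u = 1 - \<i> * complex_of_real (z / \<beta>)"
    define L where "L = Ln u"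
    have "Re u = 1" by (simp add: u_def)
    then have u0: "u \<noteq> 0" by auto
    have "Im u \<noteq> 0" using False pos by (simp add: u_def)
    then have "1 < norm u" using \<open>Re u = 1\<close> unfolding cmod_def by simp
    then have "0 < Re L" using u0 by (simp add: L_def Re_Ln)
    then have l: "0 < Re (of_real \<alpha> * L)" using pos by simp
    have char_X: "char (distr M borel (X s)) z = exp (- (of_real s * (of_real \<alpha> * L)))" if "0 \<le> s" for s
      unfolding L_def u_def
    proof (rule X.char_exponent[where \<psi>="\<lambda>z. of_real \<alpha> * Ln (1 - \<i> * of_real (z / \<beta>))", OF _ _ _ that])
      show "continuous_on UNIV (\<lambda>z. of_real \<alpha> * Ln (1 - \<i> * complex_of_real (z / \<beta>)))"
        by (intro continuous_on_mult continuous_on_const continuous_on_Ln_one_minus pos)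
    qed (auto intro: gamma_process_one(2)[OF assms(4) pos] simp del: of_real_divide)
    have "char (distr M borel (Y 1)) z = (LINT \<omega>|M. exp (- (of_real (T 1 \<omega>) * (of_real \<alpha> * L))))"
      by (rule S.char_subordination[OF _ char_X]) auto
    also have "\<dots> = (LINT x|distr M borel (T 1). exp (- (of_real \<alpha> * L * complex_of_real x)))"
      by (subst integral_distr) (auto simp: mult.commute)
    also have "\<dots> = exp (- (of_real c * (of_real \<alpha> * L)) + G.gnbc_exponent (exp (- (of_real (1 / \<alpha>) * (of_real \<alpha> * L)))))"
      by (rule G.laplace_LGNBC[OF law l])
    \<comment> \<open>The scale 1/\<alpha> of the subordinator cancels the shape \<alpha>, so the
      generating function is evaluated at exp (- L) = 1/u.\<close>
    also have "of_real (1 / \<alpha>) * (of_real \<alpha> * L) = L" using pos by simp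
    also have "exp (- L) = 1 / u" using u0 by (simp add: L_def exp_minus divide_inverse)
    also have "G.gnbc_exponent (1 / u) = of_real \<theta> * L - (LINT q|\<pi>. Ln (1 - \<i> * of_real (z / f q)))"
      unfolding L_def f by (rule G.gnbc_exponent_gamma[OF pos(2) u_def False])
    \<comment> \<open>The term \<theta> L reduces the drift contribution c \<alpha> L to \<kappa> L,
      the exponent of the atom of mass \<kappa> at \<beta>.\<close>
    also have "- (of_real c * (of_real \<alpha> * L)) + \<dots> = - ((LINT q|\<pi>. Ln (1 - \<i> * of_real (z / f q))) + \<kappa> *\<^sub>R L)"
      by (simp add: \<kappa>_def scaleR_conv_of_real algebra_simps)
    also have "(LINT q|\<pi>. Ln (1 - \<i> * of_real (z / f q))) + \<kappa> *\<^sub>R L = B.thorin_exponent z"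
    proof -
      have [measurable]: "(\<lambda>x. Ln (1 - \<i> * of_real (z / x))) \<in> borel_measurable borel" by measurable
      show ?thesis
        unfolding B.thorin_exponent_def L_def u_def
        using integral_measure_plus[OF sets21 B.integrable_thorin_exponent[of z, unfolded \<tau>_eq]]
        by (simp add: \<tau>_eq int_1 int_2 del: of_real_divide)
    qed
    finally show ?thesis .
  qed

  have "thorin_subordinator M Y"
    unfolding thorin_subordinator_def
    using S.levy_process_Y S.increasing_Y B.weak_limit_gamma[OF Y1 char_Y] by blast
  moreover have "thorin_triplet c' \<tau> (distr M borel (Y 1))"
    unfolding c' by (rule B.thorin_triplet[OF char_Y])
  moreover have "measure_support \<tau> \<subseteq> {0..\<beta>}"
  proof
    fix x assume x: "x \<in> measure_support \<tau>"
    show "x \<in> {0..\<beta>}"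
    proof (rule ccontr)
      assume "x \<notin> {0..\<beta>}"
      moreover have "open (- {0..\<beta>})" by (intro open_Compl closed_real_atLeastAtMost)
      ultimately have "0 < emeasure \<tau> (- {0..\<beta>})"
        using x unfolding measure_support_def by blast
      also have "\<dots> \<le> emeasure \<tau> (- {0<..\<beta>})" by (rule emeasure_mono) auto
      finally show False using outside by simp
    qed
  qed
  \<comment> \<open>The limit of \<open>levy_k\<close> at 0 is the total mass of \<tau>, namely
    \<theta> + (c \<alpha> - \<theta>).\<close>
  moreover have "BG0 M (c * \<alpha>) Y"
    unfolding BG0_def
  proof (intro conjI exI[of _ B.levy_measure] exI[of _ B.levy_k])
    show "(B.levy_k \<longlongrightarrow> c * \<alpha>) (at_right 0)" using B.levy_k_tendsto by (simp add: mass')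
  qed (use S.levy_process_Y S.increasing_Y B.selfdecomposable_thorin[OF char_Y] c\<alpha>
      B.levy_measure_of_thorin[OF char_Y] B.blumenthal_getoor_index_levy_measure
      B.levy_k_nonneg B.levy_k_antimono B.levy_measure_def in auto)
  ultimately show ?thesis by blast
qed

end
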